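(* Assume $\rho_{\min}:=\min_{s\in\mathcal S}\rho(s)>0$ and $|\mathcal A|\ge2$. Let $\lambda>0$, $$\tau_\lambda=\min\Big(\tfrac13\exp\Big(-\frac{16+8\gamma\lambda\log|\mathcal A|}{\lambda(1-\gamma)^2\rho_{\min}}\Big),\frac1{3^8|\mathcal A|^4}\Big),\qquad \underline{\tilde\mu}=\frac{\lambda(1-\gamma)\rho_{\min}^2\,\tau_\lambda^2}{|\mathcal S|}.$$ Run RS-FedPG with projection operator $\mathcal{T}_{\tau_\lambda}$, $H$ local steps, batches of $B$ trajectories of length $T$, and step size $\eta>0$ with $\eta HL_2\le1/74$. Then $$\begin{aligned}\tilde J_\lambda^\star-\mathbb{E}[\tilde J_\lambda(\theta^R)]\le{}&\Big(1-\frac{\eta H\underline{\tilde\mu}}2\Big)^R\big(\tilde J_\lambda^\star-\tilde J_\lambda(\theta^0)\big)+\frac{3\eta L_2\sigma_2^2}{M\underline{\tilde\mu}}+\frac{\zeta^2}{\underline{\tilde\mu}}+\frac{4\beta^2}{\underline{\tilde\mu}}+\frac{8\cdot12^3\,\eta^4L_3^2H(H-1)\sigma_4^4}{\underline{\tilde\mu}},\end{aligned}$$ where $$L_2=\frac{8+\lambda(4+8\log|\mathcal A|)}{(1-\gamma)^3},\quad L_3=\frac{480+832\lambda\log|\mathcal A|}{(1-\gamma)^4},\quad \zeta^2=\frac{56(1+\lambda\log|\mathcal A|)^2\varepsilon_{\mathsf P}^2}{(1-\gamma)^6}+\frac{36\,\varepsilon_{\mathsf r}^2}{(1-\gamma)^4},$$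 $$\beta=\frac{2(1+\lambda\log|\mathcal A|)\gamma^T}{1-\gamma}\Big(T+\frac1{1-\gamma}\Big),\quad\sigma_2^2=\frac{12+24\lambda^2(\log|\mathcal A|)^2}{B(1-\gamma)^4},\quad\sigma_4^4=\frac{1120+4480\lambda^4(\log|\mathcal A|)^4}{B^2(1-\gamma)^8}.$$
   Context: Setting. $M$ agents; agent $c\in[M]=\{1,\dots,M\}$ has a finite MDP $(\mathcal S,\mathcal A,\gamma,\mathsf P_c,\mathsf r_c,\rho)$ with common finite state space $\mathcal S$, finite action space $\mathcal A$, discount $\gamma\in(0,1)$ and initial distribution $\rho$, its own transition kernel $\mathsf P_c$, and its own reward $\mathsf r_c:\mathcal S\times\mathcal A\to[0,1]$. Heterogeneity: $\varepsilon_{\mathsf P}=\max_{s,a}\max_{c,c'}\|\mathsf P_c(\cdot|s,a)-\mathsf P_{c'}(\cdot|s,a)\|_1$ and $\varepsilon_{\mathsf r}=\max_{c,c'}\|\mathsf r_c-\mathsf r_{c'}\|_\infty$. Softmax policies: for $\theta\in\mathbb{R}^{\mathcal S\times\mathcal A}$, $\pi_\theta(a|s)=e^{\theta(s,a)}/\sum_{a'}e^{\theta(s,a')}$. Entropy-regularized objective: $\tilde J_{c,\lambda}(\theta)=\mathbb{E}[\sum_{t\ge0}\gamma^t(\mathsf r_c(S^t,A^t)-\lambda\log\pi_\theta(A^t|S^t))]$ with $S^0\sim\rho$, $A^t\sim\pi_\theta(\cdot|S^t)$, $S^{t+1}\sim\mathsf P_c(\cdot|S^t,A^t)$; $\tilde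 J_\lambda=\frac1M\sum_c\tilde J_{c,\lambda}$; $\tilde J_\lambda^\star=\frac1M\sum_c\sup_\theta\tilde J_{c,\lambda}(\theta)$. Projection operator. For a policy $\pi$, $s\in\mathcal S$ and $0<\tau<1/(2|\mathcal A|^2)$, let $\mathcal A_\tau^\pi(s)=\{a:\pi(a|s)\le\tau/2\}$ and let $a_{\max}^\pi(s)\in\operatorname{argmax}_a\pi(a|s)$ (chosen at random in case of ties). Define the policy $\mathcal U_\tau(\pi)$ by $\mathcal U_\tau(\pi)(a|s)=\tau$ if $a\in\mathcal A^\pi_\tau(s)$; $\mathcal U_\tau(\pi)(a|s)=\pi(a|s)-\sum_{b\in\mathcal A_\tau^\pi(s)}(\tau-\pi(b|s))$ if $a=a_{\max}^\pi(s)$; and $\mathcal U_\tau(\pi)(a|s)=\pi(a|s)$ otherwise. Define $\mathcal T_\tau:\mathbb{R}^{\mathcal S\times\mathcal A}\to\mathbb{R}^{\mathcal S\times\mathcal A}$ by $\mathcal T_\tau(\theta)(s,a)=\log\big(\mathcal U_\tau(\pi_\theta)(a|s)\big)$, so $\pi_{\mathcal T_\tau(\theta)}=\mathcal U_\tau(\pi_\theta)$. Algorithm RS-FedPG. Given a deterministic $\theta^0$, for $r=0,\dots,R-1$: each agent sets $\theta_c^{r,0}=\theta^r$; for $h=0,\dots,H-1$ it samples, with fresh randomness independent across agents, $B$ i.i.d. trajectories $z=(s_b^t,a_b^t)_{0\le t\le T-1,\,1\le b\le B}$ of length $T$ from its own MDP (initial distribution $\rho$) with policy $\pi_{\theta_c^{r,h}}$,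 and sets $\theta_c^{r,h+1}=\theta_c^{r,h}+\eta\,g_c^z(\theta_c^{r,h})$ where $$g_c^z(\theta)=\frac1B\sum_{b=1}^B\sum_{t=0}^{T-1}\gamma^t\Big(\sum_{\ell=0}^t\nabla_\theta\log\pi_\theta(a_b^\ell|s_b^\ell)\Big)\big[\mathsf r_c(s_b^t,a_b^t)-\lambda\log\pi_\theta(a_b^t|s_b^t)\big].$$ Then $\bar\theta^{r+1}=\frac1M\sum_{c=1}^M\theta_c^{r,H}$ and $\theta^{r+1}=\mathcal T_{\tau_\lambda}(\bar\theta^{r+1})$. *)

theory Defs
  imports "HOL-Probability.Probability"
begin

type_synonym ('s, 'a) param = "real ^ ('s \<times> 'a)"
type_synonym ('s, 'a) kernel = "'s \<Rightarrow> 'a \<Rightarrow> 's pmf"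
type_synonym ('s, 'a) reward = "'s \<Rightarrow> 'a \<Rightarrow> real"
type_synonym ('s, 'a) traj = "nat \<Rightarrow> 's \<times> 'a"

definition softmax :: "('s::finite, 'a::finite) param \<Rightarrow> 's \<Rightarrow> 'a \<Rightarrow> real" where
  "softmax \<theta> s a = exp (\<theta> $ (s, a)) / (\<Sum>a'\<in>UNIV. exp (\<theta> $ (s, a')))"

definition softmax_pmf :: "('s::finite, 'a::finite) param \<Rightarrow> 's \<Rightarrow> 'a pmf" where
  "softmax_pmf \<theta> s = embed_pmf (softmax \<theta> s)"

lemma softmax_pos: "softmax \<theta> s a > 0"
  unfolding softmax_def by (intro divide_pos_pos sum_pos) auto

lemma sum_softmax: "(\<Sum>a\<in>UNIV. softmax \<theta> s a) = 1"
proof -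
  have "(\<Sum>a'\<in>UNIV. exp (\<theta> $ (s, a'))) > 0"
    by (intro sum_pos) auto
  then show ?thesis
    unfolding softmax_def by (simp add: sum_divide_distrib[symmetric])
qed

lemma pmf_softmax_pmf: "pmf (softmax_pmf \<theta> s) a = softmax \<theta> s a"
  unfolding softmax_pmf_def
proof (rule pmf_embed_pmf)
  show "0 \<le> softmax \<theta> s x" for x
    using softmax_pos[of \<theta> s x] by simp
  show "(\<integral>\<^sup>+x. ennreal (softmax \<theta> s x) \<partial>count_space UNIV) = 1"
    by (simp add: nn_integral_count_space_finite sum_ennreal softmax_pos less_imp_le sum_softmax)
qed

text \<open>Conditional law of the \<open>n\<close>-th state-action pair given the past. Only the value
  \<open>\<omega> (n - 1)\<close> of the history \<open>\<omega>\<close> is used, and nothing of it when \<open>n = 0\<close>.\<close>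

definition step_pmf ::
  "'s pmf \<Rightarrow> ('s, 'a) kernel \<Rightarrow> ('s \<Rightarrow> 'a pmf) \<Rightarrow> nat \<Rightarrow> ('s, 'a) traj \<Rightarrow> ('s \<times> 'a) pmf" where
  "step_pmf \<rho> P \<pi> n \<omega> = do {
     s \<leftarrow> (case n of 0 \<Rightarrow> \<rho> | Suc m \<Rightarrow> P (fst (\<omega> m)) (snd (\<omega> m)));
     a \<leftarrow> \<pi> s;
     return_pmf (s, a)
   }"

text \<open>Law of the infinite trajectory of state-action pairs, by the Ionescu-Tulcea theorem.\<close>

definition traj_measure ::
  "'s pmf \<Rightarrow> ('s, 'a) kernel \<Rightarrow> ('s \<Rightarrow> 'a pmf) \<Rightarrow> ('s, 'a) traj measure" where
  "traj_measure \<rho> P \<pi> =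
     projective_family.lim UNIV
       (Ionescu_Tulcea.CI (\<lambda>n \<omega>. measure_pmf (step_pmf \<rho> P \<pi> n \<omega>)) (\<lambda>_. count_space UNIV))
       (\<lambda>_. count_space UNIV)"

text \<open>Law of the first \<open>T\<close> state-action pairs; coordinates \<open>\<ge> T\<close> are dummies.\<close>

primrec traj_pmf ::
  "'s pmf \<Rightarrow> ('s, 'a) kernel \<Rightarrow> ('s \<Rightarrow> 'a pmf) \<Rightarrow> nat \<Rightarrow> ('s, 'a) traj pmf" where
  "traj_pmf \<rho> P \<pi> 0 = return_pmf (\<lambda>_. undefined)"
| "traj_pmf \<rho> P \<pi> (Suc T) = do {
     \<omega> \<leftarrow> traj_pmf \<rho> P \<pi> T;
     x \<leftarrow> step_pmf \<rho> P \<pi> T \<omega>;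
     return_pmf (fun_upd \<omega> T x)
   }"

text \<open>Sanity checks: the kernels satisfy the hypotheses of the Ionescu-Tulcea theorem, and the
  first \<open>n\<close> coordinates of \<open>traj_measure\<close> are distributed as \<open>traj_pmf\<close> with horizon \<open>n\<close>.\<close>

lemma Ionescu_Tulcea_step_pmf:
  fixes \<rho> :: "'s::finite pmf" and P :: "('s, 'a::finite) kernel"
  shows "Ionescu_Tulcea (\<lambda>n \<omega>. measure_pmf (step_pmf \<rho> P \<pi> n \<omega>)) (\<lambda>_. count_space UNIV)"
proof
  fix n :: nat
  show "(\<lambda>\<omega>. measure_pmf (step_pmf \<rho> P \<pi> n \<omega>))
      \<in> measurable (PiM {0..<n} (\<lambda>_. count_space UNIV)) (subprob_algebra (count_space UNIV))"
  proof (cases n)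
    case 0
    then show ?thesis
      by (simp add: step_pmf_def measure_pmf_in_subprob_algebra)
  next
    case (Suc m)
    define K where "K x = measure_pmf (do { s \<leftarrow> P (fst x) (snd x); a \<leftarrow> \<pi> s; return_pmf (s, a) })" for x
    have 1: "(\<lambda>\<omega>. \<omega> m) \<in> measurable (PiM {0..<n} (\<lambda>_. count_space UNIV)) (count_space (UNIV :: ('s \<times> 'a) set))"
      using Suc by (intro measurable_component_singleton) auto
    have 2: "K \<in> measurable (count_space UNIV) (subprob_algebra (count_space UNIV))"
      by (simp add: K_def measure_pmf_in_subprob_algebra)
    from measurable_compose[OF 1 2] show ?thesis
      using Suc by (simp add: step_pmf_def K_def)
  qed
qed

lemma nn_integral_traj_measure:
  fixes \<rho> :: "'s::finite pmf" and P :: "('s, 'a::finite) kernel"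
  assumes f: "f \<in> borel_measurable (PiM {0..<n} (\<lambda>_. count_space UNIV))"
  shows "(\<integral>\<^sup>+\<omega>. f (restrict \<omega> {0..<n}) \<partial>traj_measure \<rho> P \<pi>) = (\<integral>\<^sup>+\<omega>. f \<omega> \<partial>traj_pmf \<rho> P \<pi> n)"
proof -
  let ?N = "\<lambda>n. PiM {0..<n} (\<lambda>_::nat. count_space (UNIV :: ('s \<times> 'a) set))"
  interpret IT: Ionescu_Tulcea "\<lambda>n \<omega>. measure_pmf (step_pmf \<rho> P \<pi> n \<omega>)" "\<lambda>_. count_space UNIV"
    by (rule Ionescu_Tulcea_step_pmf)
  have u: "(\<lambda>_. undefined) \<in> space (?N 0)"
    by (simp add: space_PiM)
  have C: "(\<integral>\<^sup>+\<omega>. f \<omega> \<partial>IT.C 0 n (\<lambda>_. undefined)) = (\<integral>\<^sup>+\<omega>. f \<omega> \<partial>traj_pmf \<rho> P \<pi> n)"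
    if "f \<in> borel_measurable (?N n)" for f n
    using that
  proof (induction n arbitrary: f)
    case 0
    then show ?case
      using u by (simp add: nn_integral_return nn_integral_return_pmf del: atLeastLessThan0)
  next
    case (Suc n)
    let ?g = "\<lambda>\<omega>. \<integral>\<^sup>+x. f x \<partial>IT.eP n \<omega>"
    have m: "?g \<in> borel_measurable (?N n)"
      by (rule measurable_compose[OF IT.measurable_eP nn_integral_measurable_subprob_algebra])
         (use Suc.prems in simp)
    have sC: "sets (IT.C 0 n (\<lambda>_. undefined)) = sets (?N n)"
      using IT.sets_C[OF u, of n] by simp
    have "(\<integral>\<^sup>+\<omega>. f \<omega> \<partial>IT.C 0 (Suc n) (\<lambda>_. undefined)) = (\<integral>\<^sup>+\<omega>. ?g \<omega> \<partial>IT.C 0 n (\<lambda>_. undefined))"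
      unfolding IT.C.simps add_0
      by (rule nn_integral_bind[where B="?N (Suc n)"])
         (use Suc.prems IT.measurable_eP[of n] in \<open>simp_all add: measurable_cong_sets[OF sC refl]\<close>)
    also have "\<dots> = (\<integral>\<^sup>+\<omega>. ?g \<omega> \<partial>traj_pmf \<rho> P \<pi> n)"
      by (rule Suc.IH[OF m])
    also have "\<dots> = (\<integral>\<^sup>+\<omega>. (\<integral>\<^sup>+x. f (fun_upd \<omega> n x) \<partial>step_pmf \<rho> P \<pi> n \<omega>) \<partial>traj_pmf \<rho> P \<pi> n)"
    proof (rule nn_integral_cong_AE, rule AE_pmfI)
      fix \<omega> assume "\<omega> \<in> set_pmf (traj_pmf \<rho> P \<pi> n)"
      then have "\<forall>i\<ge>n. \<omega> i = undefined"
        by (induction n arbitrary: \<omega>) (auto simp: set_bind_pmf)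
      then have "\<omega> \<in> space (?N n)"
        by (auto simp: space_PiM PiE_iff extensional_def)
      then show "?g \<omega> = (\<integral>\<^sup>+x. f (fun_upd \<omega> n x) \<partial>step_pmf \<rho> P \<pi> n \<omega>)"
        by (rule IT.nn_integral_eP) (rule Suc.prems)
    qed
    also have "\<dots> = (\<integral>\<^sup>+\<omega>. f \<omega> \<partial>traj_pmf \<rho> P \<pi> (Suc n))"
      by simp
    finally show ?case .
  qed
  have r: "(\<lambda>\<omega>. restrict \<omega> {0..<n}) \<in> measurable IT.PF.lim (?N n)"
    unfolding measurable_cong_sets[OF IT.PF.sets_lim refl] by (rule measurable_restrict_subset) simp
  have "(\<integral>\<^sup>+\<omega>. f (restrict \<omega> {0..<n}) \<partial>traj_measure \<rho> P \<pi>) = (\<integral>\<^sup>+\<omega>. f \<omega> \<partial>IT.CI {0..<n})"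
    using f unfolding traj_measure_def
    by (subst IT.distr_lim[symmetric]) (simp_all add: nn_integral_distr[OF r])
  also have "\<dots> = (\<integral>\<^sup>+\<omega>. f \<omega> \<partial>IT.C 0 n (\<lambda>_. undefined))"
  proof (rule arg_cong[where f="\<lambda>M. nn_integral M f"], rule measure_eqI)
    show "sets (IT.CI {0..<n}) = sets (IT.C 0 n (\<lambda>_. undefined))"
      using IT.sets_C[OF u, of n] by (simp add: IT.CI_def)
    show "emeasure (IT.CI {0..<n}) X = emeasure (IT.C 0 n (\<lambda>_. undefined)) X"
      if "X \<in> sets (IT.CI {0..<n})" for X
    proof -
      have X: "X \<in> sets (?N n)"
        using that by (simp add: IT.CI_def)
      have "IT.PF.emb {0..<n} {0..<n} X = X"
        using sets.sets_into_space[OF X] by (intro prod_emb_id) (simp only: space_PiM)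
      then show ?thesis
        using IT.emeasure_CI[OF subset_refl X] by simp
    qed
  qed
  also have "\<dots> = (\<integral>\<^sup>+\<omega>. f \<omega> \<partial>traj_pmf \<rho> P \<pi> n)"
    by (rule C[OF f])
  finally show ?thesis .
qed

definition ent_return ::
  "real \<Rightarrow> real \<Rightarrow> ('s::finite, 'a::finite) reward \<Rightarrow> ('s, 'a) param \<Rightarrow> ('s, 'a) traj \<Rightarrow> real" where
  "ent_return \<gamma> lam r \<theta> \<omega> =
     (\<Sum>t. \<gamma> ^ t * (case \<omega> t of (s, a) \<Rightarrow> r s a - lam * ln (softmax \<theta> s a)))"

definition J_agent ::
  "real \<Rightarrow> real \<Rightarrow> 's pmf \<Rightarrow> ('s::finite, 'a::finite) kernel \<Rightarrow> ('s, 'a) reward \<Rightarrow> ('s, 'a) param \<Rightarrow> real"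
  where
  "J_agent \<gamma> lam \<rho> P r \<theta> =
     (LINT \<omega>|traj_measure \<rho> P (softmax_pmf \<theta>). ent_return \<gamma> lam r \<theta> \<omega>)"

definition J_avg ::
  "nat \<Rightarrow> real \<Rightarrow> real \<Rightarrow> 's pmf \<Rightarrow> (nat \<Rightarrow> ('s::finite, 'a::finite) kernel) \<Rightarrow> (nat \<Rightarrow> ('s, 'a) reward)
     \<Rightarrow> ('s, 'a) param \<Rightarrow> real" where
  "J_avg M \<gamma> lam \<rho> P r \<theta> = (1 / real M) * (\<Sum>c\<in>{1..M}. J_agent \<gamma> lam \<rho> (P c) (r c) \<theta>)"

definition J_star ::
  "nat \<Rightarrow> real \<Rightarrow> real \<Rightarrow> 's pmf \<Rightarrow> (nat \<Rightarrow> ('s::finite, 'a::finite) kernel) \<Rightarrow> (nat \<Rightarrow> ('s, 'a) reward)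
     \<Rightarrow> real" where
  "J_star M \<gamma> lam \<rho> P r = (1 / real M) * (\<Sum>c\<in>{1..M}. SUP \<theta>. J_agent \<gamma> lam \<rho> (P c) (r c) \<theta>)"

definition eps_P :: "nat \<Rightarrow> (nat \<Rightarrow> ('s::finite, 'a::finite) kernel) \<Rightarrow> real" where
  "eps_P M P = (MAX s. MAX a. MAX c\<in>{1..M}. MAX c'\<in>{1..M}.
     (\<Sum>s'\<in>UNIV. \<bar>pmf (P c s a) s' - pmf (P c' s a) s'\<bar>))"

definition eps_r :: "nat \<Rightarrow> (nat \<Rightarrow> ('s::finite, 'a::finite) reward) \<Rightarrow> real" where
  "eps_r M r = (MAX c\<in>{1..M}. MAX c'\<in>{1..M}. MAX s. MAX a. \<bar>r c s a - r c' s a\<bar>)"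

definition low_actions :: "real \<Rightarrow> ('s \<Rightarrow> 'a \<Rightarrow> real) \<Rightarrow> 's \<Rightarrow> 'a set" where
  "low_actions \<tau> \<pi> s = {a. \<pi> s a \<le> \<tau> / 2}"

text \<open>The argument \<open>amax\<close> is the selected maximizer of \<open>\<pi> s\<close> in each state \<open>s\<close>.\<close>

definition proj_policy ::
  "real \<Rightarrow> ('s \<Rightarrow> 'a) \<Rightarrow> ('s \<Rightarrow> 'a \<Rightarrow> real) \<Rightarrow> 's \<Rightarrow> 'a \<Rightarrow> real" where
  "proj_policy \<tau> amax \<pi> s a =
     (if a \<in> low_actions \<tau> \<pi> s then \<tau>
      else if a = amax s then \<pi> s a - (\<Sum>b\<in>low_actions \<tau> \<pi> s. \<tau> - \<pi> s b)
      else \<pi> s a)"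

definition proj_param ::
  "real \<Rightarrow> ('s \<Rightarrow> 'a) \<Rightarrow> ('s::finite, 'a::finite) param \<Rightarrow> ('s, 'a) param" where
  "proj_param \<tau> amax \<theta> = (\<chi> p. case p of (s, a) \<Rightarrow> ln (proj_policy \<tau> amax (softmax \<theta>) s a))"

text \<open>A random tie-breaking rule: for each policy, a joint law (over all states) of the selected
  maximizers. Which law is used in case of ties is left open.\<close>

definition argmax_rule :: "(('s \<Rightarrow> 'a \<Rightarrow> real) \<Rightarrow> ('s \<Rightarrow> 'a) pmf) \<Rightarrow> bool" where
  "argmax_rule tie \<longleftrightarrow>
     (\<forall>\<pi>. \<forall>amax\<in>set_pmf (tie \<pi>). \<forall>s. is_arg_max (\<pi> s) (\<lambda>_. True) (amax s))"

definition gradient :: "('b::real_inner \<Rightarrow> real) \<Rightarrow> 'b \<Rightarrow> 'b" where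
  "gradient f x = (THE D. GDERIV f x :> D)"

definition grad_est ::
  "real \<Rightarrow> real \<Rightarrow> ('s::finite, 'a::finite) reward \<Rightarrow> nat \<Rightarrow> nat \<Rightarrow> ('s, 'a) traj list
     \<Rightarrow> ('s, 'a) param \<Rightarrow> ('s, 'a) param" where
  "grad_est \<gamma> lam r B T z \<theta> =
     (1 / real B) *\<^sub>R (\<Sum>b<B. \<Sum>t<T.
        (\<gamma> ^ t * (case (z ! b) t of (s, a) \<Rightarrow> r s a - lam * ln (softmax \<theta> s a))) *\<^sub>R
        (\<Sum>l\<le>t. case (z ! b) l of (s, a) \<Rightarrow> gradient (\<lambda>\<theta>'. ln (softmax \<theta>' s a)) \<theta>))"

primrec local_steps ::
  "real \<Rightarrow> real \<Rightarrow> 's pmf \<Rightarrow> ('s::finite, 'a::finite) kernel \<Rightarrow> ('s, 'a) reward \<Rightarrow> nat \<Rightarrow> nat \<Rightarrow> real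
     \<Rightarrow> ('s, 'a) param \<Rightarrow> nat \<Rightarrow> ('s, 'a) param pmf" where
  "local_steps \<gamma> lam \<rho> P r B T \<eta> \<theta> 0 = return_pmf \<theta>"
| "local_steps \<gamma> lam \<rho> P r B T \<eta> \<theta> (Suc h) = do {
     \<theta>' \<leftarrow> local_steps \<gamma> lam \<rho> P r B T \<eta> \<theta> h;
     z \<leftarrow> replicate_pmf B (traj_pmf \<rho> P (softmax_pmf \<theta>') T);
     return_pmf (\<theta>' + \<eta> *\<^sub>R grad_est \<gamma> lam r B T z \<theta>')
   }"

definition fed_round ::
  "nat \<Rightarrow> real \<Rightarrow> real \<Rightarrow> 's pmf \<Rightarrow> (nat \<Rightarrow> ('s::finite, 'a::finite) kernel) \<Rightarrow> (nat \<Rightarrow> ('s, 'a) reward)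
     \<Rightarrow> nat \<Rightarrow> nat \<Rightarrow> nat \<Rightarrow> real \<Rightarrow> real \<Rightarrow> (('s \<Rightarrow> 'a \<Rightarrow> real) \<Rightarrow> ('s \<Rightarrow> 'a) pmf)
     \<Rightarrow> ('s, 'a) param \<Rightarrow> ('s, 'a) param pmf" where
  "fed_round M \<gamma> lam \<rho> P r H B T \<eta> \<tau> tie \<theta> = do {
     \<phi> \<leftarrow> Pi_pmf {1..M} 0 (\<lambda>c. local_steps \<gamma> lam \<rho> (P c) (r c) B T \<eta> \<theta> H);
     let \<theta>bar = (1 / real M) *\<^sub>R (\<Sum>c\<in>{1..M}. \<phi> c);
     amax \<leftarrow> tie (softmax \<theta>bar);
     return_pmf (proj_param \<tau> amax \<theta>bar)
   }"

text \<open>Law of the server iterate after the given number of rounds.\<close>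

primrec rs_fedpg ::
  "nat \<Rightarrow> real \<Rightarrow> real \<Rightarrow> 's pmf \<Rightarrow> (nat \<Rightarrow> ('s::finite, 'a::finite) kernel) \<Rightarrow> (nat \<Rightarrow> ('s, 'a) reward)
     \<Rightarrow> nat \<Rightarrow> nat \<Rightarrow> nat \<Rightarrow> real \<Rightarrow> real \<Rightarrow> (('s \<Rightarrow> 'a \<Rightarrow> real) \<Rightarrow> ('s \<Rightarrow> 'a) pmf)
     \<Rightarrow> ('s, 'a) param \<Rightarrow> nat \<Rightarrow> ('s, 'a) param pmf" where
  "rs_fedpg M \<gamma> lam \<rho> P r H B T \<eta> \<tau> tie \<theta>\<^sub>0 0 = return_pmf \<theta>\<^sub>0"
| "rs_fedpg M \<gamma> lam \<rho> P r H B T \<eta> \<tau> tie \<theta>\<^sub>0 (Suc R) = do {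
     \<theta> \<leftarrow> rs_fedpg M \<gamma> lam \<rho> P r H B T \<eta> \<tau> tie \<theta>\<^sub>0 R;
     fed_round M \<gamma> lam \<rho> P r H B T \<eta> \<tau> tie \<theta>
   }"

end

theory Submission
  imports Defs
begin

text \<open>
  Along the local steps of one agent the gradient estimator is, given the past, an unbiased estimate of the
  gradient of the objective truncated at horizon \<open>T\<close>. If \<open>m\<close> and \<open>v\<close> are the mean and the variance of a
  local iterate, then the linear Taylor term of the gradient at \<open>m\<close> has mean zero, so \<open>m\<close> performs gradient
  ascent up to an error of order \<open>L3 * v\<close>; averaging independent agents divides the variance by \<open>M\<close>.
  Smoothness of orders two and three comes from differentiating the law of a trajectory of length \<open>t\<close>, whose
  score has norm at most \<open>sqrt 2 * t\<close>, and summing \<open>\<gamma> ^ t * t\<^sup>2\<close> and \<open>\<gamma> ^ t * t ^ 3\<close>.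

  Hence one round increases the objective by about \<open>\<eta> H / 2\<close> times the squared gradient, and a Lojasiewicz
  inequality, valid while all action probabilities exceed a fraction of the threshold \<open>\<tau>\<close>, turns this into
  a contraction of the gap. The projection never decreases the objective and restores that floor. Only the
  first round may start below it: then the projection alone gains more than the contraction requires.
\<close>

section \<open>Expectations over finitely supported distributions\<close>

text \<open>Three obstacles shape the argument. The entropy bonus
  \<open>- ln (softmax \<theta> s a)\<close> is unbounded in \<theta>, so the integrands admit no
  pointwise bound uniform in \<theta>; but scores have norm at most \<open>sqrt 2\<close> and
  \<open>p * - ln p\<close> is bounded, so averaging over the single action at time \<open>t\<close>
  suffices. The optimum is an average of per-agent suprema, so the gradient inequality is applied to
  each agent with its own supremum, and averaging the squared gradient norms afterwards costs one
  heterogeneity level. The law of an infinite trajectory is awkward to differentiate, so derivatives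
  are taken under finitely supported laws with bounds uniform in the horizon, and the resulting
  inequalities pass to the limit. The level \<open>noise / mu\<close> is the fixed point of the
  recursion of regular rounds; hence a first round charged with this whole level, rather than with
  the share of a single round, does not spoil the later recursion. Regular rounds ask for
  probabilities of at least \<open>0.4 * \<tau>\<close>, whence the factor
  \<open>8 * 0.4\<^sup>2 = 1.28\<close>, while the projection guarantees
  \<open>\<tau> / 2\<close>.\<close>

abbreviation expect :: "'a pmf \<Rightarrow> ('a \<Rightarrow> 'b::euclidean_space) \<Rightarrow> 'b" where
  "expect p f \<equiv> measure_pmf.expectation p f"

lemma integrable_finite_pmf [simp]:
  fixes f :: "'a \<Rightarrow> 'b::euclidean_space"
  shows "finite (set_pmf p) \<Longrightarrow> integrable (measure_pmf p) f"
  by (rule integrable_measure_pmf_finite)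

lemma expect_bind:
  fixes h :: "'c \<Rightarrow> 'b::euclidean_space"
  assumes "finite (set_pmf p)" "\<And>x. x \<in> set_pmf p \<Longrightarrow> finite (set_pmf (f x))"
  shows "expect (p \<bind> f) h = expect p (\<lambda>x. expect (f x) h)"
  using assms
  by (subst pmf_expectation_bind[of "set_pmf p"])
     (auto simp: integral_measure_pmf[of "set_pmf p"])

lemma expect_mono:
  fixes f :: "'a \<Rightarrow> real"
  assumes "finite (set_pmf p)" "\<And>x. x \<in> set_pmf p \<Longrightarrow> f x \<le> g x"
  shows "expect p f \<le> expect p g"
  using assms by (intro integral_mono_AE) (auto simp: AE_measure_pmf_iff)

lemma expect_ge_const:
  fixes f :: "'a \<Rightarrow> real"
  assumes "finite (set_pmf p)" "\<And>x. x \<in> set_pmf p \<Longrightarrow> c \<le> f x"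
  shows "c \<le> expect p f"
  using expect_mono[of p "\<lambda>_. c" f] assms by simp

lemma expect_norm_le:
  fixes f :: "'a \<Rightarrow> 'b::euclidean_space"
  assumes "finite (set_pmf p)" "\<And>x. x \<in> set_pmf p \<Longrightarrow> norm (f x) \<le> g x"
  shows "norm (expect p f) \<le> expect p g"
proof -
  have "norm (expect p f) \<le> expect p (\<lambda>x. norm (f x))"
    by (rule integral_norm_bound)
  also have "\<dots> \<le> expect p g"
    using assms by (rule expect_mono)
  finally show ?thesis .
qed

lemma expect_linear:
  fixes f :: "'a \<Rightarrow> 'b::euclidean_space" and A :: "'b \<Rightarrow> 'c::euclidean_space"
  assumes "finite (set_pmf p)" "linear A"
  shows "expect p (\<lambda>x. A (f x)) = A (expect p f)"
  using assms by (intro integral_bounded_linear) (auto simp: linear_conv_bounded_linear)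

lemma expect_inner_right:
  fixes f :: "'a \<Rightarrow> 'b::euclidean_space"
  assumes "finite (set_pmf p)"
  shows "expect p (\<lambda>x. v \<bullet> f x) = v \<bullet> expect p f"
  using assms by simp

text \<open>Bias-variance decomposition: the cross term is linear in the deviation from the mean and
  integrates to zero. All later additions of variances rest on it.\<close>

lemma expect_norm_sq_centered:
  fixes f :: "'a \<Rightarrow> 'b::euclidean_space"
  assumes p: "finite (set_pmf p)"
  shows "expect p (\<lambda>x. (norm (f x - c))\<^sup>2)
    = expect p (\<lambda>x. (norm (f x - expect p f))\<^sup>2) + (norm (expect p f - c))\<^sup>2"
proof -
  let ?m = "expect p f"
  have "(norm (f x - c))\<^sup>2 = (norm (f x - ?m))\<^sup>2 + 2 * ((?m - c) \<bullet> (f x - ?m)) + (norm (?m - c))\<^sup>2" for x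
  proof -
    have "f x - c = (f x - ?m) + (?m - c)" by simp
    then show ?thesis
      by (simp only: power2_norm_eq_inner inner_add_left inner_add_right)
         (simp add: inner_commute)
  qed
  then have "expect p (\<lambda>x. (norm (f x - c))\<^sup>2)
    = expect p (\<lambda>x. (norm (f x - ?m))\<^sup>2 + 2 * ((?m - c) \<bullet> (f x - ?m)) + (norm (?m - c))\<^sup>2)"
    by simp
  also have "\<dots> = expect p (\<lambda>x. (norm (f x - ?m))\<^sup>2)
      + 2 * expect p (\<lambda>x. (?m - c) \<bullet> (f x - ?m)) + (norm (?m - c))\<^sup>2"
    using p by simp
  also have "expect p (\<lambda>x. (?m - c) \<bullet> (f x - ?m)) = 0"
    using p by (subst expect_inner_right) simp_all
  finally show ?thesis by simp
qed

lemma variance_le_centered: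
  fixes f :: "'a \<Rightarrow> 'b::euclidean_space"
  assumes p: "finite (set_pmf p)"
  shows "expect p (\<lambda>x. (norm (f x - expect p f))\<^sup>2) \<le> expect p (\<lambda>x. (norm (f x - c))\<^sup>2)"
  unfolding expect_norm_sq_centered[OF p, of f c] by simp

lemma variance_le_second_moment:
  fixes f :: "'a \<Rightarrow> 'b::euclidean_space"
  assumes p: "finite (set_pmf p)"
  shows "expect p (\<lambda>x. (norm (f x - expect p f))\<^sup>2) \<le> expect p (\<lambda>x. (norm (f x))\<^sup>2)"
  using variance_le_centered[OF p, of f 0] by simp

section \<open>Sums of independent samples\<close>

lemma finite_set_replicate_pmf: "finite (set_pmf p) \<Longrightarrow> finite (set_pmf (replicate_pmf n p))"
  by (simp add: set_replicate_pmf finite_lists_length_eq conj_commute in_lists_conv_set subset_eq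
      flip: Collect_conj_eq) (rule finite_subset[OF _ finite_lists_length_eq[of "set_pmf p" n]], auto)

text \<open>Peel off the first sample. Given its value, the bias-variance decomposition applied to
  the remaining sum produces their variance plus the squared deviation of the first sample, so
  variances add without an explicit notion of independence. Both claims are proved in one induction
  because the second uses the mean of the remaining sum.\<close>

lemma expect_replicate_pmf_sum:
  fixes f :: "'a \<Rightarrow> 'b::euclidean_space"
  assumes p: "finite (set_pmf p)"
  shows "expect (replicate_pmf n p) (\<lambda>z. \<Sum>b<n. f (z ! b)) = real n *\<^sub>R expect p f"
    and "expect (replicate_pmf n p) (\<lambda>z. (norm ((\<Sum>b<n. f (z ! b)) - real n *\<^sub>R expect p f))\<^sup>2)
      = real n * expect p (\<lambda>x. (norm (f x - expect p f))\<^sup>2)"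
proof (induction n)
  case 0
  { case 1 show ?case by simp next case 2 show ?case by simp }
next
  case (Suc n)
  let ?m = "expect p f" and ?S = "\<lambda>z. \<Sum>b<n. f (z ! b)"
  note fin = p finite_set_replicate_pmf[OF p]
  have bind: "expect (replicate_pmf (Suc n) p) (\<lambda>z. h (\<Sum>b<Suc n. f (z ! b)))
      = expect p (\<lambda>x. expect (replicate_pmf n p) (\<lambda>z. h (f x + ?S z)))" for h :: "'b \<Rightarrow> 'c::euclidean_space"
    using fin by (simp add: expect_bind sum.lessThan_Suc_shift del: sum.lessThan_Suc)
  { case 1
    show ?case
      using bind[of "\<lambda>x. x"] fin Suc.IH(1) by (simp add: algebra_simps)
  next
    case 2
    have inner: "expect (replicate_pmf n p) (\<lambda>z. (norm (f x + ?S z - real (Suc n) *\<^sub>R ?m))\<^sup>2)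
        = real n * expect p (\<lambda>x. (norm (f x - ?m))\<^sup>2) + (norm (f x - ?m))\<^sup>2" for x
    proof -
      have "expect (replicate_pmf n p) (\<lambda>z. (norm (f x + ?S z - real (Suc n) *\<^sub>R ?m))\<^sup>2)
          = expect (replicate_pmf n p) (\<lambda>z. (norm (?S z - (real (Suc n) *\<^sub>R ?m - f x)))\<^sup>2)"
        by (simp add: algebra_simps)
      also have "\<dots> = real n * expect p (\<lambda>x. (norm (f x - ?m))\<^sup>2)
          + (norm (real n *\<^sub>R ?m - (real (Suc n) *\<^sub>R ?m - f x)))\<^sup>2"
        using fin by (subst expect_norm_sq_centered) (simp_all add: Suc.IH)
      finally show ?thesis
        by (simp add: algebra_simps)
    qed
    show ?case
      unfolding bind[of "\<lambda>y. (norm (y - real (Suc n) *\<^sub>R ?m))\<^sup>2"] inner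
      using fin by (simp add: algebra_simps) }
qed

lemma finite_set_Pi_pmf:
  assumes "finite A" "\<And>x. x \<in> A \<Longrightarrow> finite (set_pmf (p x))"
  shows "finite (set_pmf (Pi_pmf A d p))"
  using assms by (simp add: set_Pi_pmf finite_PiE_dflt)

text \<open>Same argument as for a batch, now with a different law for each index; it is what later
  yields the factor \<open>1 / M\<close> from independent agents.\<close>

lemma expect_Pi_pmf_sum:
  fixes f :: "'i \<Rightarrow> 'a \<Rightarrow> 'b::euclidean_space"
  assumes "finite A" "\<And>c. c \<in> A \<Longrightarrow> finite (set_pmf (p c))"
  shows "expect (Pi_pmf A d p) (\<lambda>\<phi>. \<Sum>c\<in>A. f c (\<phi> c)) = (\<Sum>c\<in>A. expect (p c) (f c)) \<and>
    expect (Pi_pmf A d p) (\<lambda>\<phi>. (norm ((\<Sum>c\<in>A. f c (\<phi> c)) - (\<Sum>c\<in>A. expect (p c) (f c))))\<^sup>2)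
      = (\<Sum>c\<in>A. expect (p c) (\<lambda>x. (norm (f c x - expect (p c) (f c)))\<^sup>2))"
  using assms
proof (induction A rule: finite_induct)
  case empty
  then show ?case by simp
next
  case (insert i A)
  let ?m = "\<lambda>c. expect (p c) (f c)" and ?S = "\<lambda>\<phi>. \<Sum>c\<in>A. f c (\<phi> c)"
  let ?V = "\<lambda>c. expect (p c) (\<lambda>x. (norm (f c x - expect (p c) (f c)))\<^sup>2)"
  have fin: "finite (set_pmf (p i))" "finite (set_pmf (Pi_pmf A d p))"
    using insert.prems insert.hyps by (auto intro: finite_set_Pi_pmf)
  have IH1: "expect (Pi_pmf A d p) ?S = (\<Sum>c\<in>A. ?m c)"
    and IH2: "expect (Pi_pmf A d p) (\<lambda>\<phi>. (norm (?S \<phi> - (\<Sum>c\<in>A. ?m c)))\<^sup>2) = (\<Sum>c\<in>A. ?V c)"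
    using insert.IH insert.prems by auto
  have bind: "expect (Pi_pmf (insert i A) d p) (\<lambda>\<phi>. h (\<Sum>c\<in>insert i A. f c (\<phi> c)))
      = expect (p i) (\<lambda>x. expect (Pi_pmf A d p) (\<lambda>\<phi>. h (f i x + ?S \<phi>)))" for h :: "'b \<Rightarrow> 'c::euclidean_space"
  proof -
    have s: "(\<Sum>c\<in>insert i A. f c ((\<phi>(i := x)) c)) = f i x + ?S \<phi>" for \<phi> x
      using insert.hyps by (auto intro!: sum.cong arg_cong2[where f="(+)"])
    show ?thesis
      unfolding Pi_pmf_insert'[OF insert.hyps]
      using fin by (simp add: expect_bind s del: fun_upd_apply)
  qed
  have inner: "expect (Pi_pmf A d p) (\<lambda>\<phi>. (norm (f i x + ?S \<phi> - (?m i + (\<Sum>c\<in>A. ?m c))))\<^sup>2)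
        = (\<Sum>c\<in>A. ?V c) + (norm (f i x - ?m i))\<^sup>2" for x
  proof -
    have "expect (Pi_pmf A d p) (\<lambda>\<phi>. (norm (f i x + ?S \<phi> - (?m i + (\<Sum>c\<in>A. ?m c))))\<^sup>2)
        = expect (Pi_pmf A d p) (\<lambda>\<phi>. (norm (?S \<phi> - (?m i + (\<Sum>c\<in>A. ?m c) - f i x)))\<^sup>2)"
      by (simp add: algebra_simps)
    also have "\<dots> = (\<Sum>c\<in>A. ?V c) + (norm ((\<Sum>c\<in>A. ?m c) - (?m i + (\<Sum>c\<in>A. ?m c) - f i x)))\<^sup>2"
      using fin by (subst expect_norm_sq_centered) (simp_all add: IH1 IH2)
    finally show ?thesis
      by (simp add: algebra_simps)
  qed
  have "expect (Pi_pmf (insert i A) d p) (\<lambda>\<phi>. \<Sum>c\<in>insert i A. f c (\<phi> c)) = (\<Sum>c\<in>insert i A. ?m c)"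
    unfolding bind[of "\<lambda>x. x"] using fin insert.hyps IH1 by simp
  moreover have "expect (Pi_pmf (insert i A) d p)
      (\<lambda>\<phi>. (norm ((\<Sum>c\<in>insert i A. f c (\<phi> c)) - (\<Sum>c\<in>insert i A. ?m c)))\<^sup>2) = (\<Sum>c\<in>insert i A. ?V c)"
    unfolding bind[of "\<lambda>y. (norm (y - (\<Sum>c\<in>insert i A. ?m c)))\<^sup>2"]
    using fin insert.hyps inner by simp
  ultimately show ?case by blast
qed

section \<open>Mean and variance of a stochastic gradient chain\<close>

text \<open>\<open>K x\<close> is the law of the random direction drawn at \<open>x\<close>. The
  local steps of an agent are recognized as such a chain later, so that the analysis sees only
  moments of \<open>K\<close>.\<close>

primrec sgd :: "real \<Rightarrow> ('v::euclidean_space \<Rightarrow> 'v pmf) \<Rightarrow> 'v \<Rightarrow> nat \<Rightarrow> 'v pmf" where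
  "sgd \<eta> K \<theta> 0 = return_pmf \<theta>"
| "sgd \<eta> K \<theta> (Suc h) = sgd \<eta> K \<theta> h \<bind> (\<lambda>x. map_pmf (\<lambda>g. x + \<eta> *\<^sub>R g) (K x))"

text \<open>\<open>L\<close> bounds the Lipschitz constant of the drift \<open>f\<close>,
  \<open>s2\<close> the conditional variance, and \<open>Q\<close> controls second-order remainders.
  The Jacobian of \<open>f\<close> enters only as an unspecified linear map \<open>A\<close> at each
  point.\<close>

locale sgd_chain =
  fixes \<eta> :: real and K :: "'v::euclidean_space \<Rightarrow> 'v pmf" and f :: "'v \<Rightarrow> 'v"
    and L Q s2 :: real and \<theta> :: 'v
  assumes eta_nonneg: "0 \<le> \<eta>" and L_nonneg: "0 \<le> L" and Q_nonneg: "0 \<le> Q" and s2_nonneg: "0 \<le> s2"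
    and finite_K: "finite (set_pmf (K x))"
    and mean_K: "expect (K x) (\<lambda>g. g) = f x"
    and var_K: "expect (K x) (\<lambda>g. (norm (g - f x))\<^sup>2) \<le> s2"
    and lipschitz: "norm (f x - f y) \<le> L * norm (x - y)"
    and taylor: "\<exists>A. linear A \<and> (\<forall>u. norm (f (x + u) - f x - A u) \<le> Q / 2 * (norm u)\<^sup>2)"
begin

abbreviation "X \<equiv> sgd \<eta> K \<theta>"

definition "xbar h = expect (X h) (\<lambda>x. x)"
definition "var h = expect (X h) (\<lambda>x. (norm (x - xbar h))\<^sup>2)"

lemma finite_X: "finite (set_pmf (X h))"
  by (induction h) (auto simp: finite_K)

lemma xbar_0 [simp]: "xbar 0 = \<theta>"
  by (simp add: xbar_def)

lemma var_0 [simp]: "var 0 = 0"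
  by (simp add: var_def)

lemma expect_Suc: "expect (X (Suc h)) F = expect (X h) (\<lambda>x. expect (K x) (\<lambda>g. F (x + \<eta> *\<^sub>R g)))"
  for F :: "'v \<Rightarrow> 'w::euclidean_space"
  using finite_X finite_K by (simp add: expect_bind)

lemma xbar_Suc: "xbar (Suc h) = xbar h + \<eta> *\<^sub>R expect (X h) f"
  unfolding xbar_def expect_Suc by (simp add: finite_K finite_X mean_K)

lemma norm_step:
  fixes a b :: 'v
  assumes "norm b \<le> c"
  shows "norm (a + \<eta> *\<^sub>R b) \<le> norm a + \<eta> * c"
  using assms eta_nonneg
  by (intro order_trans[OF norm_triangle_ineq] add_left_mono) (simp add: mult_left_mono)

text \<open>Law of total variance: fresh noise contributes at most
  \<open>\<eta>\<^sup>2 * s2\<close>, and the deterministic map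
  \<open>x + \<eta> *\<^sub>R f x\<close> has Lipschitz constant at most
  \<open>1 + \<eta> * L\<close>.\<close>

lemma var_Suc: "var (Suc h) \<le> (1 + \<eta> * L)\<^sup>2 * var h + \<eta>\<^sup>2 * s2"
proof -
  let ?\<phi> = "\<lambda>x. x + \<eta> *\<^sub>R f x"
  have mean: "expect (K x) (\<lambda>g. x + \<eta> *\<^sub>R g) = ?\<phi> x" for x
    by (simp add: finite_K mean_K)
  have xbar_Suc_eq: "xbar (Suc h) = expect (X h) ?\<phi>"
    by (simp add: finite_X xbar_Suc) (simp add: xbar_def)
  have "var (Suc h) = expect (X h) (\<lambda>x. expect (K x) (\<lambda>g. (norm (x + \<eta> *\<^sub>R g - xbar (Suc h)))\<^sup>2))"
    unfolding var_def expect_Suc ..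
  also have "\<dots> \<le> expect (X h) (\<lambda>x. \<eta>\<^sup>2 * s2 + (norm (?\<phi> x - xbar (Suc h)))\<^sup>2)"
  proof (rule expect_mono[OF finite_X])
    fix x
    have "expect (K x) (\<lambda>g. (norm (x + \<eta> *\<^sub>R g - xbar (Suc h)))\<^sup>2)
      = expect (K x) (\<lambda>g. (norm (x + \<eta> *\<^sub>R g - ?\<phi> x))\<^sup>2) + (norm (?\<phi> x - xbar (Suc h)))\<^sup>2"
      by (subst expect_norm_sq_centered[OF finite_K]) (simp only: mean)
    also have "expect (K x) (\<lambda>g. (norm (x + \<eta> *\<^sub>R g - ?\<phi> x))\<^sup>2) = \<eta>\<^sup>2 * expect (K x) (\<lambda>g. (norm (g - f x))\<^sup>2)"
    proof -
      have "x + \<eta> *\<^sub>R g - ?\<phi> x = \<eta> *\<^sub>R (g - f x)" for g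
        by (simp add: algebra_simps)
      then show ?thesis by (simp add: power_mult_distrib)
    qed
    also have "\<dots> \<le> \<eta>\<^sup>2 * s2"
      by (intro mult_left_mono var_K) simp
    finally show "expect (K x) (\<lambda>g. (norm (x + \<eta> *\<^sub>R g - xbar (Suc h)))\<^sup>2)
        \<le> \<eta>\<^sup>2 * s2 + (norm (?\<phi> x - xbar (Suc h)))\<^sup>2" by simp
  qed
  also have "\<dots> = \<eta>\<^sup>2 * s2 + expect (X h) (\<lambda>x. (norm (?\<phi> x - expect (X h) ?\<phi>))\<^sup>2)"
    by (simp only: xbar_Suc_eq) (simp add: finite_X)
  \<comment> \<open>The mean minimizes the second moment, so it may be replaced by the image of the
    previous mean, to which the Lipschitz bound applies.\<close>
  also have "expect (X h) (\<lambda>x. (norm (?\<phi> x - expect (X h) ?\<phi>))\<^sup>2)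
      \<le> expect (X h) (\<lambda>x. (norm (?\<phi> x - ?\<phi> (xbar h)))\<^sup>2)"
    by (rule variance_le_centered[OF finite_X])
  also have "\<dots> \<le> expect (X h) (\<lambda>x. (1 + \<eta> * L)\<^sup>2 * (norm (x - xbar h))\<^sup>2)"
  proof (rule expect_mono[OF finite_X])
    fix x
    have "?\<phi> x - ?\<phi> (xbar h) = (x - xbar h) + \<eta> *\<^sub>R (f x - f (xbar h))"
      by (simp add: algebra_simps)
    then have "norm (?\<phi> x - ?\<phi> (xbar h)) \<le> norm (x - xbar h) + \<eta> * norm (f x - f (xbar h))"
      using norm_step[OF order_refl, of "x - xbar h" "f x - f (xbar h)"] by (simp only:)
    also have "\<dots> \<le> norm (x - xbar h) + \<eta> * (L * norm (x - xbar h))"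
      using eta_nonneg by (intro add_left_mono mult_left_mono lipschitz)
    also have "\<dots> = (1 + \<eta> * L) * norm (x - xbar h)"
      by (simp add: algebra_simps)
    finally show "(norm (?\<phi> x - ?\<phi> (xbar h)))\<^sup>2 \<le> (1 + \<eta> * L)\<^sup>2 * (norm (x - xbar h))\<^sup>2"
      by (metis norm_ge_zero power_mono power_mult_distrib)
  qed
  also have "\<dots> = (1 + \<eta> * L)\<^sup>2 * var h"
    by (simp add: var_def)
  finally show ?thesis by simp
qed

text \<open>Unrolling the recursion gives a geometric sum; each of its \<open>h\<close> terms is
  bounded by the largest growth factor.\<close>

lemma var_le_power: "var h \<le> \<eta>\<^sup>2 * s2 * real h * (1 + \<eta> * L) ^ (2 * h)"
proof (induction h)
  case (Suc h)
  let ?q = "1 + \<eta> * L"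
  have q: "1 \<le> ?q" using eta_nonneg L_nonneg by simp
  have "var (Suc h) \<le> ?q\<^sup>2 * (\<eta>\<^sup>2 * s2 * real h * ?q ^ (2 * h)) + \<eta>\<^sup>2 * s2 * 1"
    using var_Suc[of h] mult_left_mono[OF Suc.IH, of "?q\<^sup>2"] by simp
  also have "\<dots> \<le> ?q\<^sup>2 * (\<eta>\<^sup>2 * s2 * real h * ?q ^ (2 * h)) + \<eta>\<^sup>2 * s2 * ?q ^ (2 * Suc h)"
    using q s2_nonneg by (intro add_left_mono mult_left_mono one_le_power) auto
  also have "\<dots> = \<eta>\<^sup>2 * s2 * real (Suc h) * ?q ^ (2 * Suc h)"
    by (simp add: algebra_simps power2_eq_square power_add)
  finally show ?case .
qed simp

text \<open>The linear Taylor term around the mean averages out; this is what keeps the variance of a single agent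
  from entering the bias at first order.\<close>

lemma mean_field_error: "norm (expect (X h) f - f (xbar h)) \<le> Q / 2 * var h"
proof -
  obtain A where A: "linear A"
    "\<And>u. norm (f (xbar h + u) - f (xbar h) - A u) \<le> Q / 2 * (norm u)\<^sup>2"
    using taylor[of "xbar h"] by blast
  have lin: "expect (X h) (\<lambda>x. A (x - xbar h)) = 0"
    by (subst expect_linear[OF finite_X A(1)])
       (simp add: finite_X linear_0[OF A(1)] flip: xbar_def)
  have "expect (X h) f - f (xbar h) = expect (X h) (\<lambda>x. f x - f (xbar h) - A (x - xbar h))"
    using lin by (simp add: finite_X)
  also have "norm \<dots> \<le> expect (X h) (\<lambda>x. Q / 2 * (norm (x - xbar h))\<^sup>2)"
  proof (rule expect_norm_le[OF finite_X])
    fix x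
    show "norm (f x - f (xbar h) - A (x - xbar h)) \<le> Q / 2 * (norm (x - xbar h))\<^sup>2"
      using A(2)[of "x - xbar h"] by simp
  qed
  also have "\<dots> = Q / 2 * var h"
    by (simp add: var_def)
  finally show ?thesis .
qed

section \<open>Drift of the mean under the step-size condition\<close>

context
  fixes H :: nat
  assumes small: "\<eta> * real H * L \<le> 1 / 74"
begin

lemma power_bounds:
  assumes "h \<le> H"
  shows "(1 + \<eta> * L) ^ (2 * h) \<le> 1.03" "(1 + \<eta> * L) ^ h \<le> 1.02"
proof -
  have "(1 + \<eta> * L) \<le> exp (\<eta> * L)" by simp
  then have le: "(1 + \<eta> * L) ^ n \<le> exp (\<eta> * L * real n)" for n
    using eta_nonneg L_nonneg power_mono[of "1 + \<eta> * L" "exp (\<eta> * L)" n]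
      exp_of_nat_mult[of n "\<eta> * L"]
    by (simp only: mult.commute[of _ "real n"]) simp
  have h: "\<eta> * L * real h \<le> 1 / 74"
  proof -
    have "\<eta> * L * real h \<le> \<eta> * L * real H"
      using eta_nonneg L_nonneg assms by (intro mult_left_mono) auto
    then show ?thesis using small by (simp add: mult_ac)
  qed
  \<comment> \<open>The value \<open>1.0137\<close> is small enough for its square to stay below
    \<open>1.03\<close>.\<close>
  have e1: "exp (1 / 74 :: real) \<le> 1.0137"
    using exp_bound[of "1/74 :: real"] by (simp add: power2_eq_square)
  have "(1 + \<eta> * L) ^ h \<le> exp (1 / 74)"
    using le[of h] h by (meson exp_le_cancel_iff order_trans)
  then have a: "(1 + \<eta> * L) ^ h \<le> 1.0137" using e1 by simp
  then show "(1 + \<eta> * L) ^ h \<le> 1.02" by simp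
  have "(1 + \<eta> * L) ^ (2 * h) = ((1 + \<eta> * L) ^ h)\<^sup>2"
    by (simp add: power_mult mult.commute)
  also have "\<dots> \<le> 1.0137\<^sup>2"
    using a eta_nonneg L_nonneg by (intro power_mono) auto
  finally show "(1 + \<eta> * L) ^ (2 * h) \<le> 1.03"
    by (simp add: power2_eq_square)
qed

lemma var_le: "h \<le> H \<Longrightarrow> var h \<le> 1.03 * \<eta>\<^sup>2 * s2 * real h"
  using var_le_power[of h] mult_left_mono[OF power_bounds(1)[of h], of "\<eta>\<^sup>2 * s2 * real h"] s2_nonneg
  by (simp add: mult_ac)

text \<open>Bound on the mean-field error over all steps \<open>h < H\<close>. The last such step
  starts from variance proportional to \<open>H - 1\<close>, so a single local step carries no
  bias.\<close>

definition "bias = Q / 2 * (1.03 * \<eta>\<^sup>2 * s2 * (real H - 1))"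

lemma bias_ge:
  assumes "h < H" shows "norm (expect (X h) f - f (xbar h)) \<le> bias"
proof -
  have "var h \<le> 1.03 * \<eta>\<^sup>2 * s2 * real h"
    using assms by (intro var_le) simp
  also have "\<dots> \<le> 1.03 * \<eta>\<^sup>2 * s2 * (real H - 1)"
    using assms s2_nonneg by (intro mult_left_mono) auto
  finally show ?thesis
    unfolding bias_def using mean_field_error[of h] Q_nonneg
    by (meson divide_nonneg_nonneg mult_left_mono order_trans zero_le_numeral)
qed

lemma bias_nonneg: "H \<noteq> 0 \<Longrightarrow> 0 \<le> bias"
  unfolding bias_def using Q_nonneg s2_nonneg by simp

text \<open>Discrete Gronwall argument: the mean is pushed by at most
  \<open>norm (f \<theta>) + bias\<close> per step, and the Lipschitz feedback multiplies the
  distance by \<open>1 + \<eta> * L\<close>, which compounds to at most \<open>1.02\<close>.\<close>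

lemma drift_le: "h \<le> H \<Longrightarrow> norm (xbar h - \<theta>) \<le> 1.02 * real h * \<eta> * (norm (f \<theta>) + bias)"
proof -
  let ?q = "1 + \<eta> * L" and ?c = "\<eta> * (norm (f \<theta>) + bias)"
  have q: "1 \<le> ?q" using eta_nonneg L_nonneg by simp
  assume h: "h \<le> H"
  then have "norm (xbar h - \<theta>) \<le> ?q ^ h * real h * ?c"
  proof (induction h)
    case (Suc h)
    have c: "0 \<le> ?c"
      using bias_nonneg Suc.prems eta_nonneg by (intro mult_nonneg_nonneg add_nonneg_nonneg) auto
    have "xbar (Suc h) - \<theta> = (xbar h - \<theta>)
        + \<eta> *\<^sub>R (f \<theta> + (f (xbar h) - f \<theta>) + (expect (X h) f - f (xbar h)))"
      by (simp add: xbar_Suc algebra_simps)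
    also have "norm \<dots> \<le> norm (xbar h - \<theta>)
        + \<eta> * (norm (f \<theta>) + L * norm (xbar h - \<theta>) + bias)"
      using eta_nonneg bias_ge[of h] Suc.prems lipschitz[of "xbar h" \<theta>]
      by (intro norm_step order_trans[OF norm_triangle_ineq] add_mono) auto
    also have "\<dots> = ?q * norm (xbar h - \<theta>) + ?c"
      by (simp add: algebra_simps)
    also have "\<dots> \<le> ?q * (?q ^ h * real h * ?c) + ?q ^ Suc h * ?c"
    proof (intro add_mono mult_left_mono)
      show "norm (xbar h - \<theta>) \<le> ?q ^ h * real h * ?c"
        using Suc by simp
      show "?c \<le> ?q ^ Suc h * ?c"
        using mult_right_mono[OF one_le_power[OF q, of "Suc h"] c] by simp
    qed (use q in auto)
    also have "\<dots> = ?q ^ Suc h * real (Suc h) * ?c"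
      by (simp add: algebra_simps)
    finally show ?case .
  qed simp
  also have "\<dots> \<le> 1.02 * real h * ?c"
  proof (cases "H = 0")
    case False
    then show ?thesis
      using power_bounds(2)[OF h] bias_nonneg[OF False] eta_nonneg
      by (intro mult_right_mono) auto
  qed (use h in simp)
  finally show ?thesis by (simp add: mult_ac)
qed

text \<open>A second pass over the recursion. The distance already bounded in
  \<open>drift_le\<close> makes each averaged drift differ from \<open>f \<theta>\<close> by at most
  \<open>L\<close> times that distance plus \<open>bias\<close>; the step-size condition turns the
  first part into a small relative error.\<close>

lemma drift_error:
  assumes "H \<noteq> 0"
  shows "norm (xbar H - \<theta> - (\<eta> * real H) *\<^sub>R f \<theta>)
    \<le> \<eta> * real H * (0.014 * norm (f \<theta>) + 0.53 * Q * \<eta>\<^sup>2 * s2 * (real H - 1))"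
proof -
  let ?c = "L * (1.02 * real H * \<eta> * (norm (f \<theta>) + bias)) + bias"
  have "norm (xbar h - \<theta> - (\<eta> * real h) *\<^sub>R f \<theta>) \<le> \<eta> * real h * ?c" if "h \<le> H" for h
    using that
  proof (induction h)
    case (Suc h)
    have d: "norm (xbar h - \<theta>) \<le> 1.02 * real H * \<eta> * (norm (f \<theta>) + bias)"
    proof -
      have "norm (xbar h - \<theta>) \<le> 1.02 * real h * \<eta> * (norm (f \<theta>) + bias)"
        using Suc.prems by (intro drift_le) simp
      also have "\<dots> \<le> 1.02 * real H * \<eta> * (norm (f \<theta>) + bias)"
        using Suc.prems eta_nonneg bias_nonneg[OF assms] by (intro mult_right_mono) auto
      finally show ?thesis .
    qed
    have "xbar (Suc h) - \<theta> - (\<eta> * real (Suc h)) *\<^sub>R f \<theta> = (xbar h - \<theta> - (\<eta> * real h) *\<^sub>R f \<theta>)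
        + \<eta> *\<^sub>R ((f (xbar h) - f \<theta>) + (expect (X h) f - f (xbar h)))"
      by (simp add: xbar_Suc algebra_simps)
    also have "norm \<dots> \<le> norm (xbar h - \<theta> - (\<eta> * real h) *\<^sub>R f \<theta>) + \<eta> * (L * norm (xbar h - \<theta>) + bias)"
      using eta_nonneg bias_ge[of h] Suc.prems lipschitz[of "xbar h" \<theta>]
      by (intro norm_step norm_triangle_le add_mono) auto
    also have "\<dots> \<le> \<eta> * real h * ?c + \<eta> * ?c"
      using Suc d eta_nonneg L_nonneg by (intro add_mono mult_left_mono) auto
    also have "\<dots> = \<eta> * real (Suc h) * ?c"
      by (simp only: of_nat_Suc distrib_left distrib_right mult_1_right)
    finally show ?case .
  qed simp
  from this[of H] have "norm (xbar H - \<theta> - (\<eta> * real H) *\<^sub>R f \<theta>) \<le> \<eta> * real H * ?c" by simp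
  also have "?c \<le> 0.014 * norm (f \<theta>) + 0.53 * Q * \<eta>\<^sup>2 * s2 * (real H - 1)"
  proof -
    have "?c = 1.02 * (\<eta> * real H * L) * (norm (f \<theta>) + bias) + bias"
      by simp
    also have "\<dots> \<le> 1.02 * (1 / 74) * (norm (f \<theta>) + bias) + bias"
      \<comment> \<open>\<open>1.02 / 74\<close> is below \<open>0.014\<close>; afterwards
        \<open>1.014 * 1.03 / 2\<close> is below \<open>0.53\<close>.\<close>
      using small bias_nonneg[OF assms] by (intro add_right_mono mult_right_mono mult_left_mono) auto
    also have "\<dots> \<le> 0.014 * norm (f \<theta>) + 1.014 * bias"
      using bias_nonneg[OF assms] norm_ge_zero[of "f \<theta>"] by (simp add: field_simps)
    also have "1.014 * bias \<le> 0.53 * Q * \<eta>\<^sup>2 * s2 * (real H - 1)"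
    proof -
      have "0 \<le> Q * \<eta>\<^sup>2 * s2 * (real H - 1)"
        using Q_nonneg s2_nonneg assms by simp
      then show ?thesis by (simp add: bias_def mult_ac)
    qed
    finally show ?thesis by simp
  qed
  finally show ?thesis
    using eta_nonneg by (simp add: mult_left_mono)
qed

lemma drift_le_final:
  assumes "H \<noteq> 0"
  shows "norm (xbar H - \<theta>) \<le> \<eta> * real H * (1.02 * norm (f \<theta>) + 0.53 * Q * \<eta>\<^sup>2 * s2 * (real H - 1))"
proof -
  have "norm (xbar H - \<theta>) \<le> norm ((\<eta> * real H) *\<^sub>R f \<theta>) + norm (xbar H - \<theta> - (\<eta> * real H) *\<^sub>R f \<theta>)"
    by (metis add.commute diff_add_cancel norm_triangle_ineq)
  also have "\<dots> \<le> \<eta> * real H * norm (f \<theta>)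
      + \<eta> * real H * (0.014 * norm (f \<theta>) + 0.53 * Q * \<eta>\<^sup>2 * s2 * (real H - 1))"
    using drift_error[OF assms] eta_nonneg by simp
  also have "\<dots> = \<eta> * real H * (1.014 * norm (f \<theta>) + 0.53 * Q * \<eta>\<^sup>2 * s2 * (real H - 1))"
    by (simp add: algebra_simps)
  also have "\<dots> \<le> \<eta> * real H * (1.02 * norm (f \<theta>) + 0.53 * Q * \<eta>\<^sup>2 * s2 * (real H - 1))"
    using eta_nonneg by (intro mult_left_mono add_right_mono mult_right_mono) auto
  finally show ?thesis .
qed

end

end

section \<open>Softmax policies\<close>

text \<open>The gradient of \<open>ln (softmax \<theta> s a)\<close> in \<theta>: a unit vector
  minus its average under the policy.\<close>

definition score :: "('s::finite, 'a::finite) param \<Rightarrow> 's \<Rightarrow> 'a \<Rightarrow> ('s, 'a) param" where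
  "score \<theta> s a = axis (s, a) 1 - (\<Sum>b\<in>UNIV. softmax \<theta> s b *\<^sub>R axis (s, b) 1)"

lemma inner_score: "u \<bullet> score \<theta> s a = u $ (s, a) - (\<Sum>b\<in>UNIV. softmax \<theta> s b * u $ (s, b))"
  by (simp add: score_def inner_diff_right inner_sum_right inner_axis)

lemma softmax_nonneg: "0 \<le> softmax \<theta> s a"
  using softmax_pos[of \<theta> s a] by simp

lemma softmax_le_1: "softmax \<theta> s a \<le> 1"
  using member_le_sum[of a UNIV "softmax \<theta> s"] sum_softmax[of \<theta> s] softmax_pos[of \<theta> s]
  by (simp add: less_imp_le)

lemma expect_softmax_score: "(\<Sum>a\<in>UNIV. softmax \<theta> s a * (u \<bullet> score \<theta> s a)) = 0"
  by (simp add: inner_score right_diff_distrib sum_subtractf sum_softmax flip: sum_distrib_right)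

text \<open>Expanding the square of a unit vector minus a convex combination \<open>q\<close> of
  unit vectors gives \<open>1\<close>, plus \<open>(norm q)\<^sup>2\<close> which is at most
  \<open>1\<close>, minus twice a nonnegative inner product.\<close>

lemma norm_score: "norm (score \<theta> s a) \<le> sqrt 2"
proof -
  let ?e = "\<lambda>b. axis (s, b) 1 :: ('a, 'b) param"
  let ?q = "\<Sum>b\<in>UNIV. softmax \<theta> s b *\<^sub>R ?e b"
  have "norm ?q \<le> (\<Sum>b\<in>UNIV. softmax \<theta> s b)"
    by (intro sum_norm_le) (simp add: softmax_pos less_imp_le norm_axis_1)
  then have q: "(norm ?q)\<^sup>2 \<le> 1"
    by (simp add: sum_softmax power_le_one)
  have "?e a \<bullet> ?q = (\<Sum>b\<in>UNIV. softmax \<theta> s b * (if a = b then 1 else 0))"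
    by (simp add: inner_sum_right inner_axis_axis cong: if_cong)
  also have "\<dots> \<ge> 0"
    by (intro sum_nonneg) (simp add: softmax_pos less_imp_le)
  finally have "(norm (score \<theta> s a))\<^sup>2 \<le> 2"
    unfolding score_def power2_norm_eq_inner
    using q by (simp add: inner_diff_left inner_diff_right inner_commute inner_axis_axis power2_norm_eq_inner)
  then show ?thesis
    using real_le_rsqrt by blast
qed

lemma abs_inner_score: "\<bar>u \<bullet> score \<theta> s a\<bar> \<le> sqrt 2 * norm u"
  using Cauchy_Schwarz_ineq2[of u "score \<theta> s a"] mult_left_mono[OF norm_score[of \<theta> s a] norm_ge_zero[of u]]
  by (simp add: mult.commute)

lemma ln_softmax: "ln (softmax \<theta> s a) = \<theta> $ (s, a) - ln (\<Sum>b\<in>UNIV. exp (\<theta> $ (s, b)))"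
proof -
  have "(\<Sum>b\<in>UNIV. exp (\<theta> $ (s, b))) > 0" by (intro sum_pos) auto
  then show ?thesis by (simp add: softmax_def ln_div)
qed

lemma has_derivative_ln_softmax:
  "((\<lambda>\<theta>'. ln (softmax \<theta>' s a)) has_derivative (\<lambda>u. u \<bullet> score \<theta> s a)) (at \<theta>)"
proof -
  let ?Z = "\<lambda>\<theta>. \<Sum>b\<in>UNIV. exp (\<theta> $ (s, b))"
  have Z: "?Z \<theta> > 0" by (intro sum_pos) auto
  have "((\<lambda>\<theta>'. \<theta>' $ (s, a) - ln (?Z \<theta>')) has_derivative
      (\<lambda>u. u $ (s, a) - (\<Sum>b\<in>UNIV. exp (\<theta> $ (s, b)) * u $ (s, b)) * inverse (?Z \<theta>))) (at \<theta>)"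
    using Z by (auto intro!: derivative_eq_intros
        bounded_linear.has_derivative[OF bounded_linear_vec_nth] simp: mult.commute)
  moreover have "u $ (s, a) - (\<Sum>b\<in>UNIV. exp (\<theta> $ (s, b)) * u $ (s, b)) * inverse (?Z \<theta>) = u \<bullet> score \<theta> s a" for u
    by (simp add: inner_score softmax_def divide_inverse sum_distrib_left mult_ac)
  ultimately show ?thesis
    by (simp add: ln_softmax)
qed

lemma gradient_ln_softmax: "gradient (\<lambda>\<theta>'. ln (softmax \<theta>' s a)) \<theta> = score \<theta> s a"
  unfolding gradient_def gderiv_def
proof (rule the_equality)
  show "((\<lambda>\<theta>'. ln (softmax \<theta>' s a)) has_derivative (\<lambda>h. h \<bullet> score \<theta> s a)) (at \<theta>)"
    by (rule has_derivative_ln_softmax)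
  fix D assume "((\<lambda>\<theta>'. ln (softmax \<theta>' s a)) has_derivative (\<lambda>h. h \<bullet> D)) (at \<theta>)"
  from has_derivative_unique[OF this has_derivative_ln_softmax]
  show "D = score \<theta> s a"
    by (metis vector_eq_rdot inner_commute)
qed

section \<open>Derivatives along lines in parameter space\<close>

lemma ln_softmax_deriv:
  "((\<lambda>x. ln (softmax (\<theta> + x *\<^sub>R u) s a)) has_real_derivative u \<bullet> score (\<theta> + x0 *\<^sub>R u) s a) (at x0)"
proof -
  have "((\<lambda>x. \<theta> + x *\<^sub>R u) has_derivative (\<lambda>x. x *\<^sub>R u)) (at x0)"
    by (auto intro!: derivative_eq_intros)
  from has_derivative_compose[OF this has_derivative_ln_softmax]
  show ?thesis
    by (rule has_derivative_imp_has_field_derivative) simp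
qed

lemma softmax_deriv [derivative_intros]:
  "((\<lambda>x. softmax (\<theta> + x *\<^sub>R u) s a) has_real_derivative
     softmax (\<theta> + x0 *\<^sub>R u) s a * (u \<bullet> score (\<theta> + x0 *\<^sub>R u) s a)) (at x0)"
proof -
  have "((\<lambda>x. exp (ln (softmax (\<theta> + x *\<^sub>R u) s a))) has_real_derivative
     exp (ln (softmax (\<theta> + x0 *\<^sub>R u) s a)) * (u \<bullet> score (\<theta> + x0 *\<^sub>R u) s a)) (at x0)"
    by (intro DERIV_fun_exp ln_softmax_deriv)
  then show ?thesis by (simp add: softmax_pos)
qed

text \<open>Covariance of the coordinates of \<open>u\<close> and \<open>v\<close> in state
  \<open>s\<close> under the policy, that is, minus the Hessian of the log-probability. It is the
  same for all actions.\<close>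

definition score_cov :: "('s::finite, 'a::finite) param \<Rightarrow> ('s, 'a) param \<Rightarrow> ('s, 'a) param \<Rightarrow> 's \<Rightarrow> real" where
  "score_cov \<theta> u v s = (\<Sum>b\<in>UNIV. softmax \<theta> s b * (u \<bullet> score \<theta> s b) * v $ (s, b))"

text \<open>Third joint cumulant of \<open>u\<close>, \<open>u\<close>, \<open>v\<close> under the
  policy, obtained as the derivative of the covariance in direction \<open>u\<close>.\<close>

definition score_cov' :: "('s::finite, 'a::finite) param \<Rightarrow> ('s, 'a) param \<Rightarrow> ('s, 'a) param \<Rightarrow> 's \<Rightarrow> real" where
  "score_cov' \<theta> u v s = (\<Sum>b\<in>UNIV. softmax \<theta> s b * ((u \<bullet> score \<theta> s b)\<^sup>2 - score_cov \<theta> u u s) * v $ (s, b))"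

lemma inner_score_deriv:
  "((\<lambda>x. v \<bullet> score (\<theta> + x *\<^sub>R u) s a) has_real_derivative - score_cov (\<theta> + x0 *\<^sub>R u) u v s) (at x0)"
  unfolding inner_score[of v] score_cov_def
  by (auto intro!: derivative_eq_intros simp: sum_negf)

lemma score_cov_deriv:
  "((\<lambda>x. score_cov (\<theta> + x *\<^sub>R u) u v s) has_real_derivative score_cov' (\<theta> + x0 *\<^sub>R u) u v s) (at x0)"
  unfolding score_cov_def[of _ u v] score_cov'_def
  by (auto intro!: derivative_eq_intros inner_score_deriv sum.cong simp: algebra_simps power2_eq_square)

lemma softmax_avg_le:
  assumes "\<And>a. \<bar>h a\<bar> \<le> c"
  shows "\<bar>\<Sum>a\<in>UNIV. softmax \<theta> s a * h a\<bar> \<le> c"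
proof -
  have "\<bar>\<Sum>a\<in>UNIV. softmax \<theta> s a * h a\<bar> \<le> (\<Sum>a\<in>UNIV. softmax \<theta> s a * c)"
    using assms by (intro order_trans[OF sum_abs] sum_mono)
      (auto simp: abs_mult abs_of_pos softmax_pos less_imp_le intro!: mult_left_mono)
  then show ?thesis by (simp add: sum_softmax flip: sum_distrib_right)
qed

lemma abs_mult_le: "\<bar>a\<bar> \<le> A \<Longrightarrow> \<bar>b\<bar> \<le> B \<Longrightarrow> \<bar>a * b\<bar> \<le> A * B" for a b A B :: real
  unfolding abs_mult by (rule mult_mono) auto

lemma abs_score_cov: "\<bar>score_cov \<theta> u v s\<bar> \<le> sqrt 2 * norm u * norm v"
  unfolding score_cov_def mult.assoc[of "softmax _ _ _"]
  by (intro softmax_avg_le abs_mult_le abs_inner_score component_le_norm_cart)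

lemma abs_score_cov': "\<bar>score_cov' \<theta> u v s\<bar> \<le> 4 * (norm u)\<^sup>2 * norm v"
proof -
  have "\<bar>score_cov' \<theta> u v s\<bar> \<le> (2 * (norm u)\<^sup>2 + sqrt 2 * norm u * norm u) * norm v"
    unfolding score_cov'_def mult.assoc[of "softmax _ _ _"]
  proof (intro softmax_avg_le abs_mult_le component_le_norm_cart)
    fix b
    have "(u \<bullet> score \<theta> s b)\<^sup>2 \<le> (sqrt 2 * norm u)\<^sup>2"
      using abs_inner_score[of u \<theta> s b] abs_le_square_iff by fastforce
    then have "(u \<bullet> score \<theta> s b)\<^sup>2 \<le> 2 * (norm u)\<^sup>2"
      by (simp add: power_mult_distrib)
    then show "\<bar>(u \<bullet> score \<theta> s b)\<^sup>2 - score_cov \<theta> u u s\<bar> \<le> 2 * (norm u)\<^sup>2 + sqrt 2 * norm u * norm u"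
      using abs_score_cov[of \<theta> u u s] by (smt (verit) zero_le_power2)
  qed
  also have "\<dots> = (2 + sqrt 2) * (norm u)\<^sup>2 * norm v"
    by (simp add: algebra_simps power2_eq_square)
  also have "\<dots> \<le> 4 * (norm u)\<^sup>2 * norm v"
    using sqrt_le_D[of 2 2] real_sqrt_le_iff[of 2 4] by (intro mult_right_mono) (auto simp: real_le_lsqrt)
  finally show ?thesis .
qed

section \<open>Entropy and second moment of the log-probabilities\<close>

lemma softmax_entropy_le: "(\<Sum>a\<in>UNIV. softmax \<theta> s a * - ln (softmax \<theta> s a)) \<le> ln (real CARD('a))"
  for \<theta> :: "('s::finite, 'a::finite) param"
proof -
  let ?p = "softmax \<theta> s" and ?A = "real CARD('a)"
  \<comment> \<open>Gibbs inequality against the uniform law, in termwise form: the correction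
    \<open>1 / ?A - ?p a\<close> sums to zero.\<close>
  have "?p a * - ln (?p a) \<le> ?p a * ln ?A + (1 / ?A - ?p a)" for a
  proof -
    have p: "?p a > 0" by (rule softmax_pos)
    have "ln (1 / (?A * ?p a)) \<le> 1 / (?A * ?p a) - 1"
      using p by (intro ln_le_minus_one) simp
    then have "- ln (?p a) \<le> ln ?A + (1 / (?A * ?p a) - 1)"
      using p by (simp add: ln_div ln_mult)
    then have "?p a * - ln (?p a) \<le> ?p a * (ln ?A + (1 / (?A * ?p a) - 1))"
      using p by (intro mult_left_mono) auto
    also have "\<dots> = ?p a * ln ?A + (1 / ?A - ?p a)"
      using p by (simp add: field_simps)
    finally show ?thesis .
  qed
  then have "(\<Sum>a\<in>UNIV. ?p a * - ln (?p a)) \<le> (\<Sum>a\<in>UNIV. ?p a * ln ?A + (1 / ?A - ?p a))"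
    by (rule sum_mono)
  also have "\<dots> = ln ?A"
    by (simp add: sum.distrib sum_subtractf sum_softmax flip: sum_distrib_right)
  finally show ?thesis .
qed

lemma ln_card_ge: "2 \<le> n \<Longrightarrow> 2 / 3 \<le> ln (real n)"
  by (rule order_trans[OF ln2_ge_two_thirds]) simp

text \<open>The maximum is \<open>4 / exp 2\<close>. Applying \<open>ln z \<le> z - 1\<close> to
  \<open>1 / sqrt y\<close>, rescaled by \<open>exp 1\<close>, is sharp at that maximum;
  \<open>exp 1 \<ge> 5/2\<close> then gives \<open>(4/5)\<^sup>2 = 0.64\<close>.\<close>

lemma mult_ln_sq_le:
  fixes y :: real
  assumes "0 < y" "y \<le> 1"
  shows "y * (ln y)\<^sup>2 \<le> 0.64"
proof -
  let ?x = "1 / sqrt y"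
  have e: "(5/2 :: real) \<le> exp 1"
    using exp_lower_Taylor_quadratic[of "1::real"] by simp
  have "ln (?x / exp 1) \<le> ?x / exp 1 - 1"
    using assms by (intro ln_le_minus_one) simp
  then have "ln ?x \<le> ?x / exp 1"
    using assms by (simp add: ln_div ln_mult)
  also have "\<dots> \<le> ?x / (5/2)"
    using assms e by (intro divide_left_mono) auto
  finally have "- ln y \<le> (4/5) / sqrt y"
    using assms by (simp add: ln_div ln_sqrt)
  moreover have "0 \<le> - ln y" using assms by simp
  ultimately have "(ln y)\<^sup>2 \<le> ((4/5) / sqrt y)\<^sup>2"
    by (metis power2_minus power_mono)
  also have "\<dots> = (16/25) / y"
    using assms by (simp add: power_divide)
  finally have "y * (ln y)\<^sup>2 \<le> y * ((16/25) / y)"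
    using assms by (intro mult_left_mono) auto
  then show ?thesis using assms by simp
qed

text \<open>Actions more likely than uniform have \<open>- ln p \<le> ln A\<close>. For the others
  \<open>ln p\<close> is split into \<open>ln (p * A)\<close> and \<open>- ln A\<close>, and the
  first part contributes at most a constant over \<open>A\<close> per action. Since
  \<open>ln A \<ge> 2 / 3\<close>, the resulting constant \<open>1.28\<close> is absorbed into
  \<open>4 * (ln A)\<^sup>2\<close>.\<close>

lemma softmax_ln_sq_le:
  fixes \<theta> :: "('s::finite, 'a::finite) param"
  assumes "CARD('a) \<ge> 2"
  shows "(\<Sum>a\<in>UNIV. softmax \<theta> s a * (ln (softmax \<theta> s a))\<^sup>2) \<le> 6 * (ln (real CARD('a)))\<^sup>2"
proof -
  let ?p = "softmax \<theta> s" and ?A = "real CARD('a)"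
  have lA: "2 / 3 \<le> ln ?A"
    by (rule ln_card_ge[OF assms])
  have "?p a * (ln (?p a))\<^sup>2 \<le> ?p a * (2 * (ln ?A)\<^sup>2) + 1.28 / ?A" for a
  proof -
    have p: "0 < ?p a" "?p a \<le> 1" by (rule softmax_pos, rule softmax_le_1)
    show ?thesis
    proof (cases "?p a * ?A \<le> 1")
      case True
      have l: "ln (?p a) = ln (?p a * ?A) + - ln ?A"
        using p by (simp add: ln_mult)
      have "(ln (?p a))\<^sup>2 \<le> 2 * (ln (?p a * ?A))\<^sup>2 + 2 * (ln ?A)\<^sup>2"
        unfolding l by (smt (verit) power2_diff power2_sum power2_minus zero_le_power2)
      then have "?p a * (ln (?p a))\<^sup>2 \<le> ?p a * (2 * (ln (?p a * ?A))\<^sup>2 + 2 * (ln ?A)\<^sup>2)"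
        using p by (intro mult_left_mono) auto
      also have "\<dots> = ?p a * (2 * (ln ?A)\<^sup>2) + 2 * (?p a * ?A * (ln (?p a * ?A))\<^sup>2) / ?A"
        by (simp add: algebra_simps)
      also have "\<dots> \<le> ?p a * (2 * (ln ?A)\<^sup>2) + 2 * 0.64 / ?A"
        using mult_ln_sq_le[OF _ True] p by (intro add_left_mono divide_right_mono mult_left_mono) auto
      finally show ?thesis by simp
    next
      case False
      then have "1 / ?A \<le> ?p a" by (simp add: field_simps)
      then have "ln (1 / ?A) \<le> ln (?p a)" using p by (intro ln_mono) auto
      then have "- ln (?p a) \<le> ln ?A" by (simp add: ln_div)
      moreover have "0 \<le> - ln (?p a)" using p by simp
      ultimately have "(ln (?p a))\<^sup>2 \<le> (ln ?A)\<^sup>2"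
        by (metis power2_minus power_mono)
      also have "\<dots> \<le> 2 * (ln ?A)\<^sup>2" by simp
      finally have "?p a * (ln (?p a))\<^sup>2 \<le> ?p a * (2 * (ln ?A)\<^sup>2)"
        using p by (intro mult_left_mono) auto
      then show ?thesis by (simp add: add_increasing2)
    qed
  qed
  then have "(\<Sum>a\<in>UNIV. ?p a * (ln (?p a))\<^sup>2) \<le> (\<Sum>a\<in>UNIV. ?p a * (2 * (ln ?A)\<^sup>2) + 1.28 / ?A)"
    by (rule sum_mono)
  also have "\<dots> = 2 * (ln ?A)\<^sup>2 + 1.28"
    by (simp add: sum.distrib sum_softmax flip: sum_distrib_right)
  also have "\<dots> \<le> 6 * (ln ?A)\<^sup>2"
    using power_mono[OF lA, of 2] by (simp add: power2_eq_square)
  finally show ?thesis .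
qed

section \<open>Expectations over trajectories and their derivatives\<close>

text \<open>Multiplication by \<open>1 - \<gamma>\<close> replaces a sequence by its increments,
  which \<open>b\<close> dominates. Iterating this lowers the degree of polynomial weights.\<close>

lemma geometric_summation_by_parts:
  fixes a b :: "nat \<Rightarrow> real" and \<gamma> :: real
  assumes "0 \<le> \<gamma>" "\<And>t. 0 \<le> a t" "a 0 \<le> b 0" "\<And>t. a (Suc t) \<le> a t + b (Suc t)"
  shows "(1 - \<gamma>) * (\<Sum>t<T. \<gamma> ^ t * a t) \<le> (\<Sum>t<T. \<gamma> ^ t * b t)"
proof -
  \<comment> \<open>The nonnegative boundary term left by summation by parts is kept so that the
    induction closes; the value at \<open>T = 0\<close> avoids the index
    \<open>T - 1\<close>.\<close>
  have "(1 - \<gamma>) * (\<Sum>t<T. \<gamma> ^ t * a t) + (if T = 0 then 0 else \<gamma> ^ T * a (T - 1)) \<le> (\<Sum>t<T. \<gamma> ^ t * b t)"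
  proof (induction T)
    case (Suc T)
    have "\<gamma> ^ T * a T \<le> (if T = 0 then 0 else \<gamma> ^ T * a (T - 1)) + \<gamma> ^ T * b T"
    proof (cases T)
      case (Suc n)
      then show ?thesis
        using mult_left_mono[OF assms(4)[of n], of "\<gamma> ^ T"] assms(1) by (simp add: distrib_left)
    qed (use assms in simp)
    with Suc show ?case by (simp add: algebra_simps)
  qed simp
  moreover have "0 \<le> (if T = 0 then 0 else \<gamma> ^ T * a (T - 1))"
    using assms by simp
  ultimately show ?thesis by linarith
qed

text \<open>Each line follows from the previous one, because the increments of
  \<open>(t + 1) ^ k\<close> are at most \<open>k * (t + 1) ^ (k - 1)\<close>. This gives
  \<open>fact k / (1 - \<gamma>) ^ (k + 1)\<close>.\<close>

lemma sum_geometric_bounds: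
  fixes \<gamma> :: real
  assumes "0 < \<gamma>" "\<gamma> < 1"
  shows "(\<Sum>t<T. \<gamma> ^ t) \<le> 1 / (1 - \<gamma>)"
    and "(\<Sum>t<T. \<gamma> ^ t * (real t + 1)) \<le> 1 / (1 - \<gamma>)\<^sup>2"
    and "(\<Sum>t<T. \<gamma> ^ t * (real t + 1)\<^sup>2) \<le> 2 / (1 - \<gamma>) ^ 3"
    and "(\<Sum>t<T. \<gamma> ^ t * (real t + 1) ^ 3) \<le> 6 / (1 - \<gamma>) ^ 4"
proof -
  have divide_step: "S \<le> c / (1 - \<gamma>) ^ Suc k" if "(1 - \<gamma>) * S \<le> c / (1 - \<gamma>) ^ k" for S c :: real and k
    using assms that by (simp add: field_simps)
  show 1: "(\<Sum>t<T. \<gamma> ^ t) \<le> 1 / (1 - \<gamma>)"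
    using assms by (simp add: sum_gp_strict divide_right_mono)
  have "(1 - \<gamma>) * (\<Sum>t<T. \<gamma> ^ t * (real t + 1)) \<le> (\<Sum>t<T. \<gamma> ^ t * 1)"
    using assms by (intro geometric_summation_by_parts) auto
  with 1 have "(1 - \<gamma>) * (\<Sum>t<T. \<gamma> ^ t * (real t + 1)) \<le> 1 / (1 - \<gamma>)" by simp
  then show 2: "(\<Sum>t<T. \<gamma> ^ t * (real t + 1)) \<le> 1 / (1 - \<gamma>)\<^sup>2"
    using divide_step[of _ 1 1] by (simp add: power2_eq_square)
  have "(1 - \<gamma>) * (\<Sum>t<T. \<gamma> ^ t * (real t + 1)\<^sup>2) \<le> (\<Sum>t<T. \<gamma> ^ t * (2 * (real t + 1)))"
    using assms by (intro geometric_summation_by_parts) (auto simp: power2_eq_square algebra_simps)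
  also have "\<dots> = 2 * (\<Sum>t<T. \<gamma> ^ t * (real t + 1))"
    unfolding sum_distrib_left by (intro sum.cong) auto
  finally have "(1 - \<gamma>) * (\<Sum>t<T. \<gamma> ^ t * (real t + 1)\<^sup>2) \<le> 2 * (1 / (1 - \<gamma>)\<^sup>2)"
    using 2 by linarith
  then show 3: "(\<Sum>t<T. \<gamma> ^ t * (real t + 1)\<^sup>2) \<le> 2 / (1 - \<gamma>) ^ 3"
    using divide_step[of _ 2 2] by (simp add: numeral_3_eq_3)
  have "(1 - \<gamma>) * (\<Sum>t<T. \<gamma> ^ t * (real t + 1) ^ 3) \<le> (\<Sum>t<T. \<gamma> ^ t * (3 * (real t + 1)\<^sup>2))"
    using assms by (intro geometric_summation_by_parts) (auto simp: power2_eq_square power3_eq_cube algebra_simps)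
  also have "\<dots> = 3 * (\<Sum>t<T. \<gamma> ^ t * (real t + 1)\<^sup>2)"
    unfolding sum_distrib_left by (intro sum.cong) auto
  finally have "(1 - \<gamma>) * (\<Sum>t<T. \<gamma> ^ t * (real t + 1) ^ 3) \<le> 3 * (2 / (1 - \<gamma>) ^ 3)"
    using 3 by linarith
  then show "(\<Sum>t<T. \<gamma> ^ t * (real t + 1) ^ 3) \<le> 6 / (1 - \<gamma>) ^ 4"
    using divide_step[of _ 6 3] by (simp add: eval_nat_numeral)
qed

section \<open>Trajectory expectations and the score-function identity\<close>

definition traj_score :: "('s::finite, 'a::finite) param \<Rightarrow> nat \<Rightarrow> ('s, 'a) traj \<Rightarrow> ('s, 'a) param" where
  "traj_score \<theta> n \<omega> = (\<Sum>l<n. score \<theta> (fst (\<omega> l)) (snd (\<omega> l)))"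

definition ent_rew :: "real \<Rightarrow> ('s::finite, 'a::finite) reward \<Rightarrow> ('s, 'a) param \<Rightarrow> 's \<times> 'a \<Rightarrow> real" where
  "ent_rew lam r \<theta> x = r (fst x) (snd x) - lam * ln (softmax \<theta> (fst x) (snd x))"

definition next_pmf :: "'s pmf \<Rightarrow> ('s, 'a) kernel \<Rightarrow> nat \<Rightarrow> ('s, 'a) traj \<Rightarrow> 's pmf" where
  "next_pmf \<rho> P n \<omega> = (case n of 0 \<Rightarrow> \<rho> | Suc m \<Rightarrow> P (fst (\<omega> m)) (snd (\<omega> m)))"

definition texp :: "'s pmf \<Rightarrow> ('s::finite, 'a::finite) kernel \<Rightarrow> ('s, 'a) param \<Rightarrow> nat
    \<Rightarrow> (('s, 'a) traj \<Rightarrow> 'b::euclidean_space) \<Rightarrow> 'b" where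
  "texp \<rho> P \<theta> n f = expect (traj_pmf \<rho> P (softmax_pmf \<theta>) n) f"

lemma finite_traj_pmf: "finite (set_pmf (traj_pmf \<rho> P \<pi> n))"
  for \<rho> :: "'s::finite pmf" and P :: "('s, 'a::finite) kernel"
  by (induction n) auto

lemma expect_finite_type: "expect p f = (\<Sum>x\<in>UNIV. pmf p x *\<^sub>R f x)"
  for p :: "'x::finite pmf" and f :: "'x \<Rightarrow> 'b::euclidean_space"
  by (intro integral_measure_pmf) auto

lemma texp_0: "texp \<rho> P \<theta> 0 f = f (\<lambda>_. undefined)"
  by (simp add: texp_def)

lemma texp_Suc:
  fixes f :: "_ \<Rightarrow> 'd::euclidean_space"
  shows "texp \<rho> P \<theta> (Suc n) f =
    texp \<rho> P \<theta> n (\<lambda>\<omega>. \<Sum>s\<in>UNIV. pmf (next_pmf \<rho> P n \<omega>) s *\<^sub>R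
      (\<Sum>a\<in>UNIV. softmax \<theta> s a *\<^sub>R f (fun_upd \<omega> n (s, a))))"
proof -
  have "expect (step_pmf \<rho> P (softmax_pmf \<theta>) n \<omega>) h =
      expect (next_pmf \<rho> P n \<omega>) (\<lambda>s. expect (softmax_pmf \<theta> s) (\<lambda>a. h (s, a)))"
    for \<omega> and h :: "_ \<Rightarrow> 'd"
    by (simp add: expect_bind step_pmf_def flip: next_pmf_def)
  then have step: "expect (step_pmf \<rho> P (softmax_pmf \<theta>) n \<omega>) h =
      (\<Sum>s\<in>UNIV. pmf (next_pmf \<rho> P n \<omega>) s *\<^sub>R (\<Sum>a\<in>UNIV. softmax \<theta> s a *\<^sub>R h (s, a)))"
    for \<omega> and h :: "_ \<Rightarrow> 'd"
    by (simp add: expect_finite_type pmf_softmax_pmf)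
  show ?thesis
    unfolding texp_def by (simp add: expect_bind finite_traj_pmf step del: fun_upd_apply)
qed

lemma texp_cong: "(\<And>\<omega>. f \<omega> = g \<omega>) \<Longrightarrow> texp \<rho> P \<theta> n f = texp \<rho> P \<theta> n g"
  by (rule arg_cong[where f="texp \<rho> P \<theta> n"]) auto

lemma texp_add: "texp \<rho> P \<theta> n (\<lambda>\<omega>. f \<omega> + g \<omega>) = texp \<rho> P \<theta> n f + texp \<rho> P \<theta> n g"
  and texp_diff: "texp \<rho> P \<theta> n (\<lambda>\<omega>. f \<omega> - g \<omega>) = texp \<rho> P \<theta> n f - texp \<rho> P \<theta> n g"
  and texp_scaleR: "texp \<rho> P \<theta> n (\<lambda>\<omega>. c *\<^sub>R f \<omega>) = c *\<^sub>R texp \<rho> P \<theta> n f"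
  and texp_const: "texp \<rho> P \<theta> n (\<lambda>\<omega>. d) = d"
  and texp_sum: "texp \<rho> P \<theta> n (\<lambda>\<omega>. \<Sum>i\<in>I. F i \<omega>) = (\<Sum>i\<in>I. texp \<rho> P \<theta> n (F i))"
  and texp_inner: "texp \<rho> P \<theta> n (\<lambda>\<omega>. d \<bullet> f \<omega>) = d \<bullet> texp \<rho> P \<theta> n f"
  unfolding texp_def by (simp_all add: finite_traj_pmf)

lemma texp_mult: "texp \<rho> P \<theta> n (\<lambda>\<omega>. c * f \<omega>) = c * texp \<rho> P \<theta> n f" for f :: "_ \<Rightarrow> real"
  using texp_scaleR[of \<rho> P \<theta> n c f] by simp

lemma texp_mono: "(\<And>\<omega>. f \<omega> \<le> g \<omega>) \<Longrightarrow> texp \<rho> P \<theta> n f \<le> texp \<rho> P \<theta> n g" for f g :: "_ \<Rightarrow> real"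
  unfolding texp_def by (rule expect_mono) (auto simp: finite_traj_pmf)

lemma texp_norm_le: "(\<And>\<omega>. norm (f \<omega>) \<le> g \<omega>) \<Longrightarrow> norm (texp \<rho> P \<theta> n f) \<le> texp \<rho> P \<theta> n g"
  unfolding texp_def by (rule expect_norm_le) (auto simp: finite_traj_pmf)

text \<open>Invariance under updates at positions \<open>\<ge> n\<close> expresses that
  \<open>f\<close> reads only the first \<open>n\<close> pairs; the conditional laws of the later
  pairs then integrate to one.\<close>

lemma texp_restrict:
  assumes "n \<le> m" "\<And>\<omega> i x. n \<le> i \<Longrightarrow> f (fun_upd \<omega> i x) = f \<omega>"
  shows "texp \<rho> P \<theta> m f = texp \<rho> P \<theta> n f"
  using assms(1)
proof (induction m rule: dec_induct)
  case (step m)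
  have "texp \<rho> P \<theta> (Suc m) f = texp \<rho> P \<theta> m f"
    unfolding texp_Suc
    using step.hyps by (intro texp_cong)
      (simp add: assms(2) sum_softmax sum_pmf_eq_1 flip: scaleR_sum_left)
  with step.IH show ?case by simp
qed simp

lemma traj_score_Suc: "traj_score \<theta> (Suc n) \<omega> = traj_score \<theta> n \<omega> + score \<theta> (fst (\<omega> n)) (snd (\<omega> n))"
  by (simp add: traj_score_def)

lemma traj_score_upd: "n \<le> i \<Longrightarrow> traj_score \<theta> n (fun_upd \<omega> i x) = traj_score \<theta> n \<omega>"
  by (simp add: traj_score_def)

lemma norm_traj_score: "norm (traj_score \<theta> n \<omega>) \<le> sqrt 2 * real n"
proof -
  have "norm (traj_score \<theta> n \<omega>) \<le> (\<Sum>l<n. sqrt 2)"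
    unfolding traj_score_def by (intro sum_norm_le norm_score)
  then show ?thesis by (simp add: mult.commute)
qed

lemma abs_inner_traj_score: "\<bar>u \<bullet> traj_score \<theta> n \<omega>\<bar> \<le> sqrt 2 * real n * norm u"
  using Cauchy_Schwarz_ineq2[of u "traj_score \<theta> n \<omega>"]
    mult_left_mono[OF norm_traj_score[of \<theta> n \<omega>] norm_ge_zero[of u]]
  by (simp add: mult.commute)

text \<open>Log-derivative identity for a law with product structure. The integrand must be allowed
  to depend on \<open>x\<close>: peeling off the last pair averages the integrand over the moving
  policy, and this average is the integrand handed to the induction hypothesis.\<close>

lemma texp_deriv:
  fixes g :: "real \<Rightarrow> ('s::finite, 'a::finite) traj \<Rightarrow> real"
  assumes "\<And>\<omega>. ((\<lambda>x. g x \<omega>) has_real_derivative g' \<omega>) (at x0)"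
  shows "((\<lambda>x. texp \<rho> P (\<theta> + x *\<^sub>R u) n (g x)) has_real_derivative
    texp \<rho> P (\<theta> + x0 *\<^sub>R u) n (\<lambda>\<omega>. g x0 \<omega> * (u \<bullet> traj_score (\<theta> + x0 *\<^sub>R u) n \<omega>) + g' \<omega>)) (at x0)"
  using assms
proof (induction n arbitrary: g g')
  case 0
  then show ?case by (simp add: texp_0 traj_score_def)
next
  case (Suc n)
  let ?\<theta> = "\<lambda>x. \<theta> + x *\<^sub>R u"
  let ?G = "\<lambda>x \<omega>. \<Sum>s\<in>UNIV. pmf (next_pmf \<rho> P n \<omega>) s * (\<Sum>a\<in>UNIV. softmax (?\<theta> x) s a * g x (fun_upd \<omega> n (s, a)))"
  let ?G' = "\<lambda>\<omega>. \<Sum>s\<in>UNIV. pmf (next_pmf \<rho> P n \<omega>) s * (\<Sum>a\<in>UNIV. softmax (?\<theta> x0) s a *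
      (g x0 (fun_upd \<omega> n (s, a)) * (u \<bullet> score (?\<theta> x0) s a) + g' (fun_upd \<omega> n (s, a))))"
  have "((\<lambda>x. ?G x \<omega>) has_real_derivative ?G' \<omega>) (at x0)" for \<omega>
    by (auto intro!: derivative_eq_intros Suc.prems sum.cong simp: algebra_simps sum_distrib_left
        simp del: fun_upd_apply)
  from Suc.IH[where g="?G" and g'="?G'", OF this]
  have "((\<lambda>x. texp \<rho> P (?\<theta> x) (Suc n) (g x)) has_real_derivative
      texp \<rho> P (?\<theta> x0) n (\<lambda>\<omega>. ?G x0 \<omega> * (u \<bullet> traj_score (?\<theta> x0) n \<omega>) + ?G' \<omega>)) (at x0)"
    by (simp add: texp_Suc)
  also have "texp \<rho> P (?\<theta> x0) n (\<lambda>\<omega>. ?G x0 \<omega> * (u \<bullet> traj_score (?\<theta> x0) n \<omega>) + ?G' \<omega>)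
      = texp \<rho> P (?\<theta> x0) (Suc n) (\<lambda>\<omega>. g x0 \<omega> * (u \<bullet> traj_score (?\<theta> x0) (Suc n) \<omega>) + g' \<omega>)"
    unfolding texp_Suc
    by (rule texp_cong)
      (simp add: traj_score_Suc traj_score_upd inner_add_right algebra_simps sum.distrib sum_distrib_left)
  finally show ?case .
qed

text \<open>Contribution of the reward at time \<open>t\<close> to the policy gradient. The
  derivative of the entropy bonus itself is missing because it has mean zero, as
  \<open>rew_term_deriv\<close> shows.\<close>

definition grad_term :: "'s pmf \<Rightarrow> ('s::finite, 'a::finite) kernel \<Rightarrow> ('s, 'a) reward \<Rightarrow> real
    \<Rightarrow> ('s, 'a) param \<Rightarrow> nat \<Rightarrow> ('s, 'a) param" where
  "grad_term \<rho> P r lam \<theta> t = texp \<rho> P \<theta> (Suc t) (\<lambda>\<omega>. ent_rew lam r \<theta> (\<omega> t) *\<^sub>R traj_score \<theta> (Suc t) \<omega>)"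

definition rew_term :: "'s pmf \<Rightarrow> ('s::finite, 'a::finite) kernel \<Rightarrow> ('s, 'a) reward \<Rightarrow> real
    \<Rightarrow> ('s, 'a) param \<Rightarrow> nat \<Rightarrow> real" where
  "rew_term \<rho> P r lam \<theta> t = texp \<rho> P \<theta> (Suc t) (\<lambda>\<omega>. ent_rew lam r \<theta> (\<omega> t))"

definition trunc_grad :: "'s pmf \<Rightarrow> ('s::finite, 'a::finite) kernel \<Rightarrow> ('s, 'a) reward \<Rightarrow> real \<Rightarrow> real
    \<Rightarrow> nat \<Rightarrow> ('s, 'a) param \<Rightarrow> ('s, 'a) param" where
  "trunc_grad \<rho> P r \<gamma> lam T \<theta> = (\<Sum>t<T. \<gamma> ^ t *\<^sub>R grad_term \<rho> P r lam \<theta> t)"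

definition full_grad :: "'s pmf \<Rightarrow> ('s::finite, 'a::finite) kernel \<Rightarrow> ('s, 'a) reward \<Rightarrow> real \<Rightarrow> real
    \<Rightarrow> ('s, 'a) param \<Rightarrow> ('s, 'a) param" where
  "full_grad \<rho> P r \<gamma> lam \<theta> = (\<Sum>t. \<gamma> ^ t *\<^sub>R grad_term \<rho> P r lam \<theta> t)"

section \<open>The entropy-regularized reward and differentiated integrands\<close>

locale soft_mdp =
  fixes \<rho> :: "'s::finite pmf" and P :: "('s, 'a::finite) kernel" and r :: "('s, 'a) reward"
    and \<gamma> lam logA :: real
  assumes gamma: "0 < \<gamma>" "\<gamma> < 1" and lam: "0 < lam"
    and rew_bounds: "0 \<le> r s a" "r s a \<le> 1"
    and card_actions: "CARD('a) \<ge> 2" and logA_eq: "logA = ln (real CARD('a))"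
begin

abbreviation "Rmax \<equiv> 1 + lam * logA"
abbreviation "E \<equiv> texp \<rho> P"
abbreviation "rw \<equiv> ent_rew lam r"
abbreviation "G \<equiv> grad_term \<rho> P r lam"
abbreviation "Jt \<equiv> rew_term \<rho> P r lam"

lemma logA_ge: "2 / 3 \<le> logA"
  unfolding logA_eq by (rule ln_card_ge[OF card_actions])

lemma Rmax_ge_1: "1 \<le> Rmax"
  using lam logA_ge by simp

lemma rw_nonneg: "0 \<le> rw \<theta> x"
  unfolding ent_rew_def
  using rew_bounds lam softmax_pos softmax_le_1 
  by (smt (verit) ln_le_zero_iff mult_nonneg_nonpos)

lemma softmax_rw_le: "(\<Sum>a\<in>UNIV. softmax \<theta> s a * rw \<theta> (s, a)) \<le> Rmax"
proof -
  have "softmax \<theta> s a * rw \<theta> (s, a) \<le> softmax \<theta> s a + lam * (softmax \<theta> s a * - ln (softmax \<theta> s a))" for a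
    using mult_left_mono[OF rew_bounds(2)[of s a] less_imp_le[OF softmax_pos[of \<theta> s a]]]
    by (simp add: ent_rew_def algebra_simps)
  then have "(\<Sum>a\<in>UNIV. softmax \<theta> s a * rw \<theta> (s, a))
      \<le> (\<Sum>a\<in>UNIV. softmax \<theta> s a + lam * (softmax \<theta> s a * - ln (softmax \<theta> s a)))"
    by (rule sum_mono)
  also have "\<dots> = 1 + lam * (\<Sum>a\<in>UNIV. softmax \<theta> s a * - ln (softmax \<theta> s a))"
    by (simp only: sum.distrib sum_softmax sum_distrib_left)
  also have "\<dots> \<le> Rmax"
    using softmax_entropy_le[of \<theta> s] lam unfolding logA_eq by (intro add_left_mono mult_left_mono) auto
  finally show ?thesis .
qed

text \<open>Requires control only after averaging over the last action, which is what the unbounded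
  entropy bonus allows.\<close>

lemma texp_last_action:
  assumes "\<And>\<omega> s. (\<Sum>a\<in>UNIV. softmax \<theta> s a * h (fun_upd \<omega> n (s, a))) \<le> c"
  shows "E \<theta> (Suc n) h \<le> c"
proof -
  have "E \<theta> (Suc n) h \<le> E \<theta> n (\<lambda>\<omega>. \<Sum>s\<in>UNIV. pmf (next_pmf \<rho> P n \<omega>) s * c)"
    unfolding texp_Suc using assms by (intro texp_mono sum_mono) (auto intro!: mult_left_mono)
  then show ?thesis
    by (simp add: texp_const sum_pmf_eq_1 flip: sum_distrib_right)
qed

lemma texp_rw_le: "E \<theta> (Suc t) (\<lambda>\<omega>. rw \<theta> (\<omega> t)) \<le> Rmax"
  by (rule texp_last_action) (simp add: softmax_rw_le)

text \<open>Common template for the gradient and its derivatives: their integrands are the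
  regularized reward times a deterministic factor, plus a deterministic remainder from
  differentiating the bonus.\<close>

lemma texp_rw_bound:
  assumes "\<And>\<omega>. norm (K \<omega>) \<le> rw \<theta> (\<omega> t) * c1 + c2" "0 \<le> c1"
  shows "norm (E \<theta> (Suc t) K) \<le> Rmax * c1 + c2"
proof -
  have "norm (E \<theta> (Suc t) K) \<le> E \<theta> (Suc t) (\<lambda>\<omega>. rw \<theta> (\<omega> t) * c1 + c2)"
    using assms(1) by (rule texp_norm_le)
  also have "\<dots> = c1 * E \<theta> (Suc t) (\<lambda>\<omega>. rw \<theta> (\<omega> t)) + c2"
    by (simp add: texp_add texp_const mult.commute texp_mult del: texp_sum)
  also have "\<dots> \<le> Rmax * c1 + c2"
    using mult_left_mono[OF texp_rw_le[of \<theta> t] assms(2)] by (simp add: mult.commute)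
  finally show ?thesis .
qed

lemma norm_grad_term: "norm (G \<theta> t) \<le> sqrt 2 * Rmax * (real t + 1)"
proof -
  have "norm (G \<theta> t) \<le> Rmax * (sqrt 2 * real (Suc t)) + 0"
    unfolding grad_term_def
    by (intro texp_rw_bound)
       (simp_all add: rw_nonneg mult_left_mono norm_traj_score del: of_nat_Suc)
  then show ?thesis by (simp add: mult_ac add.commute)
qed

lemma rew_term_bounds: "0 \<le> Jt \<theta> t" "Jt \<theta> t \<le> Rmax"
  using texp_rw_le[of \<theta> t] texp_mono[of "\<lambda>_. 0" "\<lambda>\<omega>. rw \<theta> (\<omega> t)" \<rho> P \<theta> "Suc t"]
  by (auto simp: rew_term_def texp_const rw_nonneg)

lemma rw_deriv:
  "((\<lambda>x. rw (\<theta> + x *\<^sub>R u) (s, a)) has_real_derivative - lam * (u \<bullet> score (\<theta> + x0 *\<^sub>R u) s a)) (at x0)"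
  unfolding ent_rew_def fst_conv snd_conv
  by (rule DERIV_cong, rule DERIV_diff[OF DERIV_const DERIV_cmult[OF ln_softmax_deriv]]) simp

text \<open>\<open>K0\<close>, \<open>K1\<close> and \<open>K2\<close> are the integrands of \<open>v \<bullet> G (\<theta> + x *\<^sub>R u) t\<close> and of its first two derivatives
  in \<open>x\<close>; \<open>dK0\<close> and \<open>dK1\<close> are the parts stemming from the integrand rather than from the law.\<close>

definition "K0 \<theta> v t \<omega> = (v \<bullet> traj_score \<theta> (Suc t) \<omega>) * rw \<theta> (\<omega> t)"
definition "cov_sum \<theta> u v t \<omega> = (\<Sum>l<Suc t. score_cov \<theta> u v (fst (\<omega> l)))"
definition "cov_sum' \<theta> u v t \<omega> = (\<Sum>l<Suc t. score_cov' \<theta> u v (fst (\<omega> l)))"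
definition "sc \<theta> u t \<omega> = u \<bullet> score \<theta> (fst (\<omega> t)) (snd (\<omega> t))"
definition "dK0 \<theta> u v t \<omega> = - cov_sum \<theta> u v t \<omega> * rw \<theta> (\<omega> t)
   - lam * (v \<bullet> traj_score \<theta> (Suc t) \<omega>) * sc \<theta> u t \<omega>"
definition "K1 \<theta> u v t \<omega> = K0 \<theta> v t \<omega> * (u \<bullet> traj_score \<theta> (Suc t) \<omega>) + dK0 \<theta> u v t \<omega>"
definition "dK1 \<theta> u v t \<omega> =
   dK0 \<theta> u v t \<omega> * (u \<bullet> traj_score \<theta> (Suc t) \<omega>) - K0 \<theta> v t \<omega> * cov_sum \<theta> u u t \<omega>
   - cov_sum' \<theta> u v t \<omega> * rw \<theta> (\<omega> t) + 2 * lam * cov_sum \<theta> u v t \<omega> * sc \<theta> u t \<omega>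
   + lam * (v \<bullet> traj_score \<theta> (Suc t) \<omega>) * score_cov \<theta> u u (fst (\<omega> t))"
definition "K2 \<theta> u v t \<omega> = K1 \<theta> u v t \<omega> * (u \<bullet> traj_score \<theta> (Suc t) \<omega>) + dK1 \<theta> u v t \<omega>"

lemma traj_score_deriv:
  "((\<lambda>x. v \<bullet> traj_score (\<theta> + x *\<^sub>R u) (Suc t) \<omega>) has_real_derivative
     - cov_sum (\<theta> + x0 *\<^sub>R u) u v t \<omega>) (at x0)"
  unfolding traj_score_def cov_sum_def inner_sum_right sum_negf[symmetric]
  by (intro DERIV_sum inner_score_deriv)

lemma cov_sum_deriv:
  "((\<lambda>x. cov_sum (\<theta> + x *\<^sub>R u) u v t \<omega>) has_real_derivative
     cov_sum' (\<theta> + x0 *\<^sub>R u) u v t \<omega>) (at x0)"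
  unfolding cov_sum'_def cov_sum_def by (intro DERIV_sum score_cov_deriv)

lemma rw_deriv': "((\<lambda>x. rw (\<theta> + x *\<^sub>R u) (\<omega> t)) has_real_derivative - lam * sc (\<theta> + x0 *\<^sub>R u) u t \<omega>) (at x0)"
  using rw_deriv[of \<theta> u "fst (\<omega> t)" "snd (\<omega> t)" x0] by (simp add: sc_def)

lemma sc_deriv: "((\<lambda>x. sc (\<theta> + x *\<^sub>R u) v t \<omega>) has_real_derivative
    - score_cov (\<theta> + x0 *\<^sub>R u) u v (fst (\<omega> t))) (at x0)"
  unfolding sc_def by (rule inner_score_deriv)

lemma K0_deriv: "((\<lambda>x. K0 (\<theta> + x *\<^sub>R u) v t \<omega>) has_real_derivative dK0 (\<theta> + x0 *\<^sub>R u) u v t \<omega>) (at x0)"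
  unfolding K0_def dK0_def
  by (auto intro!: derivative_eq_intros traj_score_deriv rw_deriv'[where \<omega>=\<omega> and t=t] simp: algebra_simps)

lemma K1_deriv: "((\<lambda>x. K1 (\<theta> + x *\<^sub>R u) u v t \<omega>) has_real_derivative dK1 (\<theta> + x0 *\<^sub>R u) u v t \<omega>) (at x0)"
proof -
  have "((\<lambda>x. dK0 (\<theta> + x *\<^sub>R u) u v t \<omega>) has_real_derivative
      - cov_sum' (\<theta> + x0 *\<^sub>R u) u v t \<omega> * rw (\<theta> + x0 *\<^sub>R u) (\<omega> t)
      + 2 * lam * cov_sum (\<theta> + x0 *\<^sub>R u) u v t \<omega> * sc (\<theta> + x0 *\<^sub>R u) u t \<omega>
      + lam * (v \<bullet> traj_score (\<theta> + x0 *\<^sub>R u) (Suc t) \<omega>) * score_cov (\<theta> + x0 *\<^sub>R u) u u (fst (\<omega> t))) (at x0)"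
    unfolding dK0_def
    by (auto intro!: derivative_eq_intros traj_score_deriv rw_deriv'[where \<omega>=\<omega> and t=t] cov_sum_deriv sc_deriv simp: algebra_simps)
  then show ?thesis
    unfolding K1_def dK1_def
    by (auto intro!: derivative_eq_intros traj_score_deriv K0_deriv simp: algebra_simps)
qed

lemma inner_grad_term: "v \<bullet> G \<theta> t = E \<theta> (Suc t) (K0 \<theta> v t)"
  unfolding grad_term_def K0_def texp_inner[symmetric] by (intro texp_cong) simp

lemma inner_grad_term_deriv:
  "((\<lambda>x. v \<bullet> G (\<theta> + x *\<^sub>R u) t) has_real_derivative E (\<theta> + x0 *\<^sub>R u) (Suc t) (K1 (\<theta> + x0 *\<^sub>R u) u v t)) (at x0)"
  unfolding inner_grad_term K1_def by (rule texp_deriv) (rule K0_deriv)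

lemma inner_grad_term_deriv2:
  "((\<lambda>x. E (\<theta> + x *\<^sub>R u) (Suc t) (K1 (\<theta> + x *\<^sub>R u) u v t)) has_real_derivative
    E (\<theta> + x0 *\<^sub>R u) (Suc t) (K2 (\<theta> + x0 *\<^sub>R u) u v t)) (at x0)"
  unfolding K2_def by (rule texp_deriv) (rule K1_deriv)

end

section \<open>Smoothness of the regularized objective\<close>

lemma mvt_bound:
  fixes g :: "real \<Rightarrow> real"
  assumes "\<And>x. (g has_real_derivative g' x) (at x)" "\<And>x. \<bar>g' x\<bar> \<le> M"
  shows "\<bar>g 1 - g 0\<bar> \<le> M"
proof -
  from MVT2[of 0 1 g g'] assms(1) obtain z where "g 1 - g 0 = g' z" by auto
  then show ?thesis using assms(2)[of z] by simp
qed

lemma taylor_bound: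
  fixes g :: "real \<Rightarrow> real"
  assumes "\<And>x. (g has_real_derivative g' x) (at x)" "\<And>x. (g' has_real_derivative g'' x) (at x)"
    "\<And>x. \<bar>g'' x\<bar> \<le> M"
  shows "\<bar>g 1 - g 0 - g' 0\<bar> \<le> M / 2"
proof -
  define d where "d m = (if m = 0 then g else if m = 1 then g' else g'')" for m :: nat
  have d: "\<forall>m t. m < 2 \<and> 0 \<le> t \<and> t \<le> 1 \<longrightarrow> (d m has_real_derivative d (Suc m) t) (at t)"
    using assms(1,2) by (auto simp: d_def less_2_cases_iff)
  have "\<exists>t>0. t < 1 \<and> g 1 = (\<Sum>m<2. d m 0 / fact m * 1 ^ m) + d 2 t / fact 2 * 1 ^ 2"
    by (rule Maclaurin[of 1 2 d g]) (use d in \<open>auto simp: d_def\<close>)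
  then obtain t where "g 1 = g 0 + g' 0 + g'' t / 2"
    by (auto simp: d_def numeral_2_eq_2)
  then show ?thesis using assms(3)[of t] by simp
qed

lemma texp_linear:
  assumes "\<And>\<omega>. linear (\<lambda>u. F u \<omega>)"
  shows "linear (\<lambda>u. texp \<rho> P \<theta> n (F u))"
proof (rule linearI)
  show "texp \<rho> P \<theta> n (F (a + b)) = texp \<rho> P \<theta> n (F a) + texp \<rho> P \<theta> n (F b)" for a b
    unfolding texp_add[symmetric] by (intro texp_cong linear_add assms)
  show "texp \<rho> P \<theta> n (F (c *\<^sub>R a)) = c *\<^sub>R texp \<rho> P \<theta> n (F a)" for c a
    unfolding texp_scaleR[symmetric] by (intro texp_cong linear_cmul assms)
qed

lemma sqrt2_le: "sqrt 2 \<le> 3 / 2"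
  by (rule real_le_lsqrt) (auto simp: power2_eq_square)

text \<open>Pure bookkeeping with \<open>q\<close> in place of \<open>sqrt 2\<close>, so that only
  \<open>q * q = 2\<close> is used and each monomial keeps at most one factor
  \<open>q\<close>.\<close>

lemma K2_collect:
  fixes q :: real
  assumes "q * q = 2"
  shows "R * ((q * N * B) * (q * N * A) * (q * N * A)
        + 2 * (N * (q * A * B) * (q * N * A)) + (q * N * B) * (N * (q * A * A)) + N * (4 * A\<^sup>2 * B))
      + lam * (2 * (N * (q * A * B) * (q * A)) + (q * N * B) * (q * A * A)
        + 2 * ((q * N * B) * (q * A) * (q * N * A)))
    = R * ((2 * (q * N ^ 3) + 6 * N\<^sup>2 + 4 * N) * (A\<^sup>2 * B))
      + lam * ((6 * N + 4 * (q * N\<^sup>2)) * (A\<^sup>2 * B))"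
proof -
  have 1: "(q * N * B) * (q * N * A) * (q * N * A) = (q * q) * (q * N ^ 3 * (A\<^sup>2 * B))"
    "(N * (q * A * B)) * (q * N * A) = (q * q) * (N\<^sup>2 * (A\<^sup>2 * B))"
    "(q * N * B) * (N * (q * A * A)) = (q * q) * (N\<^sup>2 * (A\<^sup>2 * B))"
    "(N * (q * A * B)) * (q * A) = (q * q) * (N * (A\<^sup>2 * B))"
    "(q * N * B) * (q * A * A) = (q * q) * (N * (A\<^sup>2 * B))"
    "(q * N * B) * (q * A) * (q * N * A) = (q * q) * (q * N\<^sup>2 * (A\<^sup>2 * B))"
    by (simp_all only: power2_eq_square power3_eq_cube mult_ac)
  show ?thesis
    unfolding 1 assms by (simp add: distrib_left distrib_right)
qed

context soft_mdp
begin

definition "L2 = (8 + lam * (4 + 8 * logA)) / (1 - \<gamma>) ^ 3"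
definition "L3 = (480 + 832 * lam * logA) / (1 - \<gamma>) ^ 4"

section \<open>Smoothness bounds uniform in the horizon\<close>

lemma abs_cov_sum: "\<bar>cov_sum \<theta> u v t \<omega>\<bar> \<le> (real t + 1) * (sqrt 2 * norm u * norm v)"
  unfolding cov_sum_def
  by (rule order_trans[OF sum_abs], rule order_trans[OF sum_bounded_above[OF abs_score_cov]]) (simp add: add.commute)

lemma abs_cov_sum': "\<bar>cov_sum' \<theta> u v t \<omega>\<bar> \<le> (real t + 1) * (4 * (norm u)\<^sup>2 * norm v)"
  unfolding cov_sum'_def
  by (rule order_trans[OF sum_abs], rule order_trans[OF sum_bounded_above[OF abs_score_cov']]) (simp add: add.commute)

lemma abs_traj_score: "\<bar>u \<bullet> traj_score \<theta> (Suc t) \<omega>\<bar> \<le> sqrt 2 * (real t + 1) * norm u"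
  using abs_inner_traj_score[of u \<theta> "Suc t" \<omega>] by (simp add: add.commute)

lemma abs_sc: "\<bar>sc \<theta> u t \<omega>\<bar> \<le> sqrt 2 * norm u"
  unfolding sc_def by (rule abs_inner_score)

lemma abs_diff_le: "\<bar>a\<bar> \<le> A \<Longrightarrow> \<bar>b\<bar> \<le> B \<Longrightarrow> \<bar>a - b\<bar> \<le> A + B" for a b A B :: real
  by linarith

lemma abs_sum_le: "\<bar>a\<bar> \<le> A \<Longrightarrow> \<bar>b\<bar> \<le> B \<Longrightarrow> \<bar>a + b\<bar> \<le> A + B" for a b A B :: real
  by linarith

lemma abs_K1:
  "\<bar>K1 \<theta> u v t \<omega>\<bar> \<le> rw \<theta> (\<omega> t) * (4 * (real t + 1)\<^sup>2 * norm u * norm v)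
     + 2 * lam * (real t + 1)\<^sup>2 * norm u * norm v"
proof -
  define N A B where "N = real t + 1" and "A = norm u" and "B = norm v"
  let ?vS = "v \<bullet> traj_score \<theta> (Suc t) \<omega>" and ?uS = "u \<bullet> traj_score \<theta> (Suc t) \<omega>"
  let ?R = "rw \<theta> (\<omega> t)" and ?C = "cov_sum \<theta> u v t \<omega>" and ?sc = "sc \<theta> u t \<omega>"
  have N: "1 \<le> N" "N \<le> N\<^sup>2" and AB: "0 \<le> A * B" by (auto simp: N_def A_def B_def self_le_power)
  have s: "sqrt 2 * N \<le> 2 * N\<^sup>2"
    using N sqrt2_le by (intro mult_mono) auto
  have "K1 \<theta> u v t \<omega> = ?R * (?vS * ?uS - ?C) - lam * (?vS * ?sc)"
    by (simp add: K1_def K0_def dK0_def algebra_simps)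
  also have "\<bar>\<dots>\<bar> \<le> ?R * ((sqrt 2 * N * B) * (sqrt 2 * N * A) + N * (sqrt 2 * A * B))
      + lam * ((sqrt 2 * N * B) * (sqrt 2 * A))"
    unfolding N_def A_def B_def
    by (intro abs_diff_le abs_mult_le abs_traj_score abs_cov_sum abs_sc) (use lam rw_nonneg in auto)
  also have "\<dots> = ?R * ((2 * N\<^sup>2 + sqrt 2 * N) * (A * B)) + lam * ((2 * N) * (A * B))"
    by (simp add: algebra_simps power2_eq_square)
  also have "\<dots> \<le> ?R * ((4 * N\<^sup>2) * (A * B)) + lam * ((2 * N\<^sup>2) * (A * B))"
    using N AB s rw_nonneg[of \<theta> "\<omega> t"] lam
    by (intro add_mono mult_left_mono mult_right_mono) auto
  finally show ?thesis by (simp add: N_def A_def B_def mult_ac)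
qed

lemma abs_K2:
  "\<bar>K2 \<theta> u v t \<omega>\<bar> \<le> rw \<theta> (\<omega> t) * (13 * (real t + 1) ^ 3 * (norm u)\<^sup>2 * norm v)
     + 12 * lam * (real t + 1) ^ 3 * (norm u)\<^sup>2 * norm v"
proof -
  define N A B where "N = real t + 1" and "A = norm u" and "B = norm v"
  let ?vS = "v \<bullet> traj_score \<theta> (Suc t) \<omega>" and ?uS = "u \<bullet> traj_score \<theta> (Suc t) \<omega>"
  let ?R = "rw \<theta> (\<omega> t)" and ?C = "cov_sum \<theta> u v t \<omega>" and ?sc = "sc \<theta> u t \<omega>"
  let ?Cu = "cov_sum \<theta> u u t \<omega>" and ?C' = "cov_sum' \<theta> u v t \<omega>" and ?c = "score_cov \<theta> u u (fst (\<omega> t))"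
  have N: "1 \<le> N" "N \<le> N ^ 3" "N\<^sup>2 \<le> N ^ 3" and AB: "0 \<le> A\<^sup>2 * B"
    by (auto simp: N_def A_def B_def self_le_power intro: power_increasing)
  have eq: "K2 \<theta> u v t \<omega> = ?R * (?vS * ?uS * ?uS - 2 * (?C * ?uS) - ?vS * ?Cu - ?C')
      + lam * (2 * (?C * ?sc) + ?vS * ?c - 2 * (?vS * ?sc * ?uS))"
    by (simp add: K2_def K1_def K0_def dK0_def dK1_def algebra_simps)
  have "\<bar>K2 \<theta> u v t \<omega>\<bar> \<le> ?R * ((sqrt 2 * N * B) * (sqrt 2 * N * A) * (sqrt 2 * N * A)
        + 2 * (N * (sqrt 2 * A * B) * (sqrt 2 * N * A)) + (sqrt 2 * N * B) * (N * (sqrt 2 * A * A)) + N * (4 * A\<^sup>2 * B))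
      + lam * (2 * (N * (sqrt 2 * A * B) * (sqrt 2 * A)) + (sqrt 2 * N * B) * (sqrt 2 * A * A)
        + 2 * ((sqrt 2 * N * B) * (sqrt 2 * A) * (sqrt 2 * N * A)))"
  proof -
    have R: "\<bar>?R\<bar> \<le> ?R" and l: "\<bar>lam\<bar> \<le> lam" and two: "\<bar>2\<bar> \<le> (2::real)"
      using rw_nonneg[of \<theta> "\<omega> t"] lam by simp_all
    have b: "\<bar>?vS\<bar> \<le> sqrt 2 * N * B" "\<bar>?uS\<bar> \<le> sqrt 2 * N * A" "\<bar>?C\<bar> \<le> N * (sqrt 2 * A * B)"
      "\<bar>?sc\<bar> \<le> sqrt 2 * A" "\<bar>?Cu\<bar> \<le> N * (sqrt 2 * A * A)" "\<bar>?C'\<bar> \<le> N * (4 * A\<^sup>2 * B)"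
      "\<bar>?c\<bar> \<le> sqrt 2 * A * A"
      unfolding N_def A_def B_def
      by (rule abs_traj_score abs_cov_sum abs_cov_sum' abs_sc abs_score_cov)+
    note m = abs_mult_le
    show ?thesis
      unfolding eq
      by (rule abs_sum_le[OF m[OF R abs_diff_le[OF abs_diff_le[OF abs_diff_le[OF m[OF m[OF b(1) b(2)] b(2)]
            m[OF two m[OF b(3) b(2)]]] m[OF b(1) b(5)]] b(6)]]
          m[OF l abs_diff_le[OF abs_sum_le[OF m[OF two m[OF b(3) b(4)]] m[OF b(1) b(7)]]
            m[OF two m[OF m[OF b(1) b(4)] b(2)]]]]])
  qed
  also have "\<dots> = ?R * ((2 * (sqrt 2 * N ^ 3) + 6 * N\<^sup>2 + 4 * N) * (A\<^sup>2 * B))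
      + lam * ((6 * N + 4 * (sqrt 2 * N\<^sup>2)) * (A\<^sup>2 * B))"
    by (rule K2_collect) simp
  also have "\<dots> \<le> ?R * ((13 * N ^ 3) * (A\<^sup>2 * B)) + lam * ((12 * N ^ 3) * (A\<^sup>2 * B))"
  proof -
    have "sqrt 2 * N ^ 3 \<le> 3 / 2 * N ^ 3" "sqrt 2 * N\<^sup>2 \<le> 3 / 2 * N\<^sup>2"
      using sqrt2_le N by (intro mult_right_mono; simp)+
    \<comment> \<open>The constants are \<open>2 * 3/2 + 6 + 4 = 13\<close> and
      \<open>6 + 4 * 3/2 = 12\<close>.\<close>
    then have "2 * (sqrt 2 * N ^ 3) + 6 * N\<^sup>2 + 4 * N \<le> 13 * N ^ 3" "6 * N + 4 * (sqrt 2 * N\<^sup>2) \<le> 12 * N ^ 3"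
      using N by linarith+
    then show ?thesis
      using AB rw_nonneg[of \<theta> "\<omega> t"] lam by (intro add_mono mult_left_mono mult_right_mono) simp_all
  qed
  finally show ?thesis by (simp add: N_def A_def B_def mult_ac)
qed

abbreviation "TG \<equiv> trunc_grad \<rho> P r \<gamma> lam"

text \<open>First derivative in direction \<open>u\<close> of the truncated gradient, paired with
  \<open>v\<close>. Together with \<open>DDTG\<close> it is kept as a scalar form, so that
  one-dimensional calculus along a line is enough.\<close>

definition "DTG T \<theta> u v = (\<Sum>t<T. \<gamma> ^ t * E \<theta> (Suc t) (K1 \<theta> u v t))"
definition "DDTG T \<theta> u v = (\<Sum>t<T. \<gamma> ^ t * E \<theta> (Suc t) (K2 \<theta> u v t))"

lemma TG_deriv: "((\<lambda>x. v \<bullet> TG T (\<theta> + x *\<^sub>R u)) has_real_derivative DTG T (\<theta> + x0 *\<^sub>R u) u v) (at x0)"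
  unfolding trunc_grad_def DTG_def inner_sum_right inner_scaleR_right
  by (intro DERIV_sum DERIV_cmult inner_grad_term_deriv)

lemma DTG_deriv: "((\<lambda>x. DTG T (\<theta> + x *\<^sub>R u) u v) has_real_derivative DDTG T (\<theta> + x0 *\<^sub>R u) u v) (at x0)"
  unfolding DTG_def DDTG_def by (intro DERIV_sum DERIV_cmult inner_grad_term_deriv2)

lemma abs_DTG: "\<bar>DTG T \<theta> u v\<bar> \<le> L2 * norm u * norm v"
proof -
  have key: "\<bar>E \<theta> (Suc t) (K1 \<theta> u v t)\<bar> \<le> (4 * Rmax + 2 * lam) * norm u * norm v * (real t + 1)\<^sup>2" for t
    using texp_rw_bound[of "K1 \<theta> u v t" \<theta> t "4 * (real t + 1)\<^sup>2 * norm u * norm v"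
        "2 * lam * (real t + 1)\<^sup>2 * norm u * norm v"] abs_K1
    by (simp add: algebra_simps)
  have "\<bar>DTG T \<theta> u v\<bar> \<le> (\<Sum>t<T. \<gamma> ^ t * ((4 * Rmax + 2 * lam) * norm u * norm v * (real t + 1)\<^sup>2))"
    unfolding DTG_def abs_mult using gamma
    by (intro order_trans[OF sum_abs] sum_mono)
      (simp only: abs_mult power_abs abs_of_pos, intro mult_left_mono key, simp)
  also have "\<dots> = (4 * Rmax + 2 * lam) * norm u * norm v * (\<Sum>t<T. \<gamma> ^ t * (real t + 1)\<^sup>2)"
    unfolding sum_distrib_left by (intro sum.cong) (simp_all only: mult_ac)
  also have "\<dots> \<le> (4 * Rmax + 2 * lam) * norm u * norm v * (2 / (1 - \<gamma>) ^ 3)"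
    using lam Rmax_ge_1 by (intro mult_left_mono sum_geometric_bounds gamma mult_nonneg_nonneg) auto
  also have "\<dots> = L2 * norm u * norm v"
    by (simp add: L2_def algebra_simps add_divide_distrib)
  finally show ?thesis .
qed

lemma abs_DDTG: "\<bar>DDTG T \<theta> u v\<bar> \<le> L3 * (norm u)\<^sup>2 * norm v"
proof -
  have key: "\<bar>E \<theta> (Suc t) (K2 \<theta> u v t)\<bar> \<le> (13 * Rmax + 12 * lam) * (norm u)\<^sup>2 * norm v * (real t + 1) ^ 3" for t
    using texp_rw_bound[of "K2 \<theta> u v t" \<theta> t "13 * (real t + 1) ^ 3 * (norm u)\<^sup>2 * norm v"
        "12 * lam * (real t + 1) ^ 3 * (norm u)\<^sup>2 * norm v"] abs_K2
    by (simp add: algebra_simps)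
  have "\<bar>DDTG T \<theta> u v\<bar> \<le> (\<Sum>t<T. \<gamma> ^ t * ((13 * Rmax + 12 * lam) * (norm u)\<^sup>2 * norm v * (real t + 1) ^ 3))"
    unfolding DDTG_def abs_mult using gamma
    by (intro order_trans[OF sum_abs] sum_mono)
      (simp only: abs_mult power_abs abs_of_pos, intro mult_left_mono key, simp)
  also have "\<dots> = (13 * Rmax + 12 * lam) * (norm u)\<^sup>2 * norm v * (\<Sum>t<T. \<gamma> ^ t * (real t + 1) ^ 3)"
    unfolding sum_distrib_left by (intro sum.cong) (simp_all only: mult_ac)
  also have "\<dots> \<le> (13 * Rmax + 12 * lam) * (norm u)\<^sup>2 * norm v * (6 / (1 - \<gamma>) ^ 4)"
    using lam Rmax_ge_1 by (intro mult_left_mono sum_geometric_bounds gamma mult_nonneg_nonneg) auto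
  also have "\<dots> = (6 * (13 * Rmax + 12 * lam)) / (1 - \<gamma>) ^ 4 * (norm u)\<^sup>2 * norm v"
    by simp
  also have "\<dots> \<le> L3 * (norm u)\<^sup>2 * norm v"
  proof -
    \<comment> \<open>The stray multiple of \<open>lam\<close> from differentiating the bonus is
      converted into a multiple of \<open>lam * logA\<close>.\<close>
    have "lam * (2 / 3) \<le> lam * logA"
      using lam logA_ge by (intro mult_left_mono) auto
    then have "6 * (13 * Rmax + 12 * lam) \<le> 480 + 832 * lam * logA"
      using lam unfolding mult.assoc distrib_left by linarith
    then show ?thesis
      unfolding L3_def using gamma
      by (intro mult_right_mono divide_right_mono) auto
  qed
  finally show ?thesis .
qed

lemma L2_pos: "0 < L2"
proof -
  have "0 < lam * (4 + 8 * logA)"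
    using lam logA_ge by (intro mult_pos_pos) linarith+
  then show ?thesis
    unfolding L2_def using gamma by (intro divide_pos_pos) simp_all
qed

lemma L3_pos: "0 < L3"
proof -
  have "0 < lam * logA"
    using lam logA_ge by (intro mult_pos_pos) linarith+
  then show ?thesis
    unfolding L3_def using gamma by (intro divide_pos_pos) simp_all
qed

lemma norm_le_dual:
  fixes w :: "'v::real_inner"
  assumes "\<And>v. \<bar>v \<bullet> w\<bar> \<le> c * norm v" "0 \<le> c"
  shows "norm w \<le> c"
proof (cases "norm w = 0")
  case False
  have "norm w * norm w \<le> c * norm w"
    using assms(1)[of w] by (simp add: dot_square_norm power2_eq_square)
  then show ?thesis using False by simp
qed (use assms in simp)

lemma TG_lipschitz: "norm (TG T \<theta>' - TG T \<theta>) \<le> L2 * norm (\<theta>' - \<theta>)"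
proof (rule norm_le_dual)
  fix v
  have "\<bar>v \<bullet> TG T (\<theta> + 1 *\<^sub>R (\<theta>' - \<theta>)) - v \<bullet> TG T (\<theta> + 0 *\<^sub>R (\<theta>' - \<theta>))\<bar> \<le> L2 * norm (\<theta>' - \<theta>) * norm v"
    by (rule mvt_bound[OF TG_deriv abs_DTG])
  then show "\<bar>v \<bullet> (TG T \<theta>' - TG T \<theta>)\<bar> \<le> L2 * norm (\<theta>' - \<theta>) * norm v"
    by (simp add: inner_diff_right)
qed (use L2_pos in simp)

text \<open>The Jacobian has to be exhibited as a linear map into parameter space, whereas
  \<open>DTG\<close> is scalar. The vector-valued integrand \<open>F\<close> is linear in
  \<open>u\<close> and its inner product with \<open>v\<close> is \<open>K1\<close>; the remainder
  bound is then tested against every \<open>v\<close>.\<close>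

lemma TG_taylor: "\<exists>A. linear A \<and> (\<forall>u. norm (TG T (\<theta> + u) - TG T \<theta> - A u) \<le> L3 / 2 * (norm u)\<^sup>2)"
proof -
  \<comment> \<open>\<open>cv\<close> is the vector representing \<open>cov_sum\<close> as a
    functional of \<open>v\<close>.\<close>
  define cv where "cv u t \<omega> = (\<Sum>l<Suc t. \<Sum>b\<in>UNIV. (softmax \<theta> (fst (\<omega> l)) b * (u \<bullet> score \<theta> (fst (\<omega> l)) b))
      *\<^sub>R (axis (fst (\<omega> l), b) 1 :: ('s, 'a) param))" for u :: "('s, 'a) param" and t and \<omega> :: "('s, 'a) traj"
  define F where "F u t \<omega> = (rw \<theta> (\<omega> t) * (u \<bullet> traj_score \<theta> (Suc t) \<omega>)) *\<^sub>R traj_score \<theta> (Suc t) \<omega>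
      - rw \<theta> (\<omega> t) *\<^sub>R cv u t \<omega> - (lam * sc \<theta> u t \<omega>) *\<^sub>R traj_score \<theta> (Suc t) \<omega>" for u t \<omega>
  define A where "A u = (\<Sum>t<T. \<gamma> ^ t *\<^sub>R E \<theta> (Suc t) (F u t))" for u
  have "linear (\<lambda>u. cv u t \<omega>)" for t \<omega>
    unfolding cv_def
    by (intro linear_compose_sum ballI) (rule linearI, auto simp: inner_add_left algebra_simps)
  then have "linear (\<lambda>u. F u t \<omega>)" for t \<omega>
    unfolding F_def sc_def
    by (intro linear_compose_sub linear_compose_scale_right)
      (auto intro!: linearI simp: inner_add_left algebra_simps)
  then have lin: "linear A"
    unfolding A_def by (intro linear_compose_sum linear_compose_scale_right texp_linear ballI)
  have A: "v \<bullet> A u = DTG T \<theta> u v" for u v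
  proof -
    have "v \<bullet> cv u t \<omega> = cov_sum \<theta> u v t \<omega>" for t \<omega>
      unfolding cv_def cov_sum_def score_cov_def
      by (simp add: inner_sum_right inner_axis mult_ac del: sum.lessThan_Suc)
    then have "v \<bullet> F u t \<omega> = K1 \<theta> u v t \<omega>" for t \<omega>
      by (simp add: F_def K1_def K0_def dK0_def inner_diff_right algebra_simps)
    then show ?thesis
      unfolding A_def DTG_def inner_sum_right inner_scaleR_right texp_inner[symmetric] by simp
  qed
  have "norm (TG T (\<theta> + u) - TG T \<theta> - A u) \<le> L3 / 2 * (norm u)\<^sup>2" for u
  proof (rule norm_le_dual)
    fix v
    have "\<bar>v \<bullet> TG T (\<theta> + 1 *\<^sub>R u) - v \<bullet> TG T (\<theta> + 0 *\<^sub>R u) - DTG T (\<theta> + 0 *\<^sub>R u) u v\<bar>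
        \<le> L3 * (norm u)\<^sup>2 * norm v / 2"
      by (rule taylor_bound[OF TG_deriv DTG_deriv abs_DDTG])
    then show "\<bar>v \<bullet> (TG T (\<theta> + u) - TG T \<theta> - A u)\<bar> \<le> L3 / 2 * (norm u)\<^sup>2 * norm v"
      by (simp add: inner_diff_right A)
  qed (use L3_pos in simp)
  then show ?thesis using lin by (intro exI[of _ A] conjI allI)
qed

lemma rew_term_deriv: "((\<lambda>x. Jt (\<theta> + x *\<^sub>R u) t) has_real_derivative u \<bullet> G (\<theta> + x0 *\<^sub>R u) t) (at x0)"
proof -
  let ?\<theta> = "\<theta> + x0 *\<^sub>R u"
  have "((\<lambda>x. Jt (\<theta> + x *\<^sub>R u) t) has_real_derivative
      E ?\<theta> (Suc t) (\<lambda>\<omega>. rw ?\<theta> (\<omega> t) * (u \<bullet> traj_score ?\<theta> (Suc t) \<omega>) + - lam * sc ?\<theta> u t \<omega>)) (at x0)"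
    unfolding rew_term_def by (rule texp_deriv) (rule rw_deriv')
  also have "E ?\<theta> (Suc t) (\<lambda>\<omega>. rw ?\<theta> (\<omega> t) * (u \<bullet> traj_score ?\<theta> (Suc t) \<omega>) + - lam * sc ?\<theta> u t \<omega>)
      = E ?\<theta> (Suc t) (K0 ?\<theta> u t) + - lam * E ?\<theta> (Suc t) (sc ?\<theta> u t)"
    unfolding texp_mult[symmetric] texp_add[symmetric] K0_def by (rule texp_cong) simp
  \<comment> \<open>The bonus differentiates to the score of the last action, whose average under
    the policy vanishes.\<close>
  also have "E ?\<theta> (Suc t) (sc ?\<theta> u t) = 0"
    unfolding texp_Suc by (simp add: sc_def expect_softmax_score texp_const)
  finally show ?thesis by (simp add: inner_grad_term)
qed

section \<open>Passage to the infinite horizon\<close>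

definition "J \<theta> = (\<Sum>t. \<gamma> ^ t * Jt \<theta> t)"
abbreviation "FG \<equiv> full_grad \<rho> P r \<gamma> lam"

lemma trunc_ascent:
  "(\<Sum>t<T. \<gamma> ^ t * Jt (\<theta> + u) t) \<ge> (\<Sum>t<T. \<gamma> ^ t * Jt \<theta> t) + u \<bullet> TG T \<theta> - L2 / 2 * (norm u)\<^sup>2"
proof -
  have d: "((\<lambda>x. \<Sum>t<T. \<gamma> ^ t * Jt (\<theta> + x *\<^sub>R u) t) has_real_derivative u \<bullet> TG T (\<theta> + x0 *\<^sub>R u)) (at x0)" for x0
    unfolding trunc_grad_def inner_sum_right inner_scaleR_right
    by (intro DERIV_sum DERIV_cmult rew_term_deriv)
  have "\<bar>(\<Sum>t<T. \<gamma> ^ t * Jt (\<theta> + 1 *\<^sub>R u) t) - (\<Sum>t<T. \<gamma> ^ t * Jt (\<theta> + 0 *\<^sub>R u) t) - u \<bullet> TG T (\<theta> + 0 *\<^sub>R u)\<bar>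
      \<le> L2 * norm u * norm u / 2"
    by (rule taylor_bound[OF d TG_deriv abs_DTG])
  from abs_le_D2[OF this] show ?thesis by (simp add: power2_eq_square)
qed

lemma summable_J: "summable (\<lambda>t. \<gamma> ^ t * Jt \<theta> t)"
proof (rule summable_comparison_test'[where N=0])
  show "summable (\<lambda>t. Rmax * \<gamma> ^ t)"
    using gamma by (intro summable_mult summable_geometric) simp
  show "norm (\<gamma> ^ t * Jt \<theta> t) \<le> Rmax * \<gamma> ^ t" for t
    using rew_term_bounds[of \<theta> t] gamma by (simp add: mult.commute[of Rmax] mult_left_mono)
qed

lemma norm_grad_sum_le: "norm (\<gamma> ^ t *\<^sub>R G \<theta> t) \<le> sqrt 2 * Rmax * (\<gamma> ^ t * (real t + 1))"
  using mult_left_mono[OF norm_grad_term[of \<theta> t], of "\<gamma> ^ t"] gamma by (simp add: mult_ac)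

lemma summable_arith_geo: "summable (\<lambda>t. \<gamma> ^ t * (real t + 1))"
  using gamma sum_geometric_bounds(2)[OF gamma]
  by (intro summableI_nonneg_bounded[where x="1 / (1 - \<gamma>)\<^sup>2"]) auto

lemma summable_G_norm: "summable (\<lambda>t. norm (\<gamma> ^ t *\<^sub>R G \<theta> t))"
  by (rule summable_comparison_test'[where N=0, OF summable_mult[OF summable_arith_geo]])
    (use norm_grad_sum_le in auto)

lemma summable_G: "summable (\<lambda>t. \<gamma> ^ t *\<^sub>R G \<theta> t)"
  using summable_G_norm by (rule summable_norm_cancel)

lemma TG_tendsto: "(\<lambda>T. TG T \<theta>) \<longlonglongrightarrow> FG \<theta>"
  unfolding trunc_grad_def full_grad_def using summable_G by (rule summable_LIMSEQ)

lemma J_tendsto: "(\<lambda>T. \<Sum>t<T. \<gamma> ^ t * Jt \<theta> t) \<longlonglongrightarrow> J \<theta>"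
  unfolding J_def using summable_J by (rule summable_LIMSEQ)

text \<open>The constant \<open>L2\<close> is the same for all horizons, so the truncated inequality
  passes to the limit and the series need not be differentiated term by term.\<close>

lemma ascent: "J (\<theta> + u) \<ge> J \<theta> + u \<bullet> FG \<theta> - L2 / 2 * (norm u)\<^sup>2"
proof (rule LIMSEQ_le[OF _ J_tendsto])
  show "(\<lambda>T. (\<Sum>t<T. \<gamma> ^ t * Jt \<theta> t) + u \<bullet> TG T \<theta> - L2 / 2 * (norm u)\<^sup>2)
      \<longlonglongrightarrow> J \<theta> + u \<bullet> FG \<theta> - L2 / 2 * (norm u)\<^sup>2"
    by (intro tendsto_intros J_tendsto TG_tendsto)
qed (use trunc_ascent in blast)

lemma J_bounds: "0 \<le> J \<theta>" "J \<theta> \<le> Rmax / (1 - \<gamma>)"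
proof -
  show "0 \<le> J \<theta>"
    unfolding J_def using gamma rew_term_bounds(1) by (intro suminf_nonneg summable_J) auto
  have "J \<theta> \<le> (\<Sum>t. Rmax * \<gamma> ^ t)"
    unfolding J_def using gamma rew_term_bounds(2)[of \<theta>]
    by (intro suminf_le summable_J summable_mult summable_geometric)
      (auto simp: mult.commute[of Rmax] intro: mult_left_mono)
  also have "\<dots> = Rmax * (1 / (1 - \<gamma>))"
    using gamma by (subst suminf_mult) (auto simp: suminf_geometric)
  finally show "J \<theta> \<le> Rmax / (1 - \<gamma>)" by simp
qed

lemma norm_TG: "norm (TG T \<theta>) \<le> sqrt 2 * Rmax / (1 - \<gamma>)\<^sup>2"
proof -
  have "norm (TG T \<theta>) \<le> (\<Sum>t<T. sqrt 2 * Rmax * (\<gamma> ^ t * (real t + 1)))"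
    unfolding trunc_grad_def by (intro sum_norm_le norm_grad_sum_le)
  also have "\<dots> = sqrt 2 * Rmax * (\<Sum>t<T. \<gamma> ^ t * (real t + 1))"
    by (simp only: sum_distrib_left)
  also have "\<dots> \<le> sqrt 2 * Rmax * (1 / (1 - \<gamma>)\<^sup>2)"
    using Rmax_ge_1 by (intro mult_left_mono sum_geometric_bounds gamma) auto
  finally show ?thesis by simp
qed

definition "beta T = 2 * Rmax * \<gamma> ^ T / (1 - \<gamma>) * (real T + 1 / (1 - \<gamma>))"

text \<open>Shifting the tail by \<open>T\<close> splits the weight \<open>t + T + 1\<close> into
  \<open>T\<close> and \<open>t + 1\<close>, which the first two geometric sums control.\<close>

lemma truncation_error: "norm (TG T \<theta> - FG \<theta>) \<le> beta T"
proof -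
  have "TG T \<theta> - FG \<theta> = - (\<Sum>t. \<gamma> ^ (t + T) *\<^sub>R G \<theta> (t + T))"
    unfolding trunc_grad_def full_grad_def suminf_split_initial_segment[OF summable_G, of _ T] by simp
  also have "norm \<dots> \<le> (\<Sum>t. norm (\<gamma> ^ (t + T) *\<^sub>R G \<theta> (t + T)))"
    unfolding norm_minus_cancel
    using summable_ignore_initial_segment[OF summable_G_norm, where k=T] by (rule summable_norm)
  also have "\<dots> \<le> beta T"
  proof (rule suminf_le_const)
    show "summable (\<lambda>t. norm (\<gamma> ^ (t + T) *\<^sub>R G \<theta> (t + T)))"
      by (rule summable_ignore_initial_segment[OF summable_G_norm, where k=T])
    fix n
    have "(\<Sum>t<n. norm (\<gamma> ^ (t + T) *\<^sub>R G \<theta> (t + T))) \<le> (\<Sum>t<n. sqrt 2 * Rmax * (\<gamma> ^ (t + T) * (real (t + T) + 1)))"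
      by (intro sum_mono norm_grad_sum_le)
    also have "\<dots> = sqrt 2 * Rmax * \<gamma> ^ T * (real T * (\<Sum>t<n. \<gamma> ^ t) + (\<Sum>t<n. \<gamma> ^ t * (real t + 1)))"
      by (simp add: sum_distrib_left distrib_left power_add sum.distrib[symmetric] algebra_simps)
    also have "\<dots> \<le> 2 * Rmax * \<gamma> ^ T * (real T * (1 / (1 - \<gamma>)) + 1 / (1 - \<gamma>)\<^sup>2)"
      using Rmax_ge_1 gamma sqrt2_le
      by (intro mult_mono mult_right_mono add_mono mult_left_mono sum_geometric_bounds)
        (auto intro!: add_nonneg_nonneg mult_nonneg_nonneg sum_nonneg)
    also have "\<dots> = beta T"
    proof -
      have "a * (b * (1 / g) + 1 / g\<^sup>2) = a / g * (b + 1 / g)" for a b g :: real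
        by (simp add: power2_eq_square distrib_left)
      then show ?thesis unfolding beta_def .
    qed
    finally show "(\<Sum>t<n. norm (\<gamma> ^ (t + T) *\<^sub>R G \<theta> (t + T))) \<le> beta T" .
  qed
  finally show ?thesis .
qed

end

section \<open>Performance difference and the Lojasiewicz inequality\<close>

text \<open>Donsker-Varadhan bound: relative to the exponentially tilted law with normalizer
  \<open>Z\<close>, it is termwise \<open>ln z \<le> z - 1\<close>, and the corrections sum to
  zero.\<close>

lemma gibbs_variational:
  fixes p q x :: "'a::finite \<Rightarrow> real"
  assumes "\<And>a. 0 < p a" "\<And>a. 0 < q a" "(\<Sum>a\<in>UNIV. q a) = 1"
  shows "(\<Sum>a\<in>UNIV. q a * (x a - (ln (q a) - ln (p a)))) \<le> ln (\<Sum>a\<in>UNIV. p a * exp (x a))"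
proof -
  define Z where "Z = (\<Sum>a\<in>UNIV. p a * exp (x a))"
  have Z: "Z > 0" unfolding Z_def using assms by (intro sum_pos) auto
  have "q a * (x a - (ln (q a) - ln (p a))) \<le> p a * exp (x a) / Z - q a + q a * ln Z" for a
  proof -
    have "ln (p a * exp (x a) / (q a * Z)) \<le> p a * exp (x a) / (q a * Z) - 1"
      using assms Z by (intro ln_le_minus_one) simp
    then have "x a - (ln (q a) - ln (p a)) \<le> p a * exp (x a) / (q a * Z) - 1 + ln Z"
      using assms(1)[of a] assms(2)[of a] Z by (simp add: ln_div ln_mult)
    then have "q a * (x a - (ln (q a) - ln (p a))) \<le> q a * (p a * exp (x a) / (q a * Z) - 1 + ln Z)"
      using assms by (intro mult_left_mono) (auto intro: less_imp_le)
    also have "\<dots> = p a * exp (x a) / Z - q a + q a * ln Z"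
    proof -
      have "q a \<noteq> 0" using assms(2)[of a] by simp
      then show ?thesis using Z by (simp add: distrib_left right_diff_distrib)
    qed
    finally show ?thesis .
  qed
  then have "(\<Sum>a\<in>UNIV. q a * (x a - (ln (q a) - ln (p a))))
      \<le> (\<Sum>a\<in>UNIV. p a * exp (x a) / Z - q a + q a * ln Z)"
    by (rule sum_mono)
  also have "\<dots> = ln Z"
    using Z assms(3)
    by (simp add: sum.distrib sum_subtractf flip: sum_divide_distrib sum_distrib_right Z_def)
  finally show ?thesis by (simp add: Z_def)
qed

text \<open>Taylor's theorem at zero: the intermediate point lies below \<open>max x 0\<close>,
  hence below \<open>c\<close>, however negative \<open>x\<close> is.\<close>

lemma exp_le_quadratic:
  fixes x c :: real
  assumes "x \<le> c" "0 \<le> c"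
  shows "exp x \<le> 1 + x + exp c / 2 * x\<^sup>2"
proof (cases "x = 0")
  case False
  have "\<exists>t. \<bar>t\<bar> \<le> \<bar>x\<bar> \<and> (if x < 0 then x < t \<and> t < 0 else 0 < t \<and> t < x) \<and> exp x = 1 + x + exp t / 2 * x\<^sup>2"
  proof -
    define d where "d m = (exp :: real \<Rightarrow> real)" for m :: nat
    have "\<exists>t. (if x < 0 then x < t \<and> t < 0 else 0 < t \<and> t < x) \<and>
       exp x = (\<Sum>m<2. d m 0 / fact m * (x - 0) ^ m) + d 2 t / fact 2 * (x - 0) ^ 2"
      by (rule Taylor[of 2 d exp "- \<bar>x\<bar>" "\<bar>x\<bar>" 0 x]) (use False in \<open>auto simp: d_def\<close>)
    then show ?thesis by (auto simp: d_def numeral_2_eq_2 split: if_splits)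
  qed
  then obtain t where t: "t \<le> max x 0" "exp x = 1 + x + exp t / 2 * x\<^sup>2"
    by (auto split: if_splits)
  have "exp t \<le> exp c" using t(1) assms by simp
  then have "exp t / 2 * x\<^sup>2 \<le> exp c / 2 * x\<^sup>2"
    by (intro mult_right_mono) auto
  then show ?thesis using t(2) by simp
qed simp

lemma exp_8_le: "exp (8::real) \<le> 3000"
proof -
  have "exp (8::real) = exp 1 ^ 8" by (simp flip: exp_of_nat_mult)
  also have "\<dots> \<le> 2.72 ^ 8" using e_less_272 by (intro power_mono) auto
  also have "\<dots> \<le> 3000" by (simp add: eval_nat_numeral)
  finally show ?thesis .
qed

text \<open>When the weights may be as small as \<open>\<delta>\<close>, the cumulant generating function gains a factor over the
  Hoeffding bound: a large value of \<open>x\<close> contributes linearly and small values are weighted by \<open>p\<close>.\<close>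

lemma log_mgf_bound:
  fixes p x :: "'a::finite \<Rightarrow> real"
  assumes p: "\<And>a. \<delta> \<le> p a" "(\<Sum>a\<in>UNIV. p a) = 1" and \<delta>: "0 < \<delta>" "\<delta> \<le> 1 / 12000"
    and centred: "(\<Sum>a\<in>UNIV. p a * x a) = 0"
  shows "ln (\<Sum>a\<in>UNIV. p a * exp (x a)) \<le> (\<Sum>a\<in>UNIV. (p a * x a)\<^sup>2) / (8 * \<delta>\<^sup>2)"
proof (cases "\<exists>b. x b \<ge> 8")
  case True
  define m where "m = Max (range x)"
  have "m \<in> range x" unfolding m_def by (rule Max_in) auto
  then obtain b where b: "x b = m" by auto
  have le: "x a \<le> m" for a by (simp add: m_def)
  have m: "m \<ge> 8" using True le by (meson order_trans)
  have pos: "0 < p a" for a using p(1)[of a] \<delta>(1) by linarith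
  have "(\<Sum>a\<in>UNIV. p a * exp (x a)) \<le> (\<Sum>a\<in>UNIV. p a * exp m)"
    using le pos by (intro sum_mono mult_left_mono) (auto intro: less_imp_le)
  also have "\<dots> = exp m" using p(2) by (simp flip: sum_distrib_right)
  finally have "ln (\<Sum>a\<in>UNIV. p a * exp (x a)) \<le> ln (exp m)"
    using pos by (intro ln_mono sum_pos) auto
  then have "ln (\<Sum>a\<in>UNIV. p a * exp (x a)) \<le> m" by simp
  \<comment> \<open>The threshold \<open>8\<close> is chosen to reproduce the denominator
    \<open>8 * \<delta>\<^sup>2\<close>.\<close>
  also have "m \<le> m * (m / 8)" using m by (intro mult_le_cancel_left1[THEN iffD2]) auto
  also have "\<dots> = (\<delta> * m)\<^sup>2 / (8 * \<delta>\<^sup>2)"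
    using \<delta> by (simp add: power2_eq_square)
  also have "\<dots> \<le> (\<Sum>a\<in>UNIV. (p a * x a)\<^sup>2) / (8 * \<delta>\<^sup>2)"
  proof (intro divide_right_mono)
    have "(\<delta> * m)\<^sup>2 \<le> (p b * x b)\<^sup>2"
      using p(1)[of b] \<delta> m b by (intro power_mono mult_mono) auto
    also have "\<dots> \<le> (\<Sum>a\<in>UNIV. (p a * x a)\<^sup>2)"
      by (intro member_le_sum) auto
    finally show "(\<delta> * m)\<^sup>2 \<le> (\<Sum>a\<in>UNIV. (p a * x a)\<^sup>2)" .
  qed simp
  finally show ?thesis .
next
  case False
  have pos: "0 < p a" for a using p(1)[of a] \<delta>(1) by linarith
  have le: "p a * exp (x a) \<le> p a + p a * x a + (p a * x a)\<^sup>2 / (8 * \<delta>\<^sup>2)" for a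
  proof -
    have "exp (x a) \<le> 1 + x a + exp 8 / 2 * (x a)\<^sup>2"
      using False by (intro exp_le_quadratic) (auto simp: not_le intro: less_imp_le)
    also have "\<dots> \<le> 1 + x a + 1500 * (x a)\<^sup>2"
      using exp_8_le by (intro add_left_mono mult_right_mono) auto
    finally have "p a * exp (x a) \<le> p a * (1 + x a + 1500 * (x a)\<^sup>2)"
      using pos[of a] by (intro mult_left_mono) auto
    also have "\<dots> = p a + p a * x a + (1500 * p a) * (x a)\<^sup>2" by (simp add: algebra_simps)
    also have "(1500 * p a) * (x a)\<^sup>2 \<le> ((p a)\<^sup>2 / (8 * \<delta>\<^sup>2)) * (x a)\<^sup>2"
    proof (rule mult_right_mono)
      \<comment> \<open>Here \<open>12000 = 8 * 1500\<close>, and \<open>1500\<close> bounds half of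
        \<open>exp 8\<close>; this is the origin of the upper limit on
        \<open>\<delta>\<close>.\<close>
      have "12000 * \<delta> * \<delta> \<le> 1 * p a"
        using p(1)[of a] \<delta> by (intro mult_mono) auto
      then have "p a * (12000 * \<delta> * \<delta>) \<le> p a * p a"
        using pos[of a] by (intro mult_left_mono) auto
      then show "1500 * p a \<le> (p a)\<^sup>2 / (8 * \<delta>\<^sup>2)"
        using \<delta> by (simp add: pos_le_divide_eq power2_eq_square mult_ac)
    qed simp
    finally show ?thesis by (simp add: power_mult_distrib)
  qed
  have Z: "0 < (\<Sum>a\<in>UNIV. p a * exp (x a))" using pos by (intro sum_pos) auto
  have "ln (\<Sum>a\<in>UNIV. p a * exp (x a)) \<le> (\<Sum>a\<in>UNIV. p a * exp (x a)) - 1"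
    by (rule ln_le_minus_one[OF Z])
  also have "(\<Sum>a\<in>UNIV. p a * exp (x a)) \<le> (\<Sum>a\<in>UNIV. p a + p a * x a + (p a * x a)\<^sup>2 / (8 * \<delta>\<^sup>2))"
    by (rule sum_mono[OF le])
  also have "\<dots> = 1 + (\<Sum>a\<in>UNIV. (p a * x a)\<^sup>2) / (8 * \<delta>\<^sup>2)"
    using p(2) centred by (simp add: sum.distrib flip: sum_divide_distrib)
  finally show ?thesis by simp
qed

text \<open>Concavity of \<open>- x * ln x\<close>: its graph lies below the tangent at
  \<open>x\<close>.\<close>

lemma entropy_tangent:
  fixes x y :: real
  assumes "0 < x" "0 < y"
  shows "- y * ln y \<le> - x * ln x - (ln x + 1) * (y - x)"
proof -
  have "ln (x / y) \<le> x / y - 1" using assms by (intro ln_le_minus_one) simp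
  then have "y * ln (x / y) \<le> y * (x / y - 1)" using assms by (intro mult_left_mono) auto
  then show ?thesis using assms by (simp add: ln_div algebra_simps)
qed

context soft_mdp
begin

section \<open>Value functions and the soft Bellman equation\<close>

definition "PE h x = (\<Sum>s'\<in>UNIV. pmf (P (fst x) (snd x)) s' * h s')" for h :: "'s \<Rightarrow> real"

text \<open>Expected regularized reward \<open>n\<close> steps after a start in the given state. The
  recursion runs from the front, so that shifting the series for \<open>V\<close> gives the Bellman
  equation.\<close>

fun W :: "('s, 'a) param \<Rightarrow> nat \<Rightarrow> 's \<Rightarrow> real" where
  "W \<theta> 0 s = (\<Sum>a\<in>UNIV. softmax \<theta> s a * rw \<theta> (s, a))"
| "W \<theta> (Suc n) s = (\<Sum>a\<in>UNIV. softmax \<theta> s a * PE (W \<theta> n) (s, a))"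

definition "V \<theta> s = (\<Sum>n. \<gamma> ^ n * W \<theta> n s)"

lemma PE_bounds:
  assumes "\<And>s. 0 \<le> h s" "\<And>s. h s \<le> c"
  shows "0 \<le> PE h x" "PE h x \<le> c"
proof -
  show "0 \<le> PE h x" unfolding PE_def using assms by (intro sum_nonneg) auto
  have "PE h x \<le> (\<Sum>s'\<in>UNIV. pmf (P (fst x) (snd x)) s' * c)"
    unfolding PE_def using assms by (intro sum_mono mult_left_mono) auto
  then show "PE h x \<le> c" by (simp add: sum_pmf_eq_1 flip: sum_distrib_right)
qed

lemma softmax_avg_bounds:
  assumes "\<And>a. 0 \<le> h a" "\<And>a. h a \<le> c"
  shows "0 \<le> (\<Sum>a\<in>UNIV. softmax \<theta> s a * h a)" "(\<Sum>a\<in>UNIV. softmax \<theta> s a * h a) \<le> c"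
proof -
  show "0 \<le> (\<Sum>a\<in>UNIV. softmax \<theta> s a * h a)"
    using assms by (intro sum_nonneg mult_nonneg_nonneg) (auto simp: softmax_nonneg)
  show "(\<Sum>a\<in>UNIV. softmax \<theta> s a * h a) \<le> c"
    using softmax_avg_le[of h c \<theta> s] assms by (auto simp: abs_le_iff)
qed

lemma W_bounds: "0 \<le> W \<theta> n s" "W \<theta> n s \<le> Rmax"
proof -
  have "0 \<le> W \<theta> n s \<and> W \<theta> n s \<le> Rmax"
  proof (induction n arbitrary: s)
    case 0
    have "0 \<le> W \<theta> 0 s"
      by (auto intro!: sum_nonneg mult_nonneg_nonneg simp: softmax_nonneg rw_nonneg)
    then show ?case using softmax_rw_le[of \<theta> s] by simp
  next
    case (Suc n)
    then show ?case by (auto intro!: softmax_avg_bounds PE_bounds)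
  qed
  then show "0 \<le> W \<theta> n s" "W \<theta> n s \<le> Rmax" by auto
qed

lemma W_sums: "(\<lambda>n. \<gamma> ^ n * W \<theta> n s) sums V \<theta> s"
  unfolding V_def
proof (rule summable_sums, rule summable_comparison_test'[where N=0])
  show "summable (\<lambda>t. Rmax * \<gamma> ^ t)"
    using gamma by (intro summable_mult summable_geometric) simp
  show "norm (\<gamma> ^ t * W \<theta> t s) \<le> Rmax * \<gamma> ^ t" for t
    using W_bounds[of \<theta> t s] gamma by (simp add: mult.commute[of Rmax] mult_left_mono)
qed

lemma V_bounds: "0 \<le> V \<theta> s" "V \<theta> s \<le> Rmax / (1 - \<gamma>)"
proof -
  show "0 \<le> V \<theta> s"
    unfolding V_def using gamma W_bounds by (intro suminf_nonneg sums_summable[OF W_sums]) auto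
  have "(\<lambda>n. Rmax * \<gamma> ^ n) sums (Rmax * (1 / (1 - \<gamma>)))"
    using gamma by (intro sums_mult geometric_sums) simp
  then have "V \<theta> s \<le> Rmax * (1 / (1 - \<gamma>))"
    using W_bounds gamma by (intro sums_le[OF _ W_sums]) (auto simp: mult.commute[of Rmax] mult_left_mono)
  then show "V \<theta> s \<le> Rmax / (1 - \<gamma>)" by simp
qed

definition "soft_Q \<theta> x = rw \<theta> x + \<gamma> * PE (V \<theta>) x"
definition "Adv \<theta> s a = soft_Q \<theta> (s, a) - V \<theta> s"

lemma bellman: "V \<theta> s = (\<Sum>a\<in>UNIV. softmax \<theta> s a * soft_Q \<theta> (s, a))"
proof -
  have "(\<lambda>n. \<gamma> * (\<gamma> ^ n * W \<theta> (Suc n) s)) sums (\<gamma> * (\<Sum>a\<in>UNIV. softmax \<theta> s a * PE (V \<theta>) (s, a)))"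
  proof (rule sums_mult)
    have "(\<lambda>n. \<Sum>a\<in>UNIV. softmax \<theta> s a * (\<Sum>s'\<in>UNIV. pmf (P s a) s' * (\<gamma> ^ n * W \<theta> n s')))
        sums (\<Sum>a\<in>UNIV. softmax \<theta> s a * (\<Sum>s'\<in>UNIV. pmf (P s a) s' * V \<theta> s'))"
      by (intro sums_sum sums_mult W_sums)
    then show "(\<lambda>n. \<gamma> ^ n * W \<theta> (Suc n) s) sums (\<Sum>a\<in>UNIV. softmax \<theta> s a * PE (V \<theta>) (s, a))"
      by (simp add: PE_def sum_distrib_left mult_ac)
  qed
  then have "(\<lambda>n. \<gamma> ^ Suc n * W \<theta> (Suc n) s) sums (\<gamma> * (\<Sum>a\<in>UNIV. softmax \<theta> s a * PE (V \<theta>) (s, a)))"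
    by (simp add: mult.assoc)
  then have "V \<theta> s = \<gamma> * (\<Sum>a\<in>UNIV. softmax \<theta> s a * PE (V \<theta>) (s, a)) + \<gamma> ^ 0 * W \<theta> 0 s"
    by (intro sums_unique2[OF W_sums] sums_Suc[where f="\<lambda>n. \<gamma> ^ n * W \<theta> n s"])
  then show ?thesis
    by (simp add: soft_Q_def distrib_left sum.distrib sum_distrib_left mult_ac)
qed

lemma Adv_centred: "(\<Sum>a\<in>UNIV. softmax \<theta> s a * Adv \<theta> s a) = 0"
  by (simp add: Adv_def right_diff_distrib sum_subtractf sum_softmax bellman[symmetric]
      flip: sum_distrib_right)

lemma texp_next:
  fixes g :: "('s, 'a) traj \<Rightarrow> real"
  assumes "\<And>\<omega> x. g (fun_upd \<omega> (Suc t) x) = g \<omega>"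
  shows "E \<theta> (Suc (Suc t)) (\<lambda>\<omega>. g \<omega> * h (fst (\<omega> (Suc t)))) = E \<theta> (Suc t) (\<lambda>\<omega>. g \<omega> * PE h (\<omega> t))"
proof -
  have "E \<theta> (Suc (Suc t)) (\<lambda>\<omega>. g \<omega> * h (fst (\<omega> (Suc t))))
      = E \<theta> (Suc t) (\<lambda>\<omega>. \<Sum>s\<in>UNIV. pmf (next_pmf \<rho> P (Suc t) \<omega>) s * (g \<omega> * h s))"
    unfolding texp_Suc[of _ _ _ "Suc t"]
    by (intro texp_cong) (simp add: assms sum_softmax flip: sum_distrib_right)
  also have "\<dots> = E \<theta> (Suc t) (\<lambda>\<omega>. g \<omega> * PE h (\<omega> t))"
    by (intro texp_cong) (simp add: PE_def next_pmf_def sum_distrib_left mult_ac)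
  finally show ?thesis .
qed

lemma texp_first: "E \<theta> (Suc 0) (\<lambda>\<omega>. h (fst (\<omega> 0))) = (\<Sum>s\<in>UNIV. pmf \<rho> s * h s)" for h :: "'s \<Rightarrow> real"
  by (simp add: texp_Suc texp_0 next_pmf_def sum_softmax flip: sum_distrib_right)

text \<open>A factor that does not read position \<open>t\<close> may be pulled out, and a function
  of the last pair may be replaced by its conditional mean given the last state.\<close>

lemma texp_average_action:
  fixes g :: "('s, 'a) traj \<Rightarrow> real"
  assumes "\<And>\<omega> x. g (fun_upd \<omega> t x) = g \<omega>"
  shows "E \<theta> (Suc t) (\<lambda>\<omega>. g \<omega> * f (\<omega> t))
    = E \<theta> (Suc t) (\<lambda>\<omega>. g \<omega> * (\<Sum>a\<in>UNIV. softmax \<theta> (fst (\<omega> t)) a * f (fst (\<omega> t), a)))"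
  unfolding texp_Suc
proof (intro texp_cong sum.cong refl)
  fix \<omega> s
  have "(\<Sum>a\<in>UNIV. softmax \<theta> s a * (g \<omega> * f (s, a)))
      = (\<Sum>a\<in>UNIV. softmax \<theta> s a * (g \<omega> * (\<Sum>b\<in>UNIV. softmax \<theta> s b * f (s, b))))"
    by (simp add: sum_softmax mult.left_commute[of _ "g \<omega>"] flip: sum_distrib_left sum_distrib_right)
  then show "pmf (next_pmf \<rho> P t \<omega>) s *\<^sub>R (\<Sum>a\<in>UNIV. softmax \<theta> s a *\<^sub>R
        (g (fun_upd \<omega> t (s, a)) * f ((fun_upd \<omega> t (s, a)) t)))
    = pmf (next_pmf \<rho> P t \<omega>) s *\<^sub>R (\<Sum>a\<in>UNIV. softmax \<theta> s a *\<^sub>R (g (fun_upd \<omega> t (s, a)) *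
        (\<Sum>b\<in>UNIV. softmax \<theta> (fst ((fun_upd \<omega> t (s, a)) t)) b * f (fst ((fun_upd \<omega> t (s, a)) t), b))))"
    by (simp add: assms)
qed

text \<open>Gain from using \<theta>' for one step, with its own entropy bonus, and \<theta> from
  then on, instead of \<theta> throughout.\<close>

definition "imp \<theta> \<theta>' s = (\<Sum>a\<in>UNIV. softmax \<theta>' s a * (rw \<theta>' (s, a) + \<gamma> * PE (V \<theta>) (s, a))) - V \<theta> s"

lemma imp_self: "imp \<theta> \<theta> s = 0"
  unfolding imp_def bellman[of \<theta> s] soft_Q_def by simp

text \<open>The expected improvement is the reward term of \<theta>' plus a discounted difference of
  \<open>V \<theta>\<close> at consecutive states, so the series telescopes. The statement contains
  the average of \<open>V \<theta>\<close> because its identity with \<open>J \<theta>\<close> is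
  the special case \<theta>' = \<theta>, drawn next.\<close>

lemma imp_sums_aux:
  "(\<lambda>t. \<gamma> ^ t * E \<theta>' (Suc t) (\<lambda>\<omega>. imp \<theta> \<theta>' (fst (\<omega> t)))) sums (J \<theta>' - (\<Sum>s\<in>UNIV. pmf \<rho> s * V \<theta> s))"
proof -
  define Y where "Y t = E \<theta>' (Suc t) (\<lambda>\<omega>. V \<theta> (fst (\<omega> t)))" for t
  have Y: "0 \<le> Y t" "Y t \<le> Rmax / (1 - \<gamma>)" for t
    using texp_mono[of "\<lambda>_. 0" "\<lambda>\<omega>. V \<theta> (fst (\<omega> t))" \<rho> P \<theta>' "Suc t"] V_bounds[of \<theta>]
      texp_mono[of "\<lambda>\<omega>. V \<theta> (fst (\<omega> t))" "\<lambda>_. Rmax / (1 - \<gamma>)" \<rho> P \<theta>' "Suc t"]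
    by (auto simp: Y_def texp_const)
  have step: "E \<theta>' (Suc t) (\<lambda>\<omega>. imp \<theta> \<theta>' (fst (\<omega> t))) = Jt \<theta>' t + \<gamma> * Y (Suc t) - Y t" for t
  proof -
    have "E \<theta>' (Suc t) (\<lambda>\<omega>. imp \<theta> \<theta>' (fst (\<omega> t)))
      = E \<theta>' (Suc t) (\<lambda>\<omega>. 1 * (\<Sum>a\<in>UNIV. softmax \<theta>' (fst (\<omega> t)) a *
          (rw \<theta>' (fst (\<omega> t), a) + \<gamma> * PE (V \<theta>) (fst (\<omega> t), a)))) - Y t"
      unfolding Y_def texp_diff[symmetric] imp_def by simp
    also have "E \<theta>' (Suc t) (\<lambda>\<omega>. 1 * (\<Sum>a\<in>UNIV. softmax \<theta>' (fst (\<omega> t)) a *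
          (rw \<theta>' (fst (\<omega> t), a) + \<gamma> * PE (V \<theta>) (fst (\<omega> t), a))))
        = E \<theta>' (Suc t) (\<lambda>\<omega>. 1 * (rw \<theta>' (\<omega> t) + \<gamma> * PE (V \<theta>) (\<omega> t)))"
      by (rule texp_average_action[where g="\<lambda>_. 1", OF refl, symmetric])
    also have "E \<theta>' (Suc t) (\<lambda>\<omega>. 1 * (rw \<theta>' (\<omega> t) + \<gamma> * PE (V \<theta>) (\<omega> t)))
      = Jt \<theta>' t + \<gamma> * E \<theta>' (Suc t) (\<lambda>\<omega>. 1 * PE (V \<theta>) (\<omega> t))"
      unfolding rew_term_def texp_mult[symmetric] texp_add[symmetric] by simp
    also have "E \<theta>' (Suc t) (\<lambda>\<omega>. 1 * PE (V \<theta>) (\<omega> t)) = Y (Suc t)"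
      unfolding Y_def texp_next[where g="\<lambda>_. 1", OF refl, symmetric] by simp
    finally show ?thesis .
  qed
  have "(\<Sum>t<T. \<gamma> ^ t * E \<theta>' (Suc t) (\<lambda>\<omega>. imp \<theta> \<theta>' (fst (\<omega> t))))
      = (\<Sum>t<T. \<gamma> ^ t * Jt \<theta>' t) + \<gamma> ^ T * Y T - Y 0" for T
    by (induction T) (simp_all add: step algebra_simps)
  moreover have "(\<lambda>T. (\<Sum>t<T. \<gamma> ^ t * Jt \<theta>' t) + \<gamma> ^ T * Y T - Y 0) \<longlonglongrightarrow> J \<theta>' + 0 - Y 0"
  proof (intro tendsto_intros J_tendsto)
    show "(\<lambda>T. \<gamma> ^ T * Y T) \<longlonglongrightarrow> 0"
    proof (rule Lim_null_comparison)
      show "\<forall>\<^sub>F T in sequentially. norm (\<gamma> ^ T * Y T) \<le> \<gamma> ^ T * (Rmax / (1 - \<gamma>))"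
      proof (intro always_eventually allI)
        fix T
        have "\<gamma> ^ T * Y T \<le> \<gamma> ^ T * (Rmax / (1 - \<gamma>))"
          using Y gamma by (intro mult_left_mono) auto
        then show "norm (\<gamma> ^ T * Y T) \<le> \<gamma> ^ T * (Rmax / (1 - \<gamma>))"
          using Y(1)[of T] gamma by simp
      qed
      show "(\<lambda>T. \<gamma> ^ T * (Rmax / (1 - \<gamma>))) \<longlonglongrightarrow> 0"
        using gamma by (intro tendsto_mult_left_zero LIMSEQ_power_zero) simp
    qed
  qed
  ultimately show ?thesis
    unfolding sums_def by (simp add: Y_def texp_first)
qed

end

context soft_mdp
begin

section \<open>Comparing two policies through one-step improvements\<close>

lemma J_eq_V: "J \<theta> = (\<Sum>s\<in>UNIV. pmf \<rho> s * V \<theta> s)"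
proof -
  have "(\<lambda>t. \<gamma> ^ t * E \<theta> (Suc t) (\<lambda>\<omega>. imp \<theta> \<theta> (fst (\<omega> t)))) sums 0"
    by (simp add: imp_self texp_const)
  with imp_sums_aux[of \<theta> \<theta>] show ?thesis
    using sums_unique2 by fastforce
qed

lemma performance_difference:
  "(\<lambda>t. \<gamma> ^ t * E \<theta>' (Suc t) (\<lambda>\<omega>. imp \<theta> \<theta>' (fst (\<omega> t)))) sums (J \<theta>' - J \<theta>)"
  using imp_sums_aux[of \<theta>' \<theta>] by (simp add: J_eq_V[of \<theta>])

text \<open>State-visitation probabilities are at most one, so at each time the improvement is
  bounded by the sum over all states.\<close>

lemma J_diff_le:
  assumes "\<And>s. imp \<theta> \<theta>' s \<le> c s" "\<And>s. 0 \<le> c s"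
  shows "J \<theta>' - J \<theta> \<le> (\<Sum>s\<in>UNIV. c s) / (1 - \<gamma>)"
proof -
  have "(\<lambda>t. \<gamma> ^ t * (\<Sum>s\<in>UNIV. c s)) sums (1 / (1 - \<gamma>) * (\<Sum>s\<in>UNIV. c s))"
    using gamma by (intro sums_mult2 geometric_sums) simp
  moreover have "\<gamma> ^ t * E \<theta>' (Suc t) (\<lambda>\<omega>. imp \<theta> \<theta>' (fst (\<omega> t))) \<le> \<gamma> ^ t * (\<Sum>s\<in>UNIV. c s)" for t
  proof (rule mult_left_mono)
    have "imp \<theta> \<theta>' s \<le> (\<Sum>s\<in>UNIV. c s)" for s
      using assms(1)[of s] member_le_sum[of s UNIV c] assms(2) by force
    then show "E \<theta>' (Suc t) (\<lambda>\<omega>. imp \<theta> \<theta>' (fst (\<omega> t))) \<le> (\<Sum>s\<in>UNIV. c s)"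
      using texp_mono[of "\<lambda>\<omega>. imp \<theta> \<theta>' (fst (\<omega> t))" "\<lambda>_. \<Sum>s\<in>UNIV. c s" \<rho> P \<theta>' "Suc t"]
      by (simp add: texp_const)
  qed (use gamma in simp)
  ultimately show ?thesis
    using sums_le[OF _ performance_difference] by fastforce
qed

text \<open>With nonnegative improvements, dropping all times after the initial one leaves the
  average over \<rho>.\<close>

lemma J_diff_ge:
  assumes "\<And>s. 0 \<le> imp \<theta> \<theta>' s"
  shows "J \<theta>' - J \<theta> \<ge> (\<Sum>s\<in>UNIV. pmf \<rho> s * imp \<theta> \<theta>' s)"
proof -
  let ?f = "\<lambda>t. \<gamma> ^ t * E \<theta>' (Suc t) (\<lambda>\<omega>. imp \<theta> \<theta>' (fst (\<omega> t)))"
  have "0 \<le> ?f t" for t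
    using texp_mono[of "\<lambda>_. 0" "\<lambda>\<omega>. imp \<theta> \<theta>' (fst (\<omega> t))" \<rho> P \<theta>' "Suc t"] assms gamma
    by (simp add: texp_const)
  then have "(\<Sum>t\<in>{0}. ?f t) \<le> (\<Sum>t. ?f t)"
    using performance_difference by (intro sum_le_suminf) (auto simp: sums_iff)
  then show ?thesis
    using performance_difference by (simp add: sums_iff texp_first)
qed

text \<open>The Bellman equation makes the series telescope: the past scores are paired with \<open>V\<close> at consecutive states.\<close>

lemma inner_full_grad:
  "(\<lambda>t. \<gamma> ^ t * E \<theta> (Suc t) (\<lambda>\<omega>. \<Sum>a\<in>UNIV. softmax \<theta> (fst (\<omega> t)) a * v $ (fst (\<omega> t), a) * Adv \<theta> (fst (\<omega> t)) a))
    sums (v \<bullet> FG \<theta>)"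
proof -
  define D where "D s = (\<Sum>a\<in>UNIV. softmax \<theta> s a * v $ (s, a) * Adv \<theta> s a)" for s
  define Y where "Y t = E \<theta> (Suc t) (\<lambda>\<omega>. (v \<bullet> traj_score \<theta> t \<omega>) * V \<theta> (fst (\<omega> t)))" for t
  \<comment> \<open>The soft Q-function may be recentred by \<open>V\<close> since the score has
    mean zero, and the score may be replaced by the bare coordinate since the advantage has mean
    zero.\<close>
  have score_Q: "(\<Sum>a\<in>UNIV. softmax \<theta> s a * ((v \<bullet> score \<theta> s a) * soft_Q \<theta> (s, a))) = D s" for s
  proof -
    let ?p = "softmax \<theta> s"
    define m where "m = (\<Sum>b\<in>UNIV. ?p b * v $ (s, b))"
    have "?p a * ((v \<bullet> score \<theta> s a) * soft_Q \<theta> (s, a)) =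
        ?p a * v $ (s, a) * Adv \<theta> s a - m * (?p a * Adv \<theta> s a) + V \<theta> s * (?p a * (v \<bullet> score \<theta> s a))" for a
      by (simp add: inner_score Adv_def m_def algebra_simps)
    then have "(\<Sum>a\<in>UNIV. ?p a * ((v \<bullet> score \<theta> s a) * soft_Q \<theta> (s, a))) =
        D s - m * (\<Sum>a\<in>UNIV. ?p a * Adv \<theta> s a) + V \<theta> s * (\<Sum>a\<in>UNIV. ?p a * (v \<bullet> score \<theta> s a))"
      by (simp add: sum.distrib sum_subtractf D_def flip: sum_distrib_left)
    then show ?thesis by (simp add: Adv_centred expect_softmax_score)
  qed
  have step: "v \<bullet> G \<theta> t = Y t - \<gamma> * Y (Suc t) + E \<theta> (Suc t) (\<lambda>\<omega>. D (fst (\<omega> t)))" for t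
  proof -
    have "v \<bullet> G \<theta> t = E \<theta> (Suc t) (\<lambda>\<omega>. (v \<bullet> traj_score \<theta> t \<omega>) * soft_Q \<theta> (\<omega> t)
        + 1 * ((v \<bullet> score \<theta> (fst (\<omega> t)) (snd (\<omega> t))) * soft_Q \<theta> (\<omega> t))
        - \<gamma> * ((v \<bullet> traj_score \<theta> (Suc t) \<omega>) * PE (V \<theta>) (\<omega> t)))"
      unfolding inner_grad_term K0_def
      by (intro texp_cong) (simp add: soft_Q_def traj_score_Suc inner_add_right algebra_simps)
    also have "\<dots> = E \<theta> (Suc t) (\<lambda>\<omega>. (v \<bullet> traj_score \<theta> t \<omega>) * soft_Q \<theta> (\<omega> t))
        + E \<theta> (Suc t) (\<lambda>\<omega>. 1 * ((v \<bullet> score \<theta> (fst (\<omega> t)) (snd (\<omega> t))) * soft_Q \<theta> (\<omega> t)))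
        - \<gamma> * E \<theta> (Suc t) (\<lambda>\<omega>. (v \<bullet> traj_score \<theta> (Suc t) \<omega>) * PE (V \<theta>) (\<omega> t))"
      unfolding texp_add texp_diff texp_mult ..
    also have "E \<theta> (Suc t) (\<lambda>\<omega>. (v \<bullet> traj_score \<theta> t \<omega>) * soft_Q \<theta> (\<omega> t)) = Y t"
      unfolding Y_def by (subst texp_average_action) (simp_all add: traj_score_upd bellman)
    also have "E \<theta> (Suc t) (\<lambda>\<omega>. 1 * ((v \<bullet> score \<theta> (fst (\<omega> t)) (snd (\<omega> t))) * soft_Q \<theta> (\<omega> t)))
        = E \<theta> (Suc t) (\<lambda>\<omega>. D (fst (\<omega> t)))"
      using texp_average_action[where g="\<lambda>_. 1" and t=t and \<theta>=\<theta>
          and f="\<lambda>x. (v \<bullet> score \<theta> (fst x) (snd x)) * soft_Q \<theta> x", OF refl]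
      by (simp add: score_Q)
    also have "E \<theta> (Suc t) (\<lambda>\<omega>. (v \<bullet> traj_score \<theta> (Suc t) \<omega>) * PE (V \<theta>) (\<omega> t)) = Y (Suc t)"
      unfolding Y_def by (rule texp_next[symmetric]) (simp add: traj_score_upd)
    finally show ?thesis by simp
  qed
  have Y0: "Y 0 = 0" by (simp add: Y_def traj_score_def texp_const)
  define c where "c = sqrt 2 * norm v * (Rmax / (1 - \<gamma>))"
  have Y: "\<bar>Y t\<bar> \<le> real t * c" for t
  proof -
    have "norm (Y t) \<le> E \<theta> (Suc t) (\<lambda>_. sqrt 2 * real t * norm v * (Rmax / (1 - \<gamma>)))"
      unfolding Y_def
    proof (rule texp_norm_le)
      show "norm ((v \<bullet> traj_score \<theta> t \<omega>) * V \<theta> (fst (\<omega> t))) \<le> sqrt 2 * real t * norm v * (Rmax / (1 - \<gamma>))" for \<omega>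
        unfolding real_norm_def using V_bounds[of \<theta> "fst (\<omega> t)"]
        by (intro abs_mult_le abs_inner_traj_score) auto
    qed
    then show ?thesis by (simp add: texp_const c_def mult_ac)
  qed
  have "v \<bullet> TG T \<theta> + \<gamma> ^ T * Y T = (\<Sum>t<T. \<gamma> ^ t * E \<theta> (Suc t) (\<lambda>\<omega>. D (fst (\<omega> t))))" for T
    by (induction T) (simp_all add: Y0 trunc_grad_def inner_add_right step algebra_simps)
  moreover have "(\<lambda>T. v \<bullet> TG T \<theta> + \<gamma> ^ T * Y T) \<longlonglongrightarrow> v \<bullet> FG \<theta> + 0"
  proof (intro tendsto_intros TG_tendsto)
    show "(\<lambda>T. \<gamma> ^ T * Y T) \<longlonglongrightarrow> 0"
    proof (rule Lim_null_comparison)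
      show "\<forall>\<^sub>F T in sequentially. norm (\<gamma> ^ T * Y T) \<le> (real T * \<gamma> ^ T) * c"
      proof (intro always_eventually allI)
        fix T
        have "\<gamma> ^ T * \<bar>Y T\<bar> \<le> \<gamma> ^ T * (real T * c)"
          using Y gamma by (intro mult_left_mono) auto
        then show "norm (\<gamma> ^ T * Y T) \<le> (real T * \<gamma> ^ T) * c"
          using gamma by (simp add: abs_mult mult_ac)
      qed
      show "(\<lambda>T. (real T * \<gamma> ^ T) * c) \<longlonglongrightarrow> 0"
        using gamma powser_times_n_limit_0[of \<gamma>] by (intro tendsto_mult_left_zero) simp
    qed
  qed
  ultimately show ?thesis
    unfolding sums_def D_def by simp
qed

text \<open>A single gradient coordinate is the policy-weighted advantage times the discounted
  occupancy of the state; the occupancy is at least its term at time zero.\<close>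

lemma full_grad_component: "\<bar>FG \<theta> $ (s, a)\<bar> \<ge> pmf \<rho> s * \<bar>softmax \<theta> s a * Adv \<theta> s a\<bar>"
proof -
  define x where "x = softmax \<theta> s a * Adv \<theta> s a"
  define c where "c t = \<gamma> ^ t * E \<theta> (Suc t) (\<lambda>\<omega>. indicat_real {s} (fst (\<omega> t)))" for t
  have "(\<Sum>b\<in>UNIV. softmax \<theta> s' b * axis (s, a) 1 $ (s', b) * Adv \<theta> s' b) = x * indicat_real {s} s'" for s'
    by (cases "s' = s") (auto simp: axis_def x_def if_distrib[where f="\<lambda>z. _ * z"] if_distrib[where f="\<lambda>z. z * _"]
        cong: if_cong intro!: sum.neutral)
  with inner_full_grad[of \<theta> "axis (s, a) 1"] have s: "(\<lambda>t. c t * x) sums (FG \<theta> $ (s, a))"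
    by (simp add: texp_mult c_def inner_commute[of "axis _ _"] inner_axis mult_ac)
  have c: "0 \<le> c t" for t
    using texp_mono[of "\<lambda>_. 0" "\<lambda>\<omega>. indicat_real {s} (fst (\<omega> t))" \<rho> P \<theta> "Suc t"] gamma
    by (simp add: c_def texp_const)
  have c0: "c 0 = pmf \<rho> s"
    using texp_first[of \<theta> "indicat_real {s}"] by (simp add: c_def indicator_def if_distrib cong: if_cong)
  \<comment> \<open>Multiplying by the sign makes all terms nonnegative, so that the first one
    bounds the series from below.\<close>
  have "(\<lambda>t. c t * x * sgn x) sums (FG \<theta> $ (s, a) * sgn x)"
    by (rule sums_mult2[OF s])
  then have "(\<lambda>t. c t * \<bar>x\<bar>) sums (FG \<theta> $ (s, a) * sgn x)"
    by (simp add: abs_sgn mult.assoc)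
  then have s': "summable (\<lambda>t. c t * \<bar>x\<bar>)" "(\<Sum>t. c t * \<bar>x\<bar>) = FG \<theta> $ (s, a) * sgn x"
    by (simp_all add: sums_iff)
  have "(\<Sum>t\<in>{0}. c t * \<bar>x\<bar>) \<le> FG \<theta> $ (s, a) * sgn x"
    unfolding s'(2)[symmetric] using c by (intro sum_le_suminf s'(1)) auto
  also have "\<dots> \<le> \<bar>FG \<theta> $ (s, a)\<bar>"
    by (auto simp: sgn_if)
  finally show ?thesis by (simp add: c0 x_def)
qed

text \<open>For any competitor \<theta>', the improvement in a state is \<open>lam\<close> times a
  Gibbs functional of \<open>Adv / lam\<close>, hence at most \<open>lam\<close> times a cumulant
  generating function under the current policy. The bound by squares of \<open>softmax * Adv\<close>
  matches the squared gradient coordinates. The competitor is arbitrary, so a maximizer need not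
  exist.\<close>

lemma lojasiewicz:
  assumes floor: "\<And>s a. \<delta> \<le> softmax \<theta> s a" and \<delta>: "0 < \<delta>" "\<delta> \<le> 1 / 12000"
    and \<rho>m: "\<And>s. \<rho>m \<le> pmf \<rho> s" "0 < \<rho>m"
  shows "8 * \<delta>\<^sup>2 * lam * (1 - \<gamma>) * \<rho>m\<^sup>2 * (J \<theta>' - J \<theta>) \<le> (norm (FG \<theta>))\<^sup>2"
proof -
  define c where "c s = (\<Sum>a\<in>UNIV. (softmax \<theta> s a * Adv \<theta> s a)\<^sup>2) / (8 * \<delta>\<^sup>2 * lam)" for s
  have c0: "0 \<le> c s" for s
    unfolding c_def using lam by (intro divide_nonneg_nonneg sum_nonneg) auto
  have imp: "imp \<theta> \<theta>' s \<le> c s" for s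
  proof -
    let ?p = "softmax \<theta> s" and ?q = "softmax \<theta>' s"
    let ?x = "\<lambda>a. Adv \<theta> s a / lam"
    have "lam * (?q a * (?x a - z)) = ?q a * (Adv \<theta> s a - lam * z)" for a z
      using lam by (simp add: right_diff_distrib)
    then have "?q a * (rw \<theta>' (s, a) + \<gamma> * PE (V \<theta>) (s, a)) - ?q a * V \<theta> s
        = lam * (?q a * (?x a - (ln (?q a) - ln (?p a))))" for a
      by (simp add: Adv_def soft_Q_def ent_rew_def algebra_simps)
    then have "(\<Sum>a\<in>UNIV. ?q a * (rw \<theta>' (s, a) + \<gamma> * PE (V \<theta>) (s, a)) - ?q a * V \<theta> s)
        = lam * (\<Sum>a\<in>UNIV. ?q a * (?x a - (ln (?q a) - ln (?p a))))"
      by (simp add: sum_distrib_left)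
    then have "imp \<theta> \<theta>' s = lam * (\<Sum>a\<in>UNIV. ?q a * (?x a - (ln (?q a) - ln (?p a))))"
      by (simp add: imp_def sum_subtractf sum_softmax flip: sum_distrib_right)
    also have "\<dots> \<le> lam * ln (\<Sum>a\<in>UNIV. ?p a * exp (?x a))"
      using lam by (intro mult_left_mono gibbs_variational) (auto simp: softmax_pos sum_softmax)
    also have "\<dots> \<le> lam * ((\<Sum>a\<in>UNIV. (?p a * ?x a)\<^sup>2) / (8 * \<delta>\<^sup>2))"
      using lam Adv_centred[of \<theta> s] floor \<delta>
      by (intro mult_left_mono log_mgf_bound) (auto simp: sum_softmax simp flip: sum_divide_distrib)
    also have "\<dots> = c s"
      using lam by (simp add: c_def power_divide power2_eq_square flip: sum_divide_distrib)
    finally show ?thesis .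
  qed
  have "8 * \<delta>\<^sup>2 * lam * (1 - \<gamma>) * \<rho>m\<^sup>2 * (J \<theta>' - J \<theta>)
      \<le> 8 * \<delta>\<^sup>2 * lam * (1 - \<gamma>) * \<rho>m\<^sup>2 * ((\<Sum>s\<in>UNIV. c s) / (1 - \<gamma>))"
    using lam gamma by (intro mult_left_mono J_diff_le imp c0) auto
  also have "\<dots> = (\<Sum>s\<in>UNIV. \<Sum>a\<in>UNIV. \<rho>m\<^sup>2 * (softmax \<theta> s a * Adv \<theta> s a)\<^sup>2)"
  proof -
    have "8 * \<delta>\<^sup>2 * lam * c s = (\<Sum>a\<in>UNIV. (softmax \<theta> s a * Adv \<theta> s a)\<^sup>2)" for s
      using lam \<delta> by (simp add: c_def)
    then have "8 * \<delta>\<^sup>2 * lam * (\<Sum>s\<in>UNIV. c s) = (\<Sum>s\<in>UNIV. \<Sum>a\<in>UNIV. (softmax \<theta> s a * Adv \<theta> s a)\<^sup>2)"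
      by (simp add: sum_distrib_left)
    moreover have "8 * \<delta>\<^sup>2 * lam * (1 - \<gamma>) * \<rho>m\<^sup>2 * ((\<Sum>s\<in>UNIV. c s) / (1 - \<gamma>))
        = \<rho>m\<^sup>2 * (8 * \<delta>\<^sup>2 * lam * (\<Sum>s\<in>UNIV. c s))"
      using gamma by (simp add: mult_ac)
    ultimately show ?thesis by (simp add: sum_distrib_left)
  qed
  also have "\<dots> \<le> (\<Sum>s\<in>UNIV. \<Sum>a\<in>UNIV. (FG \<theta> $ (s, a))\<^sup>2)"
  proof (intro sum_mono)
    fix s a
    have "\<rho>m * \<bar>softmax \<theta> s a * Adv \<theta> s a\<bar> \<le> pmf \<rho> s * \<bar>softmax \<theta> s a * Adv \<theta> s a\<bar>"
      using \<rho>m by (intro mult_right_mono) auto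
    also have "\<dots> \<le> \<bar>FG \<theta> $ (s, a)\<bar>" by (rule full_grad_component)
    finally have "(\<rho>m * \<bar>softmax \<theta> s a * Adv \<theta> s a\<bar>)\<^sup>2 \<le> \<bar>FG \<theta> $ (s, a)\<bar>\<^sup>2"
      using \<rho>m by (intro power_mono) auto
    then show "\<rho>m\<^sup>2 * (softmax \<theta> s a * Adv \<theta> s a)\<^sup>2 \<le> (FG \<theta> $ (s, a))\<^sup>2"
      by (simp add: power_mult_distrib)
  qed
  also have "\<dots> = (norm (FG \<theta>))\<^sup>2"
    unfolding power2_norm_eq_inner inner_vec_def by (simp add: sum.cartesian_product power2_eq_square)
  finally show ?thesis .
qed

end

section \<open>The projection\<close>

locale projection_setup =
  fixes \<theta> :: "('s::finite, 'a::finite) param" and amax :: "'s \<Rightarrow> 'a" and \<tau> A :: real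
  assumes A_eq: "A = real CARD('a)"
    and amax: "is_arg_max (softmax \<theta> s) (\<lambda>_. True) (amax s)"
    and tau: "0 < \<tau>" "\<tau> \<le> 1 / (2 * A\<^sup>2)"
begin

abbreviation "low s \<equiv> low_actions \<tau> (softmax \<theta>) s"
definition "D s = (\<Sum>b\<in>low s. \<tau> - softmax \<theta> s b)"
abbreviation "\<pi>' \<equiv> proj_policy \<tau> amax (softmax \<theta>)"

lemma A_ge_1: "1 \<le> A"
  unfolding A_eq using zero_less_card_finite[where 'a='a] by linarith

lemma tau_le: "A * \<tau> \<le> 1 / (2 * A)"
  using tau A_ge_1 mult_left_mono[OF tau(2), of A] by (simp add: power2_eq_square)

text \<open>A maximum is at least the average. Since the moved mass is at most
  \<open>1 / (2 * A)\<close>, the maximizer keeps at least half of this.\<close>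

lemma amax_ge: "1 / A \<le> softmax \<theta> s (amax s)"
proof -
  have "softmax \<theta> s b \<le> softmax \<theta> s (amax s)" for b
    using amax[of s] by (auto simp: is_arg_max_linorder)
  then have "(\<Sum>b\<in>UNIV. softmax \<theta> s b) \<le> (\<Sum>b\<in>(UNIV::'a set). softmax \<theta> s (amax s))"
    by (intro sum_mono)
  then show ?thesis
    using A_ge_1 by (simp add: sum_softmax field_simps flip: A_eq)
qed

lemma tau_half_less: "\<tau> / 2 < 1 / (2 * A)"
proof -
  have "\<tau> \<le> A * \<tau>" using A_ge_1 tau by simp
  then show ?thesis using tau_le tau by linarith
qed

lemma amax_not_low: "amax s \<notin> low s"
proof -
  have "1 / (2 * A) \<le> 1 / A" using A_ge_1 by (simp add: field_simps)
  then show ?thesis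
    using amax_ge[of s] tau_half_less by (simp add: low_actions_def)
qed

lemma low_gap: "b \<in> low s \<Longrightarrow> \<tau> / 2 \<le> \<tau> - softmax \<theta> s b"
  by (simp add: low_actions_def)

lemma D_nonneg: "0 \<le> D s"
  unfolding D_def using low_gap tau by (intro sum_nonneg) force

lemma D_ge: "b \<in> low s \<Longrightarrow> \<tau> / 2 \<le> D s"
  unfolding D_def using member_le_sum[of b "low s" "\<lambda>b. \<tau> - softmax \<theta> s b"] low_gap tau by force

lemma D_le: "D s \<le> 1 / (2 * A)"
proof -
  have "D s \<le> (\<Sum>b\<in>low s. \<tau>)"
    unfolding D_def by (intro sum_mono) (simp add: softmax_nonneg)
  also have "\<dots> \<le> (\<Sum>b\<in>(UNIV::'a set). \<tau>)"
    using tau by (intro sum_mono2) auto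
  finally show ?thesis using tau_le by (simp flip: A_eq)
qed

lemma proj_policy_eq:
  "\<pi>' s a = softmax \<theta> s a + (if a \<in> low s then \<tau> - softmax \<theta> s a else 0) - (if a = amax s then D s else 0)"
  using amax_not_low[of s] by (auto simp: proj_policy_def D_def)

lemma proj_policy_amax: "\<pi>' s (amax s) \<ge> 1 / (2 * A)"
proof -
  have "\<pi>' s (amax s) = softmax \<theta> s (amax s) - D s"
    using amax_not_low[of s] by (simp add: proj_policy_eq)
  moreover have "1 / A = 1 / (2 * A) + 1 / (2 * A)" using A_ge_1 by (simp add: field_simps)
  ultimately show ?thesis using amax_ge[of s] D_le[of s] by linarith
qed

text \<open>Raised actions get \<open>\<tau>\<close> and the maximizer keeps
  \<open>1 / (2 * A)\<close>, but an untouched action is only known to exceed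
  \<open>\<tau> / 2\<close>; this case fixes the guaranteed floor.\<close>

lemma proj_policy_floor: "\<tau> / 2 \<le> \<pi>' s a"
  using proj_policy_amax[of s] tau_half_less tau
  by (cases "a = amax s"; cases "a \<in> low s") (auto simp: proj_policy_def low_actions_def)

lemma proj_policy_pos: "0 < \<pi>' s a"
  using proj_policy_floor[of s a] tau by linarith

lemma sum_proj_policy: "(\<Sum>a\<in>UNIV. \<pi>' s a) = 1"
  by (simp add: proj_policy_eq sum.distrib sum_subtractf sum_softmax sum.If_cases D_def)

text \<open>Logarithms of positive weights summing to one are softmax parameters with normalizer
  one.\<close>

lemma softmax_proj_param: "softmax (proj_param \<tau> amax \<theta>) s a = \<pi>' s a"
  unfolding softmax_def[of "proj_param \<tau> amax \<theta>"]
  by (simp add: proj_param_def proj_policy_pos sum_proj_policy)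

end

context soft_mdp
begin

text \<open>Raising a rare action to probability \<open>\<tau>\<close> gains entropy at rate \<open>- ln \<tau>\<close> per unit of mass, which
  outweighs the range of the soft Q-function and the entropy lost at the likeliest action.\<close>

lemma projection_improves:
  assumes "projection_setup \<theta> amax \<tau> A"
    and gap: "(1 + \<gamma> * lam * logA) / (1 - \<gamma>) + lam \<le> lam * (- ln (2 * A) - ln \<tau>)"
  shows "J (proj_param \<tau> amax \<theta>) \<ge> J \<theta>"
    and "softmax \<theta> s a \<le> \<tau> / 2 \<Longrightarrow> J (proj_param \<tau> amax \<theta>) \<ge> J \<theta> + pmf \<rho> s * (lam * \<tau> / 2)"
proof -
  interpret projection_setup \<theta> amax \<tau> A by fact
  let ?\<theta>' = "proj_param \<tau> amax \<theta>"
  \<comment> \<open>Upper bound on the soft Q-function without the current entropy bonus: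
    \<open>1 + \<gamma> * Rmax / (1 - \<gamma>)\<close> simplified.\<close>
  define Qm where "Qm = (1 + \<gamma> * lam * logA) / (1 - \<gamma>)"
  define q where "q s a = r s a + \<gamma> * PE (V \<theta>) (s, a)" for s a
  have q: "0 \<le> q s a" "q s a \<le> Qm" for s a
  proof -
    have PV: "0 \<le> PE (V \<theta>) (s, a)" "PE (V \<theta>) (s, a) \<le> Rmax / (1 - \<gamma>)"
      using V_bounds by (intro PE_bounds; blast)+
    then show "0 \<le> q s a" using gamma rew_bounds by (simp add: q_def)
    have "q s a \<le> 1 + \<gamma> * (Rmax / (1 - \<gamma>))"
      unfolding q_def using PV gamma rew_bounds by (intro add_mono mult_left_mono) auto
    also have "\<dots> = Qm" using gamma by (simp add: Qm_def field_simps)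
    finally show "q s a \<le> Qm" .
  qed
  have imp: "imp \<theta> ?\<theta>' s \<ge> D s * lam" for s
  proof -
    let ?p = "softmax \<theta> s" and ?m = "\<pi>' s (amax s)"
    define h where "h a = (\<pi>' s a - ?p a) * q s a + lam * (- \<pi>' s a * ln (\<pi>' s a) + ?p a * ln (?p a))" for a
    have "\<pi>' s a * (rw ?\<theta>' (s, a) + \<gamma> * PE (V \<theta>) (s, a)) - ?p a * soft_Q \<theta> (s, a) = h a" for a
      by (simp add: h_def q_def soft_Q_def ent_rew_def softmax_proj_param algebra_simps)
    then have imp_eq: "imp \<theta> ?\<theta>' s = (\<Sum>a\<in>UNIV. h a)"
      unfolding imp_def bellman[of \<theta> s] softmax_proj_param sum_subtractf[symmetric] by simp
    \<comment> \<open>The entropy change is linearized at the new probabilities,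
      \<open>\<tau>\<close> for raised actions and \<open>?m\<close> for the maximizer, where
      concavity gives lower bounds.\<close>
    have h: "h a \<ge> (if a \<in> low s then \<tau> - ?p a else 0) * (lam * (- ln \<tau> - 1))
        + (if a = amax s then D s * (lam * (ln ?m + 1) - Qm) else 0)" for a
    proof (cases "a = amax s")
      case True
      then have m: "?p a = ?m + D s" "a \<notin> low s"
        using amax_not_low[of s] by (auto simp: proj_policy_eq)
      have "0 < ?m + D s" using m(1) softmax_pos[of \<theta> s a] by simp
      from entropy_tangent[OF proj_policy_pos[of s "amax s"] this]
      have "(ln ?m + 1) * D s \<le> - ?m * ln ?m + (?m + D s) * ln (?m + D s)"
        by (simp add: algebra_simps)
      then have "lam * ((ln ?m + 1) * D s) \<le> lam * (- ?m * ln ?m + (?m + D s) * ln (?m + D s))"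
        using lam by (intro mult_left_mono) auto
      moreover have "D s * q s a \<le> D s * Qm"
        using q D_nonneg by (intro mult_left_mono) auto
      moreover have "h a = - (D s * q s a) + lam * (- ?m * ln ?m + (?m + D s) * ln (?m + D s))"
        using True m by (simp add: h_def)
      ultimately show ?thesis using True m by (simp add: algebra_simps)
    next
      case False
      show ?thesis
      proof (cases "a \<in> low s")
        case True
        then have t: "\<pi>' s a = \<tau>" by (simp add: proj_policy_def)
        have "(\<tau> - ?p a) * (- ln \<tau> - 1) \<le> - \<tau> * ln \<tau> + ?p a * ln (?p a)"
          using entropy_tangent[OF tau(1) softmax_pos[of \<theta> s a]] by (simp add: algebra_simps)
        then have "lam * ((\<tau> - ?p a) * (- ln \<tau> - 1)) \<le> lam * (- \<tau> * ln \<tau> + ?p a * ln (?p a))"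
          using lam by (intro mult_left_mono) auto
        moreover have "0 \<le> (\<tau> - ?p a) * q s a"
          using low_gap[OF True] tau q by (intro mult_nonneg_nonneg) auto
        ultimately show ?thesis using True False t by (simp add: h_def mult_ac)
      next
        case nl: False
        then have "\<pi>' s a = ?p a" using False by (simp add: proj_policy_def)
        then show ?thesis using False nl by (simp add: h_def)
      qed
    qed
    \<comment> \<open>Added and removed mass are both \<open>D s\<close>, so the constants
      \<open>1\<close> of the two tangents cancel and \<open>ln ?m - ln \<tau>\<close> remains. The
      summand \<open>lam\<close> in the hypothesis \<open>gap\<close> leaves a strict gain.\<close>
    have "D s * lam \<le> D s * (lam * (ln ?m - ln \<tau>) - Qm)"
    proof (rule mult_left_mono)
      have "ln (1 / (2 * A)) \<le> ln ?m"
        using proj_policy_amax[of s] A_ge_1 by (intro ln_mono) auto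
      then have "- ln (2 * A) \<le> ln ?m" using A_ge_1 by (simp add: ln_div)
      then have "lam * (- ln (2 * A) - ln \<tau>) \<le> lam * (ln ?m - ln \<tau>)"
        using lam by (intro mult_left_mono) auto
      then show "lam \<le> lam * (ln ?m - ln \<tau>) - Qm"
        using gap unfolding Qm_def by linarith
    qed (rule D_nonneg)
    also have "\<dots> = (\<Sum>a\<in>UNIV. (if a \<in> low s then \<tau> - ?p a else 0) * (lam * (- ln \<tau> - 1))
        + (if a = amax s then D s * (lam * (ln ?m + 1) - Qm) else 0))"
    proof -
      have "(\<Sum>a\<in>UNIV. (if a \<in> low s then \<tau> - ?p a else 0) * k + (if a = amax s then l else 0)) = D s * k + l" for k l
        by (simp add: sum.distrib sum.If_cases D_def flip: sum_distrib_right)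
      then show ?thesis by (simp only:) (simp add: algebra_simps)
    qed
    also have "\<dots> \<le> (\<Sum>a\<in>UNIV. h a)"
      by (rule sum_mono[OF h])
    finally show ?thesis unfolding imp_eq .
  qed
  have imp0: "0 \<le> imp \<theta> ?\<theta>' s" for s
    using imp[of s] mult_nonneg_nonneg[OF D_nonneg[of s] less_imp_le[OF lam]] by linarith
  have J: "J ?\<theta>' - J \<theta> \<ge> (\<Sum>s\<in>UNIV. pmf \<rho> s * imp \<theta> ?\<theta>' s)"
    by (rule J_diff_ge[OF imp0])
  have "0 \<le> (\<Sum>s\<in>UNIV. pmf \<rho> s * imp \<theta> ?\<theta>' s)"
    using imp0 by (intro sum_nonneg) auto
  with J show "J ?\<theta>' \<ge> J \<theta>" by linarith
  assume "softmax \<theta> s a \<le> \<tau> / 2"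
  then have "\<tau> / 2 \<le> D s" by (intro D_ge[of a]) (simp add: low_actions_def)
  then have "\<tau> / 2 * lam \<le> imp \<theta> ?\<theta>' s"
    using imp[of s] lam by (meson mult_right_mono less_imp_le order_trans)
  then have "pmf \<rho> s * (\<tau> / 2 * lam) \<le> pmf \<rho> s * imp \<theta> ?\<theta>' s"
    by (intro mult_left_mono) auto
  also have "\<dots> \<le> (\<Sum>s\<in>UNIV. pmf \<rho> s * imp \<theta> ?\<theta>' s)"
    using imp0 by (intro member_le_sum) auto
  finally show "J ?\<theta>' \<ge> J \<theta> + pmf \<rho> s * (lam * \<tau> / 2)"
    using J by (simp add: mult_ac)
qed

end

section \<open>Heterogeneity\<close>

lemma square_sum_le: "(x + y)\<^sup>2 \<le> 2 * x\<^sup>2 + 2 * y\<^sup>2" for x y :: real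
  using sum_squares_bound[of x y] by (simp add: power2_sum)

text \<open>Only the average of \<open>f\<close> over the last action is bounded, because the entropy bonus of that action is not.\<close>

lemma texp_kernel_diff_step:
  fixes f :: "('s::finite, 'a::finite) traj \<Rightarrow> 'b::euclidean_space"
  assumes kernel: "\<And>s a. (\<Sum>s'\<in>UNIV. \<bar>pmf (P s a) s' - pmf (P' s a) s'\<bar>) \<le> \<epsilon>" and "0 \<le> c"
    and IH: "\<And>g :: ('s, 'a) traj \<Rightarrow> 'b. (\<And>\<omega>. norm (g \<omega>) \<le> c) \<Longrightarrow>
      norm (texp \<rho> P \<theta> n g - texp \<rho> P' \<theta> n g) \<le> real n * \<epsilon> * c"
    and f: "\<And>\<omega> s. norm (\<Sum>a\<in>UNIV. softmax \<theta> s a *\<^sub>R f (fun_upd \<omega> n (s, a))) \<le> c"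
  shows "norm (texp \<rho> P \<theta> (Suc n) f - texp \<rho> P' \<theta> (Suc n) f) \<le> real (Suc n) * \<epsilon> * c"
proof -
  let ?F = "\<lambda>\<omega> s. \<Sum>a\<in>UNIV. softmax \<theta> s a *\<^sub>R f (fun_upd \<omega> n (s, a))"
  let ?G = "\<lambda>P \<omega>. \<Sum>s\<in>UNIV. pmf (next_pmf \<rho> P n \<omega>) s *\<^sub>R ?F \<omega> s"
  have \<epsilon>: "0 \<le> \<epsilon>"
    by (rule order_trans[OF _ kernel]) (auto intro: sum_nonneg)
  have G: "norm (?G P \<omega>) \<le> c" for \<omega>
  proof -
    have "norm (?G P \<omega>) \<le> (\<Sum>s\<in>UNIV. pmf (next_pmf \<rho> P n \<omega>) s * c)"
      using f by (intro sum_norm_le) (simp add: mult_left_mono)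
    then show ?thesis by (simp add: sum_pmf_eq_1 flip: sum_distrib_right)
  qed
  have GG: "norm (?G P \<omega> - ?G P' \<omega>) \<le> \<epsilon> * c" for \<omega>
  proof -
    have "?G P \<omega> - ?G P' \<omega> = (\<Sum>s\<in>UNIV. (pmf (next_pmf \<rho> P n \<omega>) s - pmf (next_pmf \<rho> P' n \<omega>) s) *\<^sub>R ?F \<omega> s)"
      by (simp add: sum_subtractf scaleR_left_diff_distrib)
    also have "norm \<dots> \<le> (\<Sum>s\<in>UNIV. \<bar>pmf (next_pmf \<rho> P n \<omega>) s - pmf (next_pmf \<rho> P' n \<omega>) s\<bar> * c)"
      using f by (intro sum_norm_le) (simp add: mult_left_mono)
    also have "\<dots> = (\<Sum>s\<in>UNIV. \<bar>pmf (next_pmf \<rho> P n \<omega>) s - pmf (next_pmf \<rho> P' n \<omega>) s\<bar>) * c"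
      by (simp add: sum_distrib_right)
    also have "\<dots> \<le> \<epsilon> * c"
      using kernel \<epsilon> \<open>0 \<le> c\<close> by (intro mult_right_mono) (auto simp: next_pmf_def split: nat.splits)
    finally show ?thesis .
  qed
  have "texp \<rho> P \<theta> (Suc n) f - texp \<rho> P' \<theta> (Suc n) f
      = (texp \<rho> P \<theta> n (?G P) - texp \<rho> P' \<theta> n (?G P)) + texp \<rho> P' \<theta> n (\<lambda>\<omega>. ?G P \<omega> - ?G P' \<omega>)"
    unfolding texp_diff by (simp add: texp_Suc)
  also have "norm \<dots> \<le> real n * \<epsilon> * c + texp \<rho> P' \<theta> n (\<lambda>_. \<epsilon> * c)"
    by (intro norm_triangle_le add_mono IH[OF G] texp_norm_le GG)
  finally show ?thesis by (simp add: texp_const algebra_simps)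
qed

lemma texp_kernel_diff:
  fixes f :: "('s::finite, 'a::finite) traj \<Rightarrow> 'b::euclidean_space"
  assumes kernel: "\<And>s a. (\<Sum>s'\<in>UNIV. \<bar>pmf (P s a) s' - pmf (P' s a) s'\<bar>) \<le> \<epsilon>" and "0 \<le> c"
    and f: "\<And>\<omega>. norm (f \<omega>) \<le> c"
  shows "norm (texp \<rho> P \<theta> n f - texp \<rho> P' \<theta> n f) \<le> real n * \<epsilon> * c"
  using f
proof (induction n arbitrary: f)
  case 0
  then show ?case by (simp add: texp_0)
next
  case (Suc n)
  show ?case
  proof (rule texp_kernel_diff_step[OF kernel \<open>0 \<le> c\<close> Suc.IH])
    fix \<omega> s
    have "norm (\<Sum>a\<in>UNIV. softmax \<theta> s a *\<^sub>R f (fun_upd \<omega> n (s, a))) \<le> (\<Sum>a\<in>UNIV. softmax \<theta> s a * c)"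
      using Suc.prems by (intro sum_norm_le) (simp add: mult_left_mono softmax_nonneg)
    then show "norm (\<Sum>a\<in>UNIV. softmax \<theta> s a *\<^sub>R f (fun_upd \<omega> n (s, a))) \<le> c"
      by (simp add: sum_softmax flip: sum_distrib_right)
  qed
qed

text \<open>At time \<open>t\<close> the kernels change the law by at most
  \<open>(t + 1) * \<epsilon>P\<close> against an integrand of size
  \<open>Rmax * sqrt 2 * (t + 1)\<close>. The entropy bonuses depend only on \<theta> and cancel in
  the reward difference. The truncated bounds pass to the limit.\<close>

lemma full_grad_heterogeneity:
  assumes "soft_mdp r \<gamma> lam logA" "soft_mdp r' \<gamma> lam logA"
    and kernel: "\<And>s a. (\<Sum>s'\<in>UNIV. \<bar>pmf (P s a) s' - pmf (P' s a) s'\<bar>) \<le> \<epsilon>P"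
    and reward: "\<And>s a. \<bar>r s a - r' s a\<bar> \<le> \<epsilon>r"
  shows "(norm (full_grad \<rho> P r \<gamma> lam \<theta> - full_grad \<rho> P' r' \<gamma> lam \<theta>))\<^sup>2
    \<le> 16 * (1 + lam * logA)\<^sup>2 * \<epsilon>P\<^sup>2 / (1 - \<gamma>) ^ 6 + 4 * \<epsilon>r\<^sup>2 / (1 - \<gamma>) ^ 4"
proof -
  interpret a: soft_mdp \<rho> P r \<gamma> lam logA by fact
  interpret b: soft_mdp \<rho> P' r' \<gamma> lam logA by fact
  have \<epsilon>: "0 \<le> \<epsilon>P" "0 \<le> \<epsilon>r"
    using order_trans[OF _ kernel] order_trans[OF _ reward] by (auto intro: sum_nonneg)
  let ?S = "\<lambda>t. traj_score \<theta> (Suc t)"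
  have term_le: "norm (a.G \<theta> t - b.G \<theta> t) \<le> sqrt 2 * a.Rmax * \<epsilon>P * (real t + 1)\<^sup>2 + sqrt 2 * \<epsilon>r * (real t + 1)" for t
  proof -
    let ?c = "sqrt 2 * (real t + 1)"
    let ?f = "\<lambda>\<omega>. a.rw \<theta> (\<omega> t) *\<^sub>R ?S t \<omega>"
    have c0: "0 \<le> a.Rmax * ?c" using a.Rmax_ge_1 by simp
    have S: "norm (?S t \<omega>) \<le> ?c" for \<omega>
      using norm_traj_score[of \<theta> "Suc t" \<omega>] by (simp add: add.commute)
    have "norm (texp \<rho> P \<theta> (Suc t) ?f - texp \<rho> P' \<theta> (Suc t) ?f) \<le> real (Suc t) * \<epsilon>P * (a.Rmax * ?c)"
    proof (rule texp_kernel_diff_step[OF kernel c0 texp_kernel_diff[OF kernel c0]])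
      fix \<omega> s
      have "norm (\<Sum>a\<in>UNIV. softmax \<theta> s a *\<^sub>R ?f (fun_upd \<omega> t (s, a))) \<le> (\<Sum>a\<in>UNIV. softmax \<theta> s a * a.rw \<theta> (s, a) * ?c)"
        using S by (intro sum_norm_le) (simp add: mult_left_mono softmax_nonneg a.rw_nonneg mult.assoc)
      also have "\<dots> \<le> a.Rmax * ?c"
        unfolding sum_distrib_right[symmetric] by (intro mult_right_mono a.softmax_rw_le) simp
      finally show "norm (\<Sum>a\<in>UNIV. softmax \<theta> s a *\<^sub>R ?f (fun_upd \<omega> t (s, a))) \<le> a.Rmax * ?c" .
    qed
    moreover have "norm (texp \<rho> P' \<theta> (Suc t) (\<lambda>\<omega>. (a.rw \<theta> (\<omega> t) - b.rw \<theta> (\<omega> t)) *\<^sub>R ?S t \<omega>)) \<le> texp \<rho> P' \<theta> (Suc t) (\<lambda>_. \<epsilon>r * ?c)"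
    proof (rule texp_norm_le)
      fix \<omega>
      show "norm ((a.rw \<theta> (\<omega> t) - b.rw \<theta> (\<omega> t)) *\<^sub>R ?S t \<omega>) \<le> \<epsilon>r * ?c"
        using reward S \<epsilon> by (simp add: ent_rew_def mult_mono)
    qed
    moreover have "a.G \<theta> t - b.G \<theta> t = (texp \<rho> P \<theta> (Suc t) ?f - texp \<rho> P' \<theta> (Suc t) ?f)
        + texp \<rho> P' \<theta> (Suc t) (\<lambda>\<omega>. (a.rw \<theta> (\<omega> t) - b.rw \<theta> (\<omega> t)) *\<^sub>R ?S t \<omega>)"
      unfolding scaleR_left_diff_distrib texp_diff by (simp add: grad_term_def)
    ultimately have "norm (a.G \<theta> t - b.G \<theta> t) \<le> real (Suc t) * \<epsilon>P * (a.Rmax * ?c) + \<epsilon>r * ?c"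
      by (simp only: texp_const) (rule norm_triangle_le, linarith)
    then show ?thesis by (simp add: power2_eq_square mult_ac add.commute)
  qed
  define c where "c = 2 * sqrt 2 * a.Rmax * \<epsilon>P / (1 - \<gamma>) ^ 3 + sqrt 2 * \<epsilon>r / (1 - \<gamma>)\<^sup>2"
  have "norm (a.TG T \<theta> - b.TG T \<theta>) \<le> c" for T
  proof -
    have eq: "a.TG T \<theta> - b.TG T \<theta> = (\<Sum>t<T. \<gamma> ^ t *\<^sub>R (a.G \<theta> t - b.G \<theta> t))"
      by (simp add: trunc_grad_def sum_subtractf scaleR_right_diff_distrib)
    have "norm (a.TG T \<theta> - b.TG T \<theta>)
        \<le> (\<Sum>t<T. \<gamma> ^ t * (sqrt 2 * a.Rmax * \<epsilon>P * (real t + 1)\<^sup>2 + sqrt 2 * \<epsilon>r * (real t + 1)))"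
      unfolding eq
    proof (rule sum_norm_le)
      fix t
      have "\<gamma> ^ t * norm (a.G \<theta> t - b.G \<theta> t)
          \<le> \<gamma> ^ t * (sqrt 2 * a.Rmax * \<epsilon>P * (real t + 1)\<^sup>2 + sqrt 2 * \<epsilon>r * (real t + 1))"
        using a.gamma term_le by (intro mult_left_mono) auto
      then show "norm (\<gamma> ^ t *\<^sub>R (a.G \<theta> t - b.G \<theta> t))
          \<le> \<gamma> ^ t * (sqrt 2 * a.Rmax * \<epsilon>P * (real t + 1)\<^sup>2 + sqrt 2 * \<epsilon>r * (real t + 1))"
        using a.gamma by (simp only: norm_scaleR) simp
    qed
    also have "\<dots> = sqrt 2 * a.Rmax * \<epsilon>P * (\<Sum>t<T. \<gamma> ^ t * (real t + 1)\<^sup>2)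
        + sqrt 2 * \<epsilon>r * (\<Sum>t<T. \<gamma> ^ t * (real t + 1))"
    proof -
      have "(\<Sum>t<T. \<gamma> ^ t * (x * f t + y * g t)) = x * (\<Sum>t<T. \<gamma> ^ t * f t) + y * (\<Sum>t<T. \<gamma> ^ t * g t)"
        for x y and f g :: "nat \<Rightarrow> real"
        by (simp add: sum_distrib_left sum.distrib algebra_simps)
      then show ?thesis .
    qed
    also have "\<dots> \<le> sqrt 2 * a.Rmax * \<epsilon>P * (2 / (1 - \<gamma>) ^ 3) + sqrt 2 * \<epsilon>r * (1 / (1 - \<gamma>)\<^sup>2)"
      using \<epsilon> a.Rmax_ge_1 by (intro add_mono mult_left_mono sum_geometric_bounds a.gamma) auto
    finally show ?thesis by (simp add: c_def mult_ac)
  qed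
  then have "norm (a.FG \<theta> - b.FG \<theta>) \<le> c"
    by (intro LIMSEQ_le_const2[OF tendsto_norm[OF tendsto_diff[OF a.TG_tendsto b.TG_tendsto]]]) auto
  then have "(norm (a.FG \<theta> - b.FG \<theta>))\<^sup>2 \<le> c\<^sup>2"
    by (intro power_mono) auto
  also have "\<dots> \<le> 2 * (2 * sqrt 2 * a.Rmax * \<epsilon>P / (1 - \<gamma>) ^ 3)\<^sup>2 + 2 * (sqrt 2 * \<epsilon>r / (1 - \<gamma>)\<^sup>2)\<^sup>2"
    unfolding c_def by (rule square_sum_le)
  also have "\<dots> = 16 * a.Rmax\<^sup>2 * \<epsilon>P\<^sup>2 / (1 - \<gamma>) ^ 6 + 4 * \<epsilon>r\<^sup>2 / (1 - \<gamma>) ^ 4"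
    by (simp add: power_mult_distrib power_divide flip: power_mult)
  finally show ?thesis .
qed

section \<open>The gradient estimator and the infinite-horizon objective\<close>

text \<open>Cauchy-Schwarz with the weight shared between the two factors.\<close>

lemma weighted_square_sum_le:
  fixes w y :: "nat \<Rightarrow> real"
  assumes "\<And>t. 0 \<le> w t"
  shows "(\<Sum>t<T. w t * y t)\<^sup>2 \<le> (\<Sum>t<T. w t) * (\<Sum>t<T. w t * (y t)\<^sup>2)"
proof -
  have "(\<Sum>t<T. w t * y t)\<^sup>2 = (\<Sum>t<T. sqrt (w t) * (sqrt (w t) * y t))\<^sup>2"
    using assms by (simp flip: mult.assoc)
  also have "\<dots> \<le> (\<Sum>t<T. (sqrt (w t))\<^sup>2) * (\<Sum>t<T. (sqrt (w t) * y t)\<^sup>2)"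
    by (rule Cauchy_Schwarz_ineq_sum)
  also have "\<dots> = (\<Sum>t<T. w t) * (\<Sum>t<T. w t * (y t)\<^sup>2)"
    using assms by (simp add: power_mult_distrib)
  finally show ?thesis .
qed

context soft_mdp
begin

section \<open>Mean and variance of the estimator\<close>

definition "traj_est T \<theta> \<omega> = (\<Sum>t<T. (\<gamma> ^ t * rw \<theta> (\<omega> t)) *\<^sub>R traj_score \<theta> (Suc t) \<omega>)"

lemma grad_est_eq: "grad_est \<gamma> lam r B T z \<theta> = (1 / real B) *\<^sub>R (\<Sum>b<B. traj_est T \<theta> (z ! b))"
  unfolding grad_est_def traj_est_def ent_rew_def traj_score_def case_prod_unfold gradient_ln_softmax
    lessThan_Suc_atMost ..

lemma texp_single: "E \<theta> T (traj_est T \<theta>) = TG T \<theta>"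
proof -
  have "E \<theta> T (traj_est T \<theta>) = (\<Sum>t<T. E \<theta> T (\<lambda>\<omega>. \<gamma> ^ t *\<^sub>R (rw \<theta> (\<omega> t) *\<^sub>R traj_score \<theta> (Suc t) \<omega>)))"
    unfolding traj_est_def texp_sum by simp
  also have "\<dots> = TG T \<theta>"
    unfolding trunc_grad_def texp_scaleR grad_term_def
    by (intro sum.cong refl arg_cong[where f="scaleR _"] texp_restrict) (auto simp: traj_score_upd)
  finally show ?thesis .
qed

lemma texp_rw_sq_le: "E \<theta> (Suc t) (\<lambda>\<omega>. (rw \<theta> (\<omega> t))\<^sup>2) \<le> 2 + 12 * lam\<^sup>2 * logA\<^sup>2"
proof (rule texp_last_action)
  fix \<omega> s
  have "softmax \<theta> s a * (rw \<theta> (s, a))\<^sup>2 \<le> softmax \<theta> s a * 2 + 2 * lam\<^sup>2 * (softmax \<theta> s a * (ln (softmax \<theta> s a))\<^sup>2)" for a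
  proof -
    have "(rw \<theta> (s, a))\<^sup>2 \<le> 2 * (r s a)\<^sup>2 + 2 * (- lam * ln (softmax \<theta> s a))\<^sup>2"
      using square_sum_le[of "r s a" "- lam * ln (softmax \<theta> s a)"] by (simp add: ent_rew_def)
    also have "\<dots> \<le> 2 * 1 + 2 * (- lam * ln (softmax \<theta> s a))\<^sup>2"
      using rew_bounds[of s a] by (intro add_right_mono mult_left_mono power_le_one) auto
    finally have "softmax \<theta> s a * (rw \<theta> (s, a))\<^sup>2 \<le> softmax \<theta> s a * (2 * 1 + 2 * (- lam * ln (softmax \<theta> s a))\<^sup>2)"
      by (intro mult_left_mono softmax_nonneg)
    then show ?thesis by (simp add: algebra_simps power_mult_distrib)
  qed
  then have "(\<Sum>a\<in>UNIV. softmax \<theta> s a * (rw \<theta> (s, a))\<^sup>2)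
      \<le> (\<Sum>a\<in>UNIV. softmax \<theta> s a * 2 + 2 * lam\<^sup>2 * (softmax \<theta> s a * (ln (softmax \<theta> s a))\<^sup>2))"
    by (rule sum_mono)
  also have "\<dots> = 2 + 2 * lam\<^sup>2 * (\<Sum>a\<in>UNIV. softmax \<theta> s a * (ln (softmax \<theta> s a))\<^sup>2)"
    by (simp add: sum.distrib sum_softmax flip: sum_distrib_right sum_distrib_left)
  also have "\<dots> \<le> 2 + 2 * lam\<^sup>2 * (6 * logA\<^sup>2)"
    using softmax_ln_sq_le[OF card_actions, of \<theta> s] unfolding logA_eq
    by (intro add_left_mono mult_left_mono) auto
  finally show "(\<Sum>a\<in>UNIV. softmax \<theta> s a * (rw \<theta> ((fun_upd \<omega> t (s, a)) t))\<^sup>2) \<le> 2 + 12 * lam\<^sup>2 * logA\<^sup>2"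
    by simp
qed

text \<open>Weighted Cauchy-Schwarz with weights \<open>\<gamma> ^ t * (t + 1)\<close>, of total
  mass at most \<open>1 / (1 - \<gamma>)\<^sup>2\<close>, reduces the claim to second moments of
  single rewards.\<close>

lemma texp_single_sq_le: "E \<theta> T (\<lambda>\<omega>. (norm (traj_est T \<theta> \<omega>))\<^sup>2) \<le> (4 + 24 * lam\<^sup>2 * logA\<^sup>2) / (1 - \<gamma>) ^ 4"
proof -
  define w where "w t = \<gamma> ^ t * (real t + 1)" for t :: nat
  have w: "0 \<le> w t" for t using gamma by (simp add: w_def)
  have sw: "(\<Sum>t<T. w t) \<le> 1 / (1 - \<gamma>)\<^sup>2"
    unfolding w_def by (rule sum_geometric_bounds(2)[OF gamma])
  have "(norm (traj_est T \<theta> \<omega>))\<^sup>2 \<le> 2 * (\<Sum>t<T. w t) * (\<Sum>t<T. w t * (rw \<theta> (\<omega> t))\<^sup>2)" for \<omega>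
  proof -
    have "norm (traj_est T \<theta> \<omega>) \<le> (\<Sum>t<T. sqrt 2 * (w t * rw \<theta> (\<omega> t)))"
      unfolding traj_est_def
    proof (rule sum_norm_le)
      fix t
      have "norm (traj_score \<theta> (Suc t) \<omega>) \<le> sqrt 2 * (real t + 1)"
        using norm_traj_score[of \<theta> "Suc t" \<omega>] by (simp add: add.commute)
      then have "(\<gamma> ^ t * rw \<theta> (\<omega> t)) * norm (traj_score \<theta> (Suc t) \<omega>) \<le> (\<gamma> ^ t * rw \<theta> (\<omega> t)) * (sqrt 2 * (real t + 1))"
        using gamma rw_nonneg[of \<theta> "\<omega> t"] by (intro mult_left_mono) auto
      then show "norm ((\<gamma> ^ t * rw \<theta> (\<omega> t)) *\<^sub>R traj_score \<theta> (Suc t) \<omega>) \<le> sqrt 2 * (w t * rw \<theta> (\<omega> t))"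
        using gamma rw_nonneg[of \<theta> "\<omega> t"] by (simp add: w_def mult_ac abs_mult)
    qed
    then have "(norm (traj_est T \<theta> \<omega>))\<^sup>2 \<le> (\<Sum>t<T. sqrt 2 * (w t * rw \<theta> (\<omega> t)))\<^sup>2"
      by (intro power_mono) auto
    also have "\<dots> = 2 * (\<Sum>t<T. w t * rw \<theta> (\<omega> t))\<^sup>2"
      by (simp add: power_mult_distrib flip: sum_distrib_left)
    also have "\<dots> \<le> 2 * ((\<Sum>t<T. w t) * (\<Sum>t<T. w t * (rw \<theta> (\<omega> t))\<^sup>2))"
      using weighted_square_sum_le[of w "\<lambda>t. rw \<theta> (\<omega> t)" T] w by (intro mult_left_mono) auto
    finally show ?thesis by simp
  qed
  then have "E \<theta> T (\<lambda>\<omega>. (norm (traj_est T \<theta> \<omega>))\<^sup>2)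
      \<le> E \<theta> T (\<lambda>\<omega>. 2 * (\<Sum>t<T. w t) * (\<Sum>t<T. w t * (rw \<theta> (\<omega> t))\<^sup>2))"
    by (rule texp_mono)
  also have "\<dots> = 2 * (\<Sum>t<T. w t) * (\<Sum>t<T. w t * E \<theta> T (\<lambda>\<omega>. (rw \<theta> (\<omega> t))\<^sup>2))"
    by (simp only: texp_mult texp_sum)
  also have "\<dots> \<le> 2 * (\<Sum>t<T. w t) * (\<Sum>t<T. w t * (2 + 12 * lam\<^sup>2 * logA\<^sup>2))"
  proof (intro mult_left_mono sum_mono w)
    fix t assume "t \<in> {..<T}"
    then have "E \<theta> T (\<lambda>\<omega>. (rw \<theta> (\<omega> t))\<^sup>2) = E \<theta> (Suc t) (\<lambda>\<omega>. (rw \<theta> (\<omega> t))\<^sup>2)"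
      by (intro texp_restrict) auto
    then show "E \<theta> T (\<lambda>\<omega>. (rw \<theta> (\<omega> t))\<^sup>2) \<le> 2 + 12 * lam\<^sup>2 * logA\<^sup>2"
      using texp_rw_sq_le by simp
  qed (simp add: sum_nonneg w)
  also have "\<dots> = (4 + 24 * lam\<^sup>2 * logA\<^sup>2) * ((\<Sum>t<T. w t) * (\<Sum>t<T. w t))"
    unfolding sum_distrib_right[symmetric] by (simp add: algebra_simps)
  also have "\<dots> \<le> (4 + 24 * lam\<^sup>2 * logA\<^sup>2) * (1 / (1 - \<gamma>)\<^sup>2 * (1 / (1 - \<gamma>)\<^sup>2))"
    using sw w by (intro mult_left_mono mult_mono) (auto intro: sum_nonneg)
  also have "\<dots> = (4 + 24 * lam\<^sup>2 * logA\<^sup>2) / (1 - \<gamma>) ^ 4"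
    by (simp flip: power_add)
  finally show ?thesis .
qed

definition "sigma2_sq B = (12 + 24 * lam\<^sup>2 * logA\<^sup>2) / (real B * (1 - \<gamma>) ^ 4)"

definition "est_pmf B T \<theta> = map_pmf (\<lambda>z. grad_est \<gamma> lam r B T z \<theta>) (replicate_pmf B (traj_pmf \<rho> P (softmax_pmf \<theta>) T))"

lemma finite_est_pmf: "finite (set_pmf (est_pmf B T \<theta>))"
  by (simp add: est_pmf_def finite_set_replicate_pmf finite_traj_pmf)

lemma local_steps_eq_sgd: "local_steps \<gamma> lam \<rho> P r B T \<eta> \<theta> h = sgd \<eta> (est_pmf B T) \<theta> h"
  by (induction h) (simp_all add: est_pmf_def map_pmf_def bind_assoc_pmf bind_return_pmf)

lemma est_pmf_moments:
  assumes "B \<ge> 1"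
  shows "expect (est_pmf B T \<theta>) (\<lambda>g. g) = TG T \<theta>"
    and "expect (est_pmf B T \<theta>) (\<lambda>g. (norm (g - TG T \<theta>))\<^sup>2) \<le> sigma2_sq B"
proof -
  let ?p = "traj_pmf \<rho> P (softmax_pmf \<theta>) T"
  have mean: "expect ?p (traj_est T \<theta>) = TG T \<theta>"
    using texp_single[of \<theta> T] by (simp add: texp_def)
  note sums = expect_replicate_pmf_sum[where p="?p" and f="traj_est T \<theta>" and n=B, OF finite_traj_pmf, unfolded mean]
  have fin: "finite (set_pmf (replicate_pmf B ?p))"
    by (intro finite_set_replicate_pmf finite_traj_pmf)
  show "expect (est_pmf B T \<theta>) (\<lambda>g. g) = TG T \<theta>"
    using sums(1) assms by (simp add: est_pmf_def grad_est_eq fin)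
  have "expect (est_pmf B T \<theta>) (\<lambda>g. (norm (g - TG T \<theta>))\<^sup>2)
      = expect (replicate_pmf B ?p) (\<lambda>z. (1 / real B)\<^sup>2 * (norm ((\<Sum>b<B. traj_est T \<theta> (z ! b)) - real B *\<^sub>R TG T \<theta>))\<^sup>2)"
  proof -
    have "(1 / real B) *\<^sub>R S - TG T \<theta> = (1 / real B) *\<^sub>R (S - real B *\<^sub>R TG T \<theta>)" for S
      using assms by (simp add: scaleR_right_diff_distrib)
    then show ?thesis
      by (simp only: est_pmf_def integral_map_pmf grad_est_eq norm_scaleR power_mult_distrib power2_abs)
  qed
  also have "\<dots> = (1 / real B)\<^sup>2 * (real B * expect ?p (\<lambda>x. (norm (traj_est T \<theta> x - TG T \<theta>))\<^sup>2))"
    by (simp only: sums(2) integral_mult_right_zero)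
  also have "\<dots> = (1 / real B) * expect ?p (\<lambda>x. (norm (traj_est T \<theta> x - TG T \<theta>))\<^sup>2)"
    using assms by (simp add: power2_eq_square)
  also have "\<dots> \<le> (1 / real B) * expect ?p (\<lambda>x. (norm (traj_est T \<theta> x))\<^sup>2)"
    using variance_le_second_moment[where p="?p" and f="traj_est T \<theta>", OF finite_traj_pmf]
    by (intro mult_left_mono) (auto simp: mean)
  also have "\<dots> \<le> (1 / real B) * ((12 + 24 * lam\<^sup>2 * logA\<^sup>2) / (1 - \<gamma>) ^ 4)"
  proof (rule mult_left_mono)
    have "expect ?p (\<lambda>x. (norm (traj_est T \<theta> x))\<^sup>2) \<le> (4 + 24 * lam\<^sup>2 * logA\<^sup>2) / (1 - \<gamma>) ^ 4"
      using texp_single_sq_le[of \<theta> T] by (simp add: texp_def)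
    also have "\<dots> \<le> (12 + 24 * lam\<^sup>2 * logA\<^sup>2) / (1 - \<gamma>) ^ 4"
      by (intro divide_right_mono) auto
    finally show "expect ?p (\<lambda>x. (norm (traj_est T \<theta> x))\<^sup>2) \<le> (12 + 24 * lam\<^sup>2 * logA\<^sup>2) / (1 - \<gamma>) ^ 4" .
  qed simp
  also have "\<dots> = sigma2_sq B" by (simp add: sigma2_sq_def)
  finally show "expect (est_pmf B T \<theta>) (\<lambda>g. (norm (g - TG T \<theta>))\<^sup>2) \<le> sigma2_sq B" .
qed

lemma sigma2_sq_nonneg: "0 \<le> sigma2_sq B"
  unfolding sigma2_sq_def by simp

lemma sgd_chain_est:
  assumes "B \<ge> 1" "0 \<le> \<eta>"
  shows "sgd_chain \<eta> (est_pmf B T) (TG T) L2 L3 (sigma2_sq B)"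
proof
  show "\<exists>A. linear A \<and> (\<forall>u. norm (TG T (x + u) - TG T x - A u) \<le> L3 / 2 * (norm u)\<^sup>2)" for x
    by (rule TG_taylor)
qed (use assms L2_pos L3_pos sigma2_sq_nonneg finite_est_pmf est_pmf_moments TG_lipschitz in \<open>auto intro: less_imp_le\<close>)

text \<open>Link between the integral over infinite trajectories and the series used in the
  analysis. Rewards are nonnegative, so sum and integral may be exchanged, and each term reads
  finitely many coordinates, where \<open>traj_measure\<close> agrees with
  \<open>traj_pmf\<close>.\<close>

lemma J_agent_eq: "J_agent \<gamma> lam \<rho> P r \<theta> = J \<theta>"
proof -
  let ?M = "traj_measure \<rho> P (softmax_pmf \<theta>)"
  interpret IT: Ionescu_Tulcea "\<lambda>n \<omega>. measure_pmf (step_pmf \<rho> P (softmax_pmf \<theta>) n \<omega>)" "\<lambda>_. count_space UNIV"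
    by (rule Ionescu_Tulcea_step_pmf)
  have sets: "sets ?M = sets (PiM UNIV (\<lambda>_. count_space UNIV))"
    unfolding traj_measure_def by (rule IT.PF.sets_lim)
  have coord: "(\<lambda>\<omega>. f (\<omega> t)) \<in> borel_measurable ?M" for f :: "'s \<times> 'a \<Rightarrow> real" and t
    unfolding measurable_cong_sets[OF sets refl]
    by (rule measurable_compose[where N="count_space UNIV"]) (auto intro: measurable_component_singleton)
  \<comment> \<open>For fixed \<theta> there are finitely many pairs; the bound depends on \<theta>
    and serves only pathwise convergence.\<close>
  have "finite (range (rw \<theta>))" by simp
  then obtain C where C: "\<And>x. rw \<theta> x \<le> C"
    by (metis Max_ge rangeI)
  have sm: "summable (\<lambda>t. \<gamma> ^ t * rw \<theta> (\<omega> t))" for \<omega>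
  proof (rule summable_comparison_test'[where N=0])
    show "summable (\<lambda>t. C * \<gamma> ^ t)"
      using gamma by (intro summable_mult summable_geometric) simp
    show "norm (\<gamma> ^ t * rw \<theta> (\<omega> t)) \<le> C * \<gamma> ^ t" for t
      using C[of "\<omega> t"] rw_nonneg[of \<theta> "\<omega> t"] gamma by (simp add: mult.commute[of C] mult_left_mono)
  qed
  have er: "ent_return \<gamma> lam r \<theta> \<omega> = (\<Sum>t. \<gamma> ^ t * rw \<theta> (\<omega> t))" for \<omega>
    by (simp add: ent_return_def ent_rew_def case_prod_unfold)
  have "(\<integral>\<^sup>+\<omega>. ennreal (ent_return \<gamma> lam r \<theta> \<omega>) \<partial>?M) = (\<integral>\<^sup>+\<omega>. (\<Sum>t. ennreal (\<gamma> ^ t * rw \<theta> (\<omega> t))) \<partial>?M)"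
    unfolding er using gamma rw_nonneg sm by (intro nn_integral_cong suminf_ennreal2[symmetric]) auto
  also have "\<dots> = (\<Sum>t. \<integral>\<^sup>+\<omega>. ennreal (\<gamma> ^ t * rw \<theta> (\<omega> t)) \<partial>?M)"
    using coord[of "\<lambda>x. \<gamma> ^ t * rw \<theta> x" for t] by (intro nn_integral_suminf) auto
  also have "\<dots> = (\<Sum>t. ennreal (\<gamma> ^ t * Jt \<theta> t))"
  proof (rule suminf_cong)
    fix t
    let ?f = "\<lambda>\<omega> :: ('s, 'a) traj. ennreal (\<gamma> ^ t * rw \<theta> (\<omega> t))"
    have "?f \<in> borel_measurable (PiM {0..<Suc t} (\<lambda>_. count_space UNIV))"
      by (rule measurable_compose[where N="count_space UNIV" and g="\<lambda>x. ennreal (\<gamma> ^ t * rw \<theta> x)"])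
        (auto intro: measurable_component_singleton)
    from nn_integral_traj_measure[OF this, of \<rho> P "softmax_pmf \<theta>"]
    have "(\<integral>\<^sup>+\<omega>. ?f \<omega> \<partial>?M) = (\<integral>\<^sup>+\<omega>. ?f \<omega> \<partial>traj_pmf \<rho> P (softmax_pmf \<theta>) (Suc t))"
      by (simp del: traj_pmf.simps)
    also have "\<dots> = ennreal (expect (traj_pmf \<rho> P (softmax_pmf \<theta>) (Suc t)) (\<lambda>\<omega>. \<gamma> ^ t * rw \<theta> (\<omega> t)))"
      using gamma rw_nonneg by (intro nn_integral_eq_integral integrable_finite_pmf finite_traj_pmf) auto
    also have "expect (traj_pmf \<rho> P (softmax_pmf \<theta>) (Suc t)) (\<lambda>\<omega>. \<gamma> ^ t * rw \<theta> (\<omega> t)) = \<gamma> ^ t * Jt \<theta> t"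
      unfolding rew_term_def texp_def by (rule integral_mult_right_zero)
    finally show "(\<integral>\<^sup>+\<omega>. ?f \<omega> \<partial>?M) = ennreal (\<gamma> ^ t * Jt \<theta> t)" .
  qed
  also have "\<dots> = ennreal (J \<theta>)"
    unfolding J_def using gamma rew_term_bounds(1) summable_J by (intro suminf_ennreal2) auto
  finally have nn: "(\<integral>\<^sup>+\<omega>. ennreal (ent_return \<gamma> lam r \<theta> \<omega>) \<partial>?M) = ennreal (J \<theta>)" .
  have "J_agent \<gamma> lam \<rho> P r \<theta> = enn2real (\<integral>\<^sup>+\<omega>. ennreal (ent_return \<gamma> lam r \<theta> \<omega>) \<partial>?M)"
    unfolding J_agent_def
  proof (rule integral_eq_nn_integral)
    show "ent_return \<gamma> lam r \<theta> \<in> borel_measurable ?M"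
      unfolding er[abs_def] using coord by (intro borel_measurable_suminf borel_measurable_times) auto
    show "AE \<omega> in ?M. 0 \<le> ent_return \<gamma> lam r \<theta> \<omega>"
      unfolding er using gamma rw_nonneg sm by (intro AE_I2 suminf_nonneg) auto
  qed
  then show ?thesis using nn J_bounds(1) by simp
qed

end

section \<open>One federated round\<close>

text \<open>Each logit moves by at most the norm of the difference, which changes numerator and
  normalizer each by at most one exponential factor.\<close>

lemma softmax_perturb:
  fixes \<theta> \<theta>' :: "('s::finite, 'a::finite) param"
  shows "softmax \<theta>' s a \<le> softmax \<theta> s a * exp (2 * norm (\<theta>' - \<theta>))"
proof -
  let ?d = "norm (\<theta>' - \<theta>)"
  have d: "\<bar>\<theta>' $ i - \<theta> $ i\<bar> \<le> ?d" for i
    using component_le_norm_cart[of "\<theta>' - \<theta>" i] by simp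
  let ?Z = "\<lambda>\<theta> :: ('s, 'a) param. \<Sum>b\<in>UNIV. exp (\<theta> $ (s, b))"
  have Z: "0 < ?Z \<theta>" for \<theta> by (intro sum_pos) auto
  have "?Z \<theta> * exp (- ?d) \<le> ?Z \<theta>'"
    unfolding sum_distrib_right
  proof (rule sum_mono)
    fix b show "exp (\<theta> $ (s, b)) * exp (- ?d) \<le> exp (\<theta>' $ (s, b))"
      using d[of "(s, b)"] by (simp flip: exp_add)
  qed
  moreover have "exp (\<theta>' $ (s, a)) \<le> exp (\<theta> $ (s, a)) * exp ?d"
    using d[of "(s, a)"] by (simp flip: exp_add)
  ultimately have "exp (\<theta>' $ (s, a)) / ?Z \<theta>' \<le> (exp (\<theta> $ (s, a)) * exp ?d) / (?Z \<theta> * exp (- ?d))"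
    using Z by (intro frac_le) auto
  also have "\<dots> = exp (\<theta> $ (s, a)) / ?Z \<theta> * exp (2 * ?d)"
    using Z[of \<theta>] by (simp add: exp_minus field_simps flip: exp_add)
  finally show ?thesis by (simp add: softmax_def)
qed

lemma exp_fifth_le: "exp (1 / 5 :: real) \<le> 5 / 4"
  using exp_bound[of "1 / 5 :: real"] by (simp add: power2_eq_square)

text \<open>The quantitative hypotheses are kept as inequalities: \<open>z2\<close> bounds squared
  gradient discrepancies, and \<open>gap\<close> is the property of \<open>\<tau>\<close> that makes
  the projection improve every agent.\<close>

locale fedpg =
  fixes \<rho> :: "'s::finite pmf" and P :: "nat \<Rightarrow> ('s, 'a::finite) kernel" and r :: "nat \<Rightarrow> ('s, 'a) reward"
    and M H B T :: nat and \<gamma> lam logA \<eta> \<tau> \<rho>m z2 A :: real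
    and tie :: "('s \<Rightarrow> 'a \<Rightarrow> real) \<Rightarrow> ('s \<Rightarrow> 'a) pmf"
  assumes sizes: "1 \<le> M" "1 \<le> H" "1 \<le> B" and eta: "0 < \<eta>"
    and mdp: "c \<in> {1..M} \<Longrightarrow> soft_mdp (r c) \<gamma> lam logA"
    and small: "\<eta> * real H * soft_mdp.L2 \<gamma> lam logA \<le> 1 / 74"
    and het: "c \<in> {1..M} \<Longrightarrow> c' \<in> {1..M} \<Longrightarrow>
      (norm (full_grad \<rho> (P c) (r c) \<gamma> lam \<theta> - full_grad \<rho> (P c') (r c') \<gamma> lam \<theta>))\<^sup>2 \<le> z2"
    and rho: "\<rho>m \<le> pmf \<rho> s" "0 < \<rho>m"
    and A_eq: "A = real CARD('a)"
    and tau: "0 < \<tau>" "\<tau> \<le> 1 / 10000" "\<tau> \<le> 1 / (2 * A\<^sup>2)"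
    and gap: "(1 + \<gamma> * lam * logA) / (1 - \<gamma>) + lam \<le> lam * (- ln (2 * A) - ln \<tau>)"
    and tie: "argmax_rule tie"
begin

abbreviation "Jc c \<equiv> soft_mdp.J \<rho> (P c) (r c) \<gamma> lam"
abbreviation "F c \<equiv> full_grad \<rho> (P c) (r c) \<gamma> lam"
abbreviation "f c \<equiv> trunc_grad \<rho> (P c) (r c) \<gamma> lam T"
abbreviation "L2 \<equiv> soft_mdp.L2 \<gamma> lam logA"
abbreviation "L3 \<equiv> soft_mdp.L3 \<gamma> lam logA"
abbreviation "beta \<equiv> soft_mdp.beta \<gamma> lam logA T"
abbreviation "s2 \<equiv> soft_mdp.sigma2_sq \<gamma> lam logA B"

definition avg :: "(nat \<Rightarrow> 'v::real_vector) \<Rightarrow> 'v" where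
  "avg g = (1 / real M) *\<^sub>R (\<Sum>c\<in>{1..M}. g c)"

lemma avg_const: "avg (\<lambda>_. v) = v"
  using sizes by (simp add: avg_def sum_constant_scaleR)

lemma avg_add: "avg (\<lambda>c. g c + h c) = avg g + avg h"
  and avg_diff: "avg (\<lambda>c. g c - h c) = avg g - avg h"
  and avg_scaleR: "avg (\<lambda>c. k *\<^sub>R g c) = k *\<^sub>R avg g"
  by (simp_all add: avg_def sum.distrib sum_subtractf scaleR_sum_right[symmetric] algebra_simps)

lemma avg_mono: "(\<And>c. c \<in> {1..M} \<Longrightarrow> g c \<le> h c) \<Longrightarrow> avg g \<le> avg h" for g h :: "nat \<Rightarrow> real"
  unfolding avg_def by (auto intro!: divide_right_mono sum_mono)

lemma avg_le: "(\<And>c. c \<in> {1..M} \<Longrightarrow> g c \<le> k) \<Longrightarrow> avg g \<le> k" for g :: "nat \<Rightarrow> real"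
  using avg_mono[of g "\<lambda>_. k"] by (simp add: avg_const)

lemma norm_avg_le: "(\<And>c. c \<in> {1..M} \<Longrightarrow> norm (g c) \<le> k) \<Longrightarrow> norm (avg g) \<le> k"
  for g :: "nat \<Rightarrow> 'v::real_normed_vector"
proof -
  assume "\<And>c. c \<in> {1..M} \<Longrightarrow> norm (g c) \<le> k"
  then have "norm (\<Sum>c\<in>{1..M}. g c) \<le> (\<Sum>c\<in>{1..M}. k)" by (rule sum_norm_le)
  then show ?thesis
    using sizes by (simp add: avg_def field_simps)
qed

lemma inner_avg: "v \<bullet> avg g = avg (\<lambda>c. v \<bullet> g c)"
  by (simp add: avg_def inner_sum_right)

definition "Jbar \<theta> = avg (\<lambda>c. Jc c \<theta>)"
definition "Fbar \<theta> = avg (\<lambda>c. F c \<theta>)"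
definition "Jopt = avg (\<lambda>c. SUP \<theta>. Jc c \<theta>)"
definition "law c \<theta> = local_steps \<gamma> lam \<rho> (P c) (r c) B T \<eta> \<theta> H"
text \<open>Law of the averaged iterate before projection.\<close>

definition "server \<theta> = map_pmf (\<lambda>\<phi>. avg \<phi>) (Pi_pmf {1..M} 0 (\<lambda>c. law c \<theta>))"
definition "drift \<theta> = expect (server \<theta>) (\<lambda>x. x) - \<theta>"
definition "bias = 0.53 * L3 * \<eta>\<^sup>2 * s2 * (real H - 1)"

section \<open>Averaging the agents: mean, variance and expected ascent\<close>

lemma one_in: "1 \<in> {1..M}" using sizes by simp

lemmas mdp1 = mdp[OF one_in]

lemmas L2_pos = soft_mdp.L2_pos[OF mdp1]
lemmas L3_pos = soft_mdp.L3_pos[OF mdp1]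
lemmas s2_nonneg = soft_mdp.sigma2_sq_nonneg[OF mdp1]

lemma bias_nonneg: "0 \<le> bias"
  unfolding bias_def using L3_pos s2_nonneg sizes by simp

lemma Jbar_ascent: "Jbar (\<theta> + u) \<ge> Jbar \<theta> + u \<bullet> Fbar \<theta> - L2 / 2 * (norm u)\<^sup>2"
proof -
  have "avg (\<lambda>c. Jc c \<theta> + u \<bullet> F c \<theta> - L2 / 2 * (norm u)\<^sup>2) \<le> avg (\<lambda>c. Jc c (\<theta> + u))"
    using soft_mdp.ascent[OF mdp] by (intro avg_mono) auto
  then show ?thesis
    by (simp only: avg_diff avg_add avg_const Jbar_def Fbar_def inner_avg)
qed

lemma agent_chain:
  assumes "c \<in> {1..M}"
  shows "norm (expect (law c \<theta>) (\<lambda>x. x) - \<theta> - (\<eta> * real H) *\<^sub>R f c \<theta>)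
      \<le> \<eta> * real H * (0.014 * norm (f c \<theta>) + bias)"
    and "norm (expect (law c \<theta>) (\<lambda>x. x) - \<theta>) \<le> \<eta> * real H * (1.02 * norm (f c \<theta>) + bias)"
    and "expect (law c \<theta>) (\<lambda>x. (norm (x - expect (law c \<theta>) (\<lambda>x. x)))\<^sup>2) \<le> 1.03 * \<eta>\<^sup>2 * s2 * real H"
    and "finite (set_pmf (law c \<theta>))"
proof -
  interpret A: soft_mdp \<rho> "P c" "r c" \<gamma> lam logA using mdp[OF assms] .
  interpret S: sgd_chain \<eta> "A.est_pmf B T" "A.TG T" L2 L3 s2 \<theta>
    using sizes eta by (intro A.sgd_chain_est) auto
  have H: "H \<noteq> 0" using sizes by simp
  have l: "law c \<theta> = S.X H" by (simp add: law_def A.local_steps_eq_sgd)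
  show "norm (expect (law c \<theta>) (\<lambda>x. x) - \<theta> - (\<eta> * real H) *\<^sub>R f c \<theta>) \<le> \<eta> * real H * (0.014 * norm (f c \<theta>) + bias)"
    using S.drift_error[OF small H] by (simp add: l bias_def S.xbar_def)
  show "norm (expect (law c \<theta>) (\<lambda>x. x) - \<theta>) \<le> \<eta> * real H * (1.02 * norm (f c \<theta>) + bias)"
    using S.drift_le_final[OF small H] by (simp add: l bias_def S.xbar_def)
  show "expect (law c \<theta>) (\<lambda>x. (norm (x - expect (law c \<theta>) (\<lambda>x. x)))\<^sup>2) \<le> 1.03 * \<eta>\<^sup>2 * s2 * real H"
    using S.var_le[OF small order_refl] by (simp add: l S.var_def S.xbar_def)
  show "finite (set_pmf (law c \<theta>))" unfolding l by (rule S.finite_X)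
qed

lemma finite_Pi_law: "finite (set_pmf (Pi_pmf {1..M} 0 (\<lambda>c. law c \<theta>)))"
  using agent_chain(4) by (intro finite_set_Pi_pmf) auto

lemma finite_server: "finite (set_pmf (server \<theta>))"
  unfolding server_def set_map_pmf by (intro finite_imageI finite_Pi_law)

lemma server_mean: "expect (server \<theta>) (\<lambda>x. x) = avg (\<lambda>c. expect (law c \<theta>) (\<lambda>x. x))"
  using expect_Pi_pmf_sum[of "{1..M}" "\<lambda>c. law c \<theta>" 0 "\<lambda>_ x. x"] agent_chain(4) finite_Pi_law
  by (simp add: server_def avg_def)

lemma server_variance:
  "expect (server \<theta>) (\<lambda>x. (norm (x - expect (server \<theta>) (\<lambda>x. x)))\<^sup>2) \<le> 1.03 * \<eta>\<^sup>2 * s2 * real H / real M"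
proof -
  let ?m = "\<lambda>c. expect (law c \<theta>) (\<lambda>x. x)" and ?p = "Pi_pmf {1..M} 0 (\<lambda>c. law c \<theta>)"
  have "avg \<phi> - avg ?m = (1 / real M) *\<^sub>R ((\<Sum>c\<in>{1..M}. \<phi> c) - (\<Sum>c\<in>{1..M}. ?m c))" for \<phi>
    by (simp add: avg_def scaleR_right_diff_distrib)
  then have "expect (server \<theta>) (\<lambda>x. (norm (x - expect (server \<theta>) (\<lambda>x. x)))\<^sup>2)
      = expect ?p (\<lambda>\<phi>. (1 / real M)\<^sup>2 * (norm ((\<Sum>c\<in>{1..M}. \<phi> c) - (\<Sum>c\<in>{1..M}. ?m c)))\<^sup>2)"
    unfolding server_mean by (simp only: server_def integral_map_pmf norm_scaleR power_mult_distrib power2_abs)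
  also have "\<dots> = (1 / real M)\<^sup>2 * (\<Sum>c\<in>{1..M}. expect (law c \<theta>) (\<lambda>x. (norm (x - ?m c))\<^sup>2))"
    using expect_Pi_pmf_sum[of "{1..M}" "\<lambda>c. law c \<theta>" 0 "\<lambda>_ x. x"] agent_chain(4)
    by (simp only: integral_mult_right_zero) simp
  also have "\<dots> \<le> (1 / real M)\<^sup>2 * (\<Sum>c\<in>{1..M}. 1.03 * \<eta>\<^sup>2 * s2 * real H)"
    using agent_chain(3) by (intro mult_left_mono sum_mono) auto
  also have "\<dots> = 1.03 * \<eta>\<^sup>2 * s2 * real H / real M"
    using sizes by (simp add: power2_eq_square)
  finally show ?thesis .
qed

lemma server_second_moment:
  "expect (server \<theta>) (\<lambda>x. (norm (x - \<theta>))\<^sup>2) \<le> 1.03 * \<eta>\<^sup>2 * s2 * real H / real M + (norm (drift \<theta>))\<^sup>2"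
  using server_variance[of \<theta>] by (subst expect_norm_sq_centered[OF finite_server]) (simp add: drift_def)

lemma drift_eq: "drift \<theta> = avg (\<lambda>c. expect (law c \<theta>) (\<lambda>x. x) - \<theta>)"
  by (simp add: drift_def server_mean avg_diff avg_const)

lemma z2_nonneg: "0 \<le> z2"
  using het[OF one_in one_in, of undefined] by simp

lemma F_dist: "c \<in> {1..M} \<Longrightarrow> norm (F c \<theta> - Fbar \<theta>) \<le> sqrt z2"
proof -
  assume c: "c \<in> {1..M}"
  have "norm (avg (\<lambda>c'. F c \<theta> - F c' \<theta>)) \<le> sqrt z2"
    using het[OF c, of _ \<theta>] by (intro norm_avg_le real_le_rsqrt)
  then show ?thesis by (simp add: avg_diff avg_const Fbar_def)
qed

lemma norm_f_le:
  assumes "c \<in> {1..M}"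
  shows "norm (f c \<theta>) \<le> norm (Fbar \<theta>) + sqrt z2 + beta"
proof -
  have "norm (f c \<theta>) = norm (Fbar \<theta> + (F c \<theta> - Fbar \<theta>) + (f c \<theta> - F c \<theta>))" by simp
  also have "\<dots> \<le> norm (Fbar \<theta>) + norm (F c \<theta> - Fbar \<theta>) + norm (f c \<theta> - F c \<theta>)"
    by (intro norm_triangle_le add_right_mono norm_triangle_ineq)
  also have "\<dots> \<le> norm (Fbar \<theta>) + sqrt z2 + beta"
    using F_dist[OF assms] soft_mdp.truncation_error[OF mdp[OF assms]] by (intro add_mono) auto
  finally show ?thesis .
qed

lemma drift_error: "norm (drift \<theta> - (\<eta> * real H) *\<^sub>R Fbar \<theta>)
    \<le> \<eta> * real H * (0.014 * (norm (Fbar \<theta>) + sqrt z2) + 1.014 * beta + bias)"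
proof -
  have eH: "0 \<le> \<eta> * real H" using eta by simp
  have "norm (avg (\<lambda>c. (expect (law c \<theta>) (\<lambda>x. x) - \<theta>) - (\<eta> * real H) *\<^sub>R F c \<theta>))
      \<le> \<eta> * real H * (0.014 * (norm (Fbar \<theta>) + sqrt z2) + 1.014 * beta + bias)"
  proof (rule norm_avg_le)
    fix c assume c: "c \<in> {1..M}"
    let ?m = "expect (law c \<theta>) (\<lambda>x. x)"
    have "norm (?m - \<theta> - (\<eta> * real H) *\<^sub>R F c \<theta>)
        = norm ((?m - \<theta> - (\<eta> * real H) *\<^sub>R f c \<theta>) + (\<eta> * real H) *\<^sub>R (f c \<theta> - F c \<theta>))"
      by (simp add: algebra_simps)
    also have "\<dots> \<le> \<eta> * real H * (0.014 * norm (f c \<theta>) + bias) + \<eta> * real H * beta"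
    proof (intro norm_triangle_le add_mono agent_chain(1)[OF c])
      have "(\<eta> * real H) * norm (f c \<theta> - F c \<theta>) \<le> \<eta> * real H * beta"
        using soft_mdp.truncation_error[OF mdp[OF c]] eH by (intro mult_left_mono)
      then show "norm ((\<eta> * real H) *\<^sub>R (f c \<theta> - F c \<theta>)) \<le> \<eta> * real H * beta"
        using eH by (simp only: norm_scaleR abs_of_nonneg)
    qed
    also have "\<dots> = \<eta> * real H * (0.014 * norm (f c \<theta>) + bias + beta)"
      by (simp only: distrib_left)
    also have "\<dots> \<le> \<eta> * real H * (0.014 * (norm (Fbar \<theta>) + sqrt z2) + 1.014 * beta + bias)"
      using norm_f_le[OF c, of \<theta>] eH by (intro mult_left_mono) (simp_all add: field_simps)
    finally show "norm (?m - \<theta> - (\<eta> * real H) *\<^sub>R F c \<theta>)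
        \<le> \<eta> * real H * (0.014 * (norm (Fbar \<theta>) + sqrt z2) + 1.014 * beta + bias)" .
  qed
  then show ?thesis
    by (simp only: drift_eq Fbar_def avg_diff avg_scaleR)
qed

text \<open>In the smoothness inequality the linear term sees only the mean displacement, while the
  quadratic term splits into the variance, already divided by \<open>M\<close>, and the squared
  drift.\<close>

lemma expect_Jbar_server:
  "expect (server \<theta>) Jbar \<ge> Jbar \<theta> + drift \<theta> \<bullet> Fbar \<theta>
    - L2 / 2 * (1.03 * \<eta>\<^sup>2 * s2 * real H / real M + (norm (drift \<theta>))\<^sup>2)"
proof -
  have "expect (server \<theta>) (\<lambda>x. Jbar \<theta> + (x - \<theta>) \<bullet> Fbar \<theta> - L2 / 2 * (norm (x - \<theta>))\<^sup>2) \<le> expect (server \<theta>) Jbar"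
  proof (rule expect_mono[OF finite_server])
    fix x show "Jbar \<theta> + (x - \<theta>) \<bullet> Fbar \<theta> - L2 / 2 * (norm (x - \<theta>))\<^sup>2 \<le> Jbar x"
      using Jbar_ascent[of \<theta> "x - \<theta>"] by simp
  qed
  also have "expect (server \<theta>) (\<lambda>x. Jbar \<theta> + (x - \<theta>) \<bullet> Fbar \<theta> - L2 / 2 * (norm (x - \<theta>))\<^sup>2)
      = Jbar \<theta> + drift \<theta> \<bullet> Fbar \<theta> - L2 / 2 * expect (server \<theta>) (\<lambda>x. (norm (x - \<theta>))\<^sup>2)"
    by (simp add: finite_server drift_def)
  finally show ?thesis
    using mult_left_mono[OF server_second_moment[of \<theta>], of "L2 / 2"] L2_pos by linarith
qed

text \<open>With \<open>m = k *\<^sub>R (F + q)\<close> and \<open>k * L \<le> 1\<close>, the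
  polarization identity turns the left side into half of \<open>k\<close> times the difference of
  the squared norms of \<open>F\<close> and \<open>q\<close>.\<close>

lemma ascent_arith:
  fixes m F :: "'v::real_inner"
  assumes k: "0 \<le> k" "k * L \<le> 1" and q: "norm (m - k *\<^sub>R F) \<le> k * e"
  shows "m \<bullet> F - L / 2 * (norm m)\<^sup>2 \<ge> k / 2 * ((norm F)\<^sup>2 - e\<^sup>2)"
proof (cases "k = 0")
  case True
  then show ?thesis using q by simp
next
  case False
  define q where "q = (1 / k) *\<^sub>R m - F"
  have m: "m = k *\<^sub>R (F + q)" using False by (simp add: q_def)
  have "k * norm q \<le> k * e"
    using assms(3) k unfolding m by (simp add: algebra_simps)
  then have "norm q \<le> e" using False k by simp
  then have e: "(norm q)\<^sup>2 \<le> e\<^sup>2" by (intro power_mono) auto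
  have "m \<bullet> F - L / 2 * (norm m)\<^sup>2 = k * ((F + q) \<bullet> F) - k / 2 * ((k * L) * (norm (F + q))\<^sup>2)"
  proof -
    have "m \<bullet> F = k * ((F + q) \<bullet> F)" by (simp add: m)
    moreover have "(norm m)\<^sup>2 = k\<^sup>2 * (norm (F + q))\<^sup>2"
      unfolding m norm_scaleR power_mult_distrib by simp
    ultimately show ?thesis by (simp only: power2_eq_square) simp
  qed
  also have "\<dots> \<ge> k * ((F + q) \<bullet> F) - k / 2 * (1 * (norm (F + q))\<^sup>2)"
    using k by (intro diff_left_mono mult_left_mono mult_right_mono) auto
  also have "k * ((F + q) \<bullet> F) - k / 2 * (1 * (norm (F + q))\<^sup>2) = k / 2 * ((norm F)\<^sup>2 - (norm q)\<^sup>2)"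
    unfolding power2_norm_eq_inner by (simp add: inner_add_left inner_add_right inner_commute algebra_simps)
  also have "\<dots> \<ge> k / 2 * ((norm F)\<^sup>2 - e\<^sup>2)"
    using e k by (intro mult_left_mono) auto
  finally show ?thesis .
qed

lemma cube_square_le: "(x + y + w)\<^sup>2 \<le> 3 * (x\<^sup>2 + y\<^sup>2 + w\<^sup>2)" for x y w :: real
  using sum_squares_bound[of x y] sum_squares_bound[of x w] sum_squares_bound[of y w]
  by (simp add: power2_eq_square algebra_simps)

lemma server_ascent:
  "expect (server \<theta>) Jbar \<ge> Jbar \<theta>
    + \<eta> * real H / 2 * (0.998 * (norm (Fbar \<theta>))\<^sup>2 - 0.002 * z2 - 3.1 * beta\<^sup>2 - 3 * bias\<^sup>2)
    - 0.515 * L2 * \<eta>\<^sup>2 * s2 * real H / real M"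
proof -
  let ?k = "\<eta> * real H" and ?n = "norm (Fbar \<theta>)"
  define e where "e = 0.014 * (?n + sqrt z2) + 1.014 * beta + bias"
  have "e\<^sup>2 \<le> 3 * ((0.014 * (?n + sqrt z2))\<^sup>2 + (1.014 * beta)\<^sup>2 + bias\<^sup>2)"
    unfolding e_def by (rule cube_square_le)
  also have "(0.014 * (?n + sqrt z2))\<^sup>2 \<le> 0.000196 * (2 * ?n\<^sup>2 + 2 * z2)"
  proof -
    have sq: "(0.014 * y)\<^sup>2 = 0.000196 * y\<^sup>2" for y :: real by (simp add: power2_eq_square)
    have "(?n + sqrt z2)\<^sup>2 \<le> 2 * ?n\<^sup>2 + 2 * z2"
      using square_sum_le[of ?n "sqrt z2"] z2_nonneg by simp
    then show ?thesis unfolding sq by (rule mult_left_mono) simp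
  qed
  finally have e0: "e\<^sup>2 \<le> 3 * (0.000196 * (2 * ?n\<^sup>2 + 2 * z2) + (1.014 * beta)\<^sup>2 + bias\<^sup>2)"
    by simp
  have e: "e\<^sup>2 \<le> 0.002 * ?n\<^sup>2 + 0.002 * z2 + 3.1 * beta\<^sup>2 + 3 * bias\<^sup>2"
  proof -
    have "e2 \<le> 0.002 * n2 + 0.002 * z2 + 3.1 * b2 + 3 * i2"
      if "e2 \<le> 3 * (0.000196 * (2 * n2 + 2 * z2) + 1.028196 * b2 + i2)" "0 \<le> n2" "0 \<le> b2"
      for e2 n2 b2 i2 :: real
      using that z2_nonneg by (simp add: field_simps)
    moreover have "(1.014 * beta)\<^sup>2 = 1.028196 * beta\<^sup>2" by (simp add: power2_eq_square)
    ultimately show ?thesis using e0 by (simp only: zero_le_power2)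
  qed
  have "?k / 2 * (?n\<^sup>2 - e\<^sup>2) \<le> drift \<theta> \<bullet> Fbar \<theta> - L2 / 2 * (norm (drift \<theta>))\<^sup>2"
    unfolding e_def by (rule ascent_arith[OF _ _ drift_error]) (use eta small in auto)
  moreover have "?k / 2 * (0.998 * ?n\<^sup>2 - 0.002 * z2 - 3.1 * beta\<^sup>2 - 3 * bias\<^sup>2) \<le> ?k / 2 * (?n\<^sup>2 - e\<^sup>2)"
    using e eta by (intro mult_left_mono) auto
  moreover have "L2 / 2 * (1.03 * \<eta>\<^sup>2 * s2 * real H / real M + (norm (drift \<theta>))\<^sup>2)
      = 0.515 * L2 * \<eta>\<^sup>2 * s2 * real H / real M + L2 / 2 * (norm (drift \<theta>))\<^sup>2"
    by (simp add: distrib_left)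
  ultimately show ?thesis
    using expect_Jbar_server[of \<theta>] by linarith
qed

end

text \<open>Here \<open>n\<close> is the squared gradient norm, \<open>z\<close> the heterogeneity,
  \<open>b\<close> the squared truncation error, \<open>i\<close> the squared bias, and
  \<open>a\<close>, \<open>d\<close> the two sampling terms;
  \<open>13824 = 8 * 12 ^ 3\<close>.\<close>

lemma noise_arith:
  fixes a b d i n z :: real
  assumes "0 \<le> a" "0 \<le> d" "0 \<le> z" "0 \<le> b" "i \<le> 0.3 * d"
  shows "0.998 * (n + z) - (3 * a + 2 * z + 4 * b + 13824 * d)
    \<le> 0.998 * n - 0.002 * z - 3.1 * b - 3 * i - 1.03 * a"
  using assms by (simp add: field_simps)

lemma pl_slack: "1.28 * x \<le> y \<Longrightarrow> 0 \<le> x \<Longrightarrow> x \<le> 0.998 * y" for x y :: real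
  by (simp add: field_simps)

context fedpg
begin

section \<open>Contraction of the server average from a regular point\<close>

definition "mu = lam * (1 - \<gamma>) * \<rho>m\<^sup>2 * \<tau>\<^sup>2 / real CARD('s)"

lemma bdd_J: "c \<in> {1..M} \<Longrightarrow> bdd_above (range (Jc c))"
  using soft_mdp.J_bounds(2)[OF mdp] by (intro bdd_aboveI2) auto

lemma Jbar_le_Jopt: "Jbar \<theta> \<le> Jopt"
  unfolding Jbar_def Jopt_def by (intro avg_mono cSUP_upper bdd_J) auto

lemma Jopt_gap_le: "Jopt - Jbar \<theta> \<le> (1 + lam * logA) / (1 - \<gamma>)"
proof -
  have "Jopt \<le> (1 + lam * logA) / (1 - \<gamma>)"
    unfolding Jopt_def using soft_mdp.J_bounds(2)[OF mdp] by (intro avg_le cSUP_least) auto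
  moreover have "avg (\<lambda>_. 0) \<le> Jbar \<theta>"
    unfolding Jbar_def using soft_mdp.J_bounds(1)[OF mdp] by (intro avg_mono) auto
  ultimately show ?thesis by (simp add: avg_const)
qed

text \<open>Deviations of the agents' gradients from their average sum to zero, so the linear term
  of the expansion disappears.\<close>

lemma avg_norm_sq_F: "avg (\<lambda>c. (norm (F c \<theta>))\<^sup>2) \<le> (norm (Fbar \<theta>))\<^sup>2 + z2"
proof -
  have "avg (\<lambda>c. (norm (F c \<theta>))\<^sup>2)
      \<le> avg (\<lambda>c. (norm (Fbar \<theta>))\<^sup>2 + (2 *\<^sub>R Fbar \<theta>) \<bullet> (F c \<theta> - Fbar \<theta>) + z2)"
  proof (rule avg_mono)
    fix c assume c: "c \<in> {1..M}"
    have "(norm (F c \<theta> - Fbar \<theta>))\<^sup>2 \<le> (sqrt z2)\<^sup>2"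
      using F_dist[OF c] by (intro power_mono) auto
    then show "(norm (F c \<theta>))\<^sup>2 \<le> (norm (Fbar \<theta>))\<^sup>2 + (2 *\<^sub>R Fbar \<theta>) \<bullet> (F c \<theta> - Fbar \<theta>) + z2"
      using z2_nonneg unfolding power2_norm_eq_inner
      by (simp add: inner_diff_left inner_diff_right inner_commute)
  qed
  also have "\<dots> = (norm (Fbar \<theta>))\<^sup>2 + (2 *\<^sub>R Fbar \<theta>) \<bullet> avg (\<lambda>c. F c \<theta> - Fbar \<theta>) + z2"
    by (simp only: avg_add avg_const inner_avg)
  also have "avg (\<lambda>c. F c \<theta> - Fbar \<theta>) = 0"
    by (simp add: avg_diff avg_const Fbar_def)
  finally show ?thesis by simp
qed

lemmas mdp_facts = soft_mdp.gamma[OF mdp1] soft_mdp.lam[OF mdp1] soft_mdp.logA_ge[OF mdp1]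

lemma mu_pos: "0 < mu"
  unfolding mu_def using mdp_facts tau rho by simp

text \<open>\<open>Jopt\<close> averages separate suprema, so each agent is compared with its own
  supremum at floor \<open>0.4 * \<tau>\<close>; averaging the squared gradients brings in
  \<open>z2\<close>.\<close>

lemma averaged_lojasiewicz:
  assumes "\<And>s a. 0.4 * \<tau> \<le> softmax \<theta> s a"
  shows "1.28 * mu * (Jopt - Jbar \<theta>) \<le> (norm (Fbar \<theta>))\<^sup>2 + z2"
proof -
  define K where "K = 8 * (0.4 * \<tau>)\<^sup>2 * lam * (1 - \<gamma>) * \<rho>m\<^sup>2"
  have K: "0 < K" unfolding K_def using mdp_facts tau rho by simp
  have "avg (\<lambda>c. K *\<^sub>R ((SUP \<theta>. Jc c \<theta>) - Jc c \<theta>)) \<le> avg (\<lambda>c. (norm (F c \<theta>))\<^sup>2)"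
  proof (rule avg_mono)
    fix c assume c: "c \<in> {1..M}"
    have "(SUP \<theta>. Jc c \<theta>) \<le> Jc c \<theta> + (norm (F c \<theta>))\<^sup>2 / K"
    proof (rule cSUP_least)
      fix \<theta>'
      have "K * (Jc c \<theta>' - Jc c \<theta>) \<le> (norm (F c \<theta>))\<^sup>2"
        unfolding K_def using tau assms
        by (intro soft_mdp.lojasiewicz[OF mdp[OF c]] rho) auto
      then show "Jc c \<theta>' \<le> Jc c \<theta> + (norm (F c \<theta>))\<^sup>2 / K"
        using K by (simp add: field_simps)
    qed simp
    then show "K *\<^sub>R ((SUP \<theta>. Jc c \<theta>) - Jc c \<theta>) \<le> (norm (F c \<theta>))\<^sup>2"
      using K by (simp add: field_simps)
  qed
  then have "K * (Jopt - Jbar \<theta>) \<le> (norm (Fbar \<theta>))\<^sup>2 + z2"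
    using avg_norm_sq_F[of \<theta>] by (simp only: avg_scaleR avg_diff Jopt_def Jbar_def) simp
  moreover have "1.28 * mu \<le> K"
  proof -
    have "K = 1.28 * (lam * (1 - \<gamma>) * \<rho>m\<^sup>2 * \<tau>\<^sup>2)"
      by (simp add: K_def power2_eq_square)
    moreover have "mu \<le> lam * (1 - \<gamma>) * \<rho>m\<^sup>2 * \<tau>\<^sup>2 / 1"
      unfolding mu_def using mdp_facts by (intro divide_left_mono) auto
    ultimately show ?thesis by simp
  qed
  ultimately show ?thesis
    using mult_right_mono[of "1.28 * mu" K "Jopt - Jbar \<theta>"] Jbar_le_Jopt[of \<theta>] by linarith
qed

definition "noise s4 = 3 * \<eta> * L2 * s2 / real M + 2 * z2 + 4 * beta\<^sup>2
  + 8 * 12 ^ 3 * \<eta> ^ 4 * L3\<^sup>2 * real H * (real H - 1) * s4"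

text \<open>The fourth-moment level enters through \<open>s2\<^sup>2 \<le> s4\<close>; the remaining
  slack is \<open>0.53\<^sup>2 \<le> 0.3\<close> and
  \<open>(H - 1)\<^sup>2 \<le> H * (H - 1)\<close>.\<close>

lemma bias_sq_le:
  assumes "s2\<^sup>2 \<le> s4"
  shows "bias\<^sup>2 \<le> 0.3 * (\<eta> ^ 4 * L3\<^sup>2 * real H * (real H - 1) * s4)"
proof -
  have "bias\<^sup>2 = 0.2809 * (\<eta> ^ 4 * L3\<^sup>2) * (((real H - 1) * (real H - 1)) * s2\<^sup>2)"
    by (simp add: bias_def power2_eq_square eval_nat_numeral)
  also have "\<dots> \<le> 0.2809 * (\<eta> ^ 4 * L3\<^sup>2) * ((real H * (real H - 1)) * s4)"
    using sizes assms by (intro mult_left_mono mult_mono mult_right_mono) auto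
  also have "\<dots> \<le> 0.3 * (\<eta> ^ 4 * L3\<^sup>2) * ((real H * (real H - 1)) * s4)"
    using sizes order_trans[OF zero_le_power2 assms] by (intro mult_right_mono) auto
  finally show ?thesis by (simp add: mult_ac)
qed

context
  fixes s4 :: real
  assumes s4: "s2\<^sup>2 \<le> s4"
begin

abbreviation "k \<equiv> \<eta> * real H"

lemma noise_parts:
  "0 \<le> \<eta> * L2 * s2 / real M" "0 \<le> \<eta> ^ 4 * L3\<^sup>2 * real H * (real H - 1) * s4"
  using eta L2_pos s2_nonneg sizes order_trans[OF zero_le_power2 s4] by auto

lemma noise_eq: "noise s4 = 3 * (\<eta> * L2 * s2 / real M) + 2 * z2 + 4 * beta\<^sup>2
    + 13824 * (\<eta> ^ 4 * L3\<^sup>2 * real H * (real H - 1) * s4)"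
  by (simp add: noise_def)

lemma noise_nonneg: "0 \<le> noise s4"
  unfolding noise_eq using noise_parts z2_nonneg zero_le_power2[of beta] by linarith

lemma server_ascent':
  "expect (server \<theta>) Jbar \<ge> Jbar \<theta> + k / 2 * (0.998 * ((norm (Fbar \<theta>))\<^sup>2 + z2) - noise s4)"
proof -
  let ?n = "(norm (Fbar \<theta>))\<^sup>2"
  have eq: "0.515 * L2 * \<eta>\<^sup>2 * s2 * real H / real M = k / 2 * (1.03 * (\<eta> * L2 * s2 / real M))"
    by (simp add: power2_eq_square)
  have "0.998 * (?n + z2) - noise s4 \<le>
      0.998 * ?n - 0.002 * z2 - 3.1 * beta\<^sup>2 - 3 * bias\<^sup>2 - 1.03 * (\<eta> * L2 * s2 / real M)"
    unfolding noise_eq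
    using noise_parts z2_nonneg bias_sq_le[OF s4] by (intro noise_arith) auto
  then have "k / 2 * (0.998 * (?n + z2) - noise s4) \<le>
      k / 2 * (0.998 * ?n - 0.002 * z2 - 3.1 * beta\<^sup>2 - 3 * bias\<^sup>2 - 1.03 * (\<eta> * L2 * s2 / real M))"
    using eta by (intro mult_left_mono) auto
  then show ?thesis
    using server_ascent[of \<theta>] unfolding eq by (simp only: right_diff_distrib)
qed

lemma server_ascent_regular:
  assumes "\<And>s a. 0.4 * \<tau> \<le> softmax \<theta> s a"
  shows "Jopt - expect (server \<theta>) Jbar \<le> (1 - k * mu / 2) * (Jopt - Jbar \<theta>) + k / 2 * noise s4"
proof -
  have "mu * (Jopt - Jbar \<theta>) \<le> 0.998 * ((norm (Fbar \<theta>))\<^sup>2 + z2)"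
    using averaged_lojasiewicz[OF assms] mult_nonneg_nonneg[of mu "Jopt - Jbar \<theta>"] mu_pos Jbar_le_Jopt[of \<theta>]
    by (intro pl_slack) (auto simp: mult.assoc)
  then have "k / 2 * (mu * (Jopt - Jbar \<theta>) - noise s4) \<le> k / 2 * (0.998 * ((norm (Fbar \<theta>))\<^sup>2 + z2) - noise s4)"
    using eta by (intro mult_left_mono) auto
  with server_ascent'[of \<theta>]
  have "Jbar \<theta> + k / 2 * (mu * (Jopt - Jbar \<theta>) - noise s4) \<le> expect (server \<theta>) Jbar"
    by (meson add_left_mono order_trans)
  then show ?thesis by (simp add: algebra_simps)
qed

text \<open>Away from the floor the gradient may be small at a large gap, so the gradient term is
  merely discarded and a loss of one noise share remains.\<close>

lemma server_ascent_any: "expect (server \<theta>) Jbar \<ge> Jbar \<theta> - k / 2 * noise s4"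
proof -
  have "k / 2 * (0 - noise s4) \<le> k / 2 * (0.998 * ((norm (Fbar \<theta>))\<^sup>2 + z2) - noise s4)"
    using eta z2_nonneg by (intro mult_left_mono) auto
  then show ?thesis
    using server_ascent'[of \<theta>] by (simp only: diff_0 mult_minus_right)
qed

end

section \<open>Projection of the server average\<close>

lemma projection_setup_tie:
  assumes "amax \<in> set_pmf (tie (softmax \<theta>))"
  shows "projection_setup \<theta> amax \<tau> A"
  using assms tie A_eq tau by unfold_locales (auto simp: argmax_rule_def)

lemma Jbar_proj:
  assumes "amax \<in> set_pmf (tie (softmax \<theta>))"
  shows "Jbar (proj_param \<tau> amax \<theta>) \<ge> Jbar \<theta>"
    and "softmax \<theta> s a \<le> \<tau> / 2 \<Longrightarrow> Jbar (proj_param \<tau> amax \<theta>) \<ge> Jbar \<theta> + \<rho>m * (lam * \<tau> / 2)"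
proof -
  note imp = soft_mdp.projection_improves[OF mdp projection_setup_tie[OF assms] gap]
  show "Jbar (proj_param \<tau> amax \<theta>) \<ge> Jbar \<theta>"
    unfolding Jbar_def using imp(1) by (intro avg_mono)
  assume low: "softmax \<theta> s a \<le> \<tau> / 2"
  have "avg (\<lambda>c. Jc c \<theta> + \<rho>m * (lam * \<tau> / 2)) \<le> avg (\<lambda>c. Jc c (proj_param \<tau> amax \<theta>))"
  proof (rule avg_mono)
    fix c assume c: "c \<in> {1..M}"
    have "\<rho>m * (lam * \<tau> / 2) \<le> pmf \<rho> s * (lam * \<tau> / 2)"
      using rho mdp_facts tau by (intro mult_right_mono) auto
    then show "Jc c \<theta> + \<rho>m * (lam * \<tau> / 2) \<le> Jc c (proj_param \<tau> amax \<theta>)"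
      using imp(2)[OF c low, where \<rho>=\<rho> and P="P c"] by linarith
  qed
  then show "Jbar (proj_param \<tau> amax \<theta>) \<ge> Jbar \<theta> + \<rho>m * (lam * \<tau> / 2)"
    by (simp only: avg_add avg_const Jbar_def)
qed

lemma proj_floor:
  assumes "amax \<in> set_pmf (tie (softmax \<theta>))"
  shows "\<tau> / 2 \<le> softmax (proj_param \<tau> amax \<theta>) s a"
  using projection_setup.proj_policy_floor[OF projection_setup_tie[OF assms]]
    projection_setup.softmax_proj_param[OF projection_setup_tie[OF assms]] by simp

abbreviation "fround \<theta> \<equiv> fed_round M \<gamma> lam \<rho> P r H B T \<eta> \<tau> tie \<theta>"

lemma fround_eq: "fround \<theta> = server \<theta> \<bind> (\<lambda>x. map_pmf (\<lambda>amax. proj_param \<tau> amax x) (tie (softmax x)))"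
  unfolding fed_round_def server_def law_def avg_def Let_def
  by (simp add: map_pmf_def bind_assoc_pmf bind_return_pmf)

lemma finite_fround: "finite (set_pmf (fround \<theta>))"
  unfolding fround_eq by (auto simp: finite_server)

lemma expect_fround_ge:
  assumes "\<And>x amax. amax \<in> set_pmf (tie (softmax x)) \<Longrightarrow> g x \<le> Jbar (proj_param \<tau> amax x)"
  shows "expect (server \<theta>) g \<le> expect (fround \<theta>) Jbar"
proof -
  have "expect (fround \<theta>) Jbar = expect (server \<theta>) (\<lambda>x. expect (tie (softmax x)) (\<lambda>amax. Jbar (proj_param \<tau> amax x)))"
    unfolding fround_eq by (subst expect_bind) (auto simp: finite_server)
  also have "\<dots> \<ge> expect (server \<theta>) g"
    using assms by (intro expect_mono[OF finite_server] expect_ge_const) auto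
  finally show ?thesis .
qed

lemma fround_floor: "\<theta>' \<in> set_pmf (fround \<theta>) \<Longrightarrow> \<tau> / 2 \<le> softmax \<theta>' s a"
  using proj_floor by (auto simp: fround_eq)

end

context fedpg
begin

section \<open>A round from an arbitrary parameter\<close>

lemma L2_ge: "8 * ((1 + lam * logA) / (1 - \<gamma>) ^ 3) \<le> L2" "4 * lam \<le> L2"
proof -
  have L: "L2 = 8 * ((1 + lam * logA) / (1 - \<gamma>) ^ 3) + 4 * lam / (1 - \<gamma>) ^ 3"
    by (simp add: soft_mdp.L2_def[OF mdp1] algebra_simps add_divide_distrib)
  have R: "0 \<le> (1 + lam * logA) / (1 - \<gamma>) ^ 3"
    using mdp_facts soft_mdp.Rmax_ge_1[OF mdp1] by (intro divide_nonneg_nonneg) auto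
  have l: "4 * lam \<le> 4 * lam / (1 - \<gamma>) ^ 3"
    using mdp_facts by (simp add: pos_le_divide_eq power_le_one mult_left_le)
  show "8 * ((1 + lam * logA) / (1 - \<gamma>) ^ 3) \<le> L2"
    unfolding L using l mdp_facts(3) by linarith
  show "4 * lam \<le> L2"
    unfolding L using l R by linarith
qed

text \<open>Both quantities are dominated by fractions of \<open>L2\<close>, hence controlled by the
  step-size condition: \<open>592 = 8 * 74\<close> and \<open>296 = 4 * 74\<close>.\<close>

lemma step_bounds:
  assumes "j \<le> 3"
  shows "k * ((1 + lam * logA) / (1 - \<gamma>) ^ j) \<le> 1 / 592" "k * lam \<le> 1 / 296"
proof -
  have "k * ((1 + lam * logA) / (1 - \<gamma>) ^ j) \<le> k * (L2 / 8)"
  proof (rule mult_left_mono)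
    have "(1 + lam * logA) / (1 - \<gamma>) ^ j \<le> (1 + lam * logA) / (1 - \<gamma>) ^ 3"
      using mdp_facts assms soft_mdp.Rmax_ge_1[OF mdp1]
      by (intro divide_left_mono power_decreasing) auto
    then show "(1 + lam * logA) / (1 - \<gamma>) ^ j \<le> L2 / 8" using L2_ge(1) by linarith
  qed (use eta in simp)
  moreover have "k * (L2 / 8) = k * L2 / 8" by simp
  ultimately show "k * ((1 + lam * logA) / (1 - \<gamma>) ^ j) \<le> 1 / 592" using small by linarith
  have "k * (4 * lam) \<le> k * L2" using L2_ge(2) eta by (intro mult_left_mono) auto
  then show "k * lam \<le> 1 / 296" using small by simp
qed

text \<open>Guaranteed improvement by the projection once some action has probability at most
  \<open>\<tau> / 2\<close>.\<close>

definition "gain = \<rho>m * (lam * \<tau> / 2)"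

lemma rho_le_1: "\<rho>m \<le> 1"
  using rho(1)[of undefined] pmf_le_1[of \<rho> undefined] by linarith

lemma gain_bounds: "0 < gain" "gain \<le> lam" "mu \<le> 2 * gain" "mu \<le> lam"
proof -
  show "0 < gain" unfolding gain_def using rho mdp_facts tau by simp
  have "\<rho>m * (lam * \<tau> / 2) \<le> 1 * (lam * 1)"
    using rho rho_le_1 mdp_facts tau by (intro mult_mono) auto
  then show g: "gain \<le> lam" by (simp add: gain_def)
  have "mu \<le> lam * (1 - \<gamma>) * \<rho>m\<^sup>2 * \<tau>\<^sup>2 / 1"
    unfolding mu_def using mdp_facts by (intro divide_left_mono) auto
  also have "\<dots> = lam * (\<rho>m * \<tau>) * ((1 - \<gamma>) * (\<rho>m * \<tau>))"
    by (simp add: power2_eq_square)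
  also have "\<dots> \<le> lam * (\<rho>m * \<tau>) * (1 * (1 * 1))"
    using rho rho_le_1 mdp_facts tau by (intro mult_left_mono mult_mono) auto
  finally show m: "mu \<le> 2 * gain" by (simp add: gain_def mult_ac)
  have "lam * (\<rho>m * \<tau>) \<le> lam * (1 * 1)"
    using rho rho_le_1 mdp_facts tau by (intro mult_left_mono mult_mono) auto
  then show "mu \<le> lam" using m by (simp add: gain_def mult_ac)
qed

lemma k_mu_le: "k * mu \<le> 1 / 296"
proof -
  have "k * mu \<le> k * lam" using gain_bounds(4) eta by (intro mult_left_mono) auto
  then show ?thesis using step_bounds(2)[of 0] by simp
qed

text \<open>The gradient is bounded uniformly in \<theta>, and the step size is inversely
  proportional to a larger constant, so apart from the bias the mean moves by a small absolute
  amount.\<close>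

lemma drift_sq_le: "(norm (drift \<theta>))\<^sup>2 \<le> 0.00002 + 2 * k\<^sup>2 * bias\<^sup>2"
proof -
  have "norm (drift \<theta>) \<le> 0.003 + k * bias"
    unfolding drift_eq
  proof (rule norm_avg_le)
    fix c assume c: "c \<in> {1..M}"
    define X where "X = (1 + lam * logA) / (1 - \<gamma>)\<^sup>2"
    have "norm (f c \<theta>) \<le> 3 / 2 * X"
    proof -
      have "norm (f c \<theta>) \<le> sqrt 2 * X"
        using soft_mdp.norm_TG[OF mdp[OF c], of \<rho> "P c" T \<theta>] by (simp add: X_def)
      also have "\<dots> \<le> 3 / 2 * X"
        using sqrt2_le soft_mdp.Rmax_ge_1[OF mdp1] by (intro mult_right_mono) (auto simp: X_def)
      finally show ?thesis .
    qed
    then have "k * norm (f c \<theta>) \<le> k * (3 / 2 * X)" using eta by (intro mult_left_mono) auto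
    moreover have "k * X \<le> 1 / 592" unfolding X_def by (rule step_bounds) simp
    ultimately have "k * norm (f c \<theta>) \<le> 3 / 1184" by simp
    moreover have "norm (expect (law c \<theta>) (\<lambda>x. x) - \<theta>) \<le> 1.02 * (k * norm (f c \<theta>)) + k * bias"
      using agent_chain(2)[OF c, of \<theta>] by (simp add: algebra_simps)
    ultimately show "norm (expect (law c \<theta>) (\<lambda>x. x) - \<theta>) \<le> 0.003 + k * bias" by simp
  qed
  then have "(norm (drift \<theta>))\<^sup>2 \<le> (0.003 + k * bias)\<^sup>2" by (intro power_mono) auto
  also have "\<dots> \<le> 2 * 0.003\<^sup>2 + 2 * (k * bias)\<^sup>2" by (rule square_sum_le)
  also have "\<dots> \<le> 0.00002 + 2 * (k * bias)\<^sup>2" by (simp add: power2_eq_square)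
  finally have "(norm (drift \<theta>))\<^sup>2 \<le> 0.00002 + 2 * (k * bias)\<^sup>2" .
  then show ?thesis unfolding power_mult_distrib[of k bias] by (simp only: mult.assoc)
qed

context
  fixes s4 :: real
  assumes s4: "s2\<^sup>2 \<le> s4"
begin

text \<open>Measures every deviation in units of \<open>noise s4 / mu\<close>. The factor
  \<open>k * mu \<le> 1 / 296\<close> makes each a small fraction.\<close>

lemma noise_ratio:
  "k / 2 * noise s4 \<le> (noise s4 / mu) / 592"
  "gain * (k\<^sup>2 * bias\<^sup>2) \<le> (noise s4 / mu) / 1000"
  "gain * (\<eta>\<^sup>2 * s2 * real H / real M) \<le> (noise s4 / mu) / 800"
proof -
  define y a d where "y = noise s4 / mu" and "a = \<eta> * L2 * s2 / real M"
    and "d = \<eta> ^ 4 * L3\<^sup>2 * real H * (real H - 1) * s4"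
  have y: "0 \<le> y" unfolding y_def using noise_nonneg[OF s4] mu_pos by simp
  have n: "noise s4 = mu * y" unfolding y_def using mu_pos by simp
  have parts: "0 \<le> a" "0 \<le> d" using noise_parts[OF s4] by (simp_all add: a_def d_def)
  have ad: "3 * a \<le> mu * y" "13824 * d \<le> mu * y"
    using noise_eq[OF s4] parts z2_nonneg zero_le_power2[of beta]
    unfolding n a_def[symmetric] d_def[symmetric] by linarith+
  have k0: "0 \<le> k" using eta by simp
  have km: "k * mu * y \<le> 1 / 296 * y" using k_mu_le y by (intro mult_right_mono)
  show "k / 2 * noise s4 \<le> y / 592" using km y by (simp add: n mult_ac)
  have gk: "gain * k \<le> 1 / 296"
    using mult_right_mono[OF gain_bounds(2) k0] step_bounds(2)[of 0] by (simp add: mult.commute)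
  have "gain * (k\<^sup>2 * bias\<^sup>2) \<le> gain * (k\<^sup>2 * (0.3 * d))"
    using bias_sq_le[OF s4] gain_bounds(1) by (intro mult_left_mono) (auto simp: d_def)
  also have "\<dots> = 0.3 * ((gain * k) * (k * d))" by (simp add: power2_eq_square)
  also have "\<dots> \<le> 0.3 * (1 / 296 * (k * (mu * y)))"
    using gk ad parts k0 gain_bounds(1) by (intro mult_left_mono mult_mono) auto
  also have "\<dots> \<le> 0.3 * (1 / 296 * (1 / 296 * y))"
    using km by (intro mult_left_mono) (auto simp: mult.assoc)
  also have "\<dots> \<le> y / 1000" using y by simp
  finally show "gain * (k\<^sup>2 * bias\<^sup>2) \<le> y / 1000" .
  have "gain * (\<eta>\<^sup>2 * s2 * real H / real M) = (gain / L2) * (k * a)"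
    using L2_pos by (simp add: a_def power2_eq_square)
  also have "\<dots> \<le> (1 / 4) * (k * (mu * y / 3))"
  proof (intro mult_mono mult_left_mono)
    have "4 * gain \<le> L2" using gain_bounds(2) L2_ge(2) by linarith
    then show "gain / L2 \<le> 1 / 4" using L2_pos by (simp add: field_simps)
  qed (use ad parts k0 eta in auto)
  also have "\<dots> = (k * mu * y) / 12" by simp
  also have "\<dots> \<le> y / 800" using km y by linarith
  finally show "gain * (\<eta>\<^sup>2 * s2 * real H / real M) \<le> y / 800" .
qed

lemma fround_regular:
  assumes "\<And>s a. 0.4 * \<tau> \<le> softmax \<theta> s a"
  shows "Jopt - expect (fround \<theta>) Jbar \<le> (1 - k * mu / 2) * (Jopt - Jbar \<theta>) + k / 2 * noise s4"
  using server_ascent_regular[OF s4 assms] expect_fround_ge[OF Jbar_proj(1), of \<theta>] by linarith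

text \<open>An arbitrary initial parameter may violate the floor needed for the Lojasiewicz inequality. Then a
  rare action stays rare while the server iterate is within \<open>1 / 10\<close>, as \<open>0.4 * exp (1 / 5) \<le> 1 / 2\<close>, and its
  projection gains \<open>gain\<close>, which exceeds the contraction required of one round; the deviations are absorbed
  by the full noise level.\<close>

lemma fround_irregular:
  assumes low: "softmax \<theta> s a \<le> 0.4 * \<tau>"
  shows "Jopt - expect (fround \<theta>) Jbar \<le> (1 - k * mu / 2) * (Jopt - Jbar \<theta>) + noise s4 / mu"
proof -
  \<comment> \<open>A quadratic penalty in place of a tail estimate: at distance
    \<open>1 / 10\<close> the factor \<open>100\<close> cancels the whole gain, so \<open>g\<close>
    is a lower bound both near \<theta> and far from it.\<close>
  define g where "g x = Jbar x + gain * (1 - 100 * (norm (x - \<theta>))\<^sup>2)" for x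
  have "g x \<le> Jbar (proj_param \<tau> amax x)" if amax: "amax \<in> set_pmf (tie (softmax x))" for x amax
  proof (cases "norm (x - \<theta>) \<le> 1 / 10")
    case True
    have "softmax x s a \<le> softmax \<theta> s a * exp (2 * norm (x - \<theta>))" by (rule softmax_perturb)
    also have "\<dots> \<le> 0.4 * \<tau> * exp (1 / 5)"
      using True low tau by (intro mult_mono) (auto simp: softmax_nonneg)
    also have "\<dots> \<le> 0.4 * \<tau> * (5 / 4)"
      using exp_fifth_le tau by (intro mult_left_mono) auto
    finally have "softmax x s a \<le> \<tau> / 2" by simp
    from Jbar_proj(2)[OF amax this] have "Jbar x + gain \<le> Jbar (proj_param \<tau> amax x)"
      by (simp add: gain_def)
    moreover have "gain * (1 - 100 * (norm (x - \<theta>))\<^sup>2) \<le> gain * 1"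
      using gain_bounds(1) by (intro mult_left_mono) auto
    ultimately show ?thesis by (simp add: g_def)
  next
    case False
    then have "(1 / 10)\<^sup>2 \<le> (norm (x - \<theta>))\<^sup>2" by (intro power_mono) auto
    then have "gain * (1 - 100 * (norm (x - \<theta>))\<^sup>2) \<le> 0"
      using gain_bounds(1) by (intro mult_nonneg_nonpos) (auto simp: power2_eq_square)
    then show ?thesis using Jbar_proj(1)[OF amax] by (simp add: g_def)
  qed
  from expect_fround_ge[OF this] have 1: "expect (server \<theta>) g \<le> expect (fround \<theta>) Jbar" .
  define y where "y = noise s4 / mu"
  define e2 where "e2 = expect (server \<theta>) (\<lambda>x. (norm (x - \<theta>))\<^sup>2)"
  have 2: "expect (server \<theta>) g = expect (server \<theta>) Jbar + gain * (1 - 100 * e2)"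
    unfolding g_def e2_def by (simp add: finite_server)
  have "e2 \<le> 1.03 * (\<eta>\<^sup>2 * s2 * real H / real M) + (0.00002 + 2 * (k\<^sup>2 * bias\<^sup>2))"
    using server_second_moment[of \<theta>] drift_sq_le[of \<theta>] unfolding e2_def by (simp add: mult.assoc)
  then have "gain * e2 \<le> gain * (1.03 * (\<eta>\<^sup>2 * s2 * real H / real M) + (0.00002 + 2 * (k\<^sup>2 * bias\<^sup>2)))"
    using gain_bounds(1) by (intro mult_left_mono) auto
  also have "\<dots> = 1.03 * (gain * (\<eta>\<^sup>2 * s2 * real H / real M)) + 0.00002 * gain + 2 * (gain * (k\<^sup>2 * bias\<^sup>2))"
    by (simp add: algebra_simps)
  also have "\<dots> \<le> 1.03 * (y / 800) + 0.00002 * gain + 2 * (y / 1000)"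
    using noise_ratio(2,3) by (intro add_mono mult_left_mono) (auto simp: y_def)
  finally have ge: "gain * e2 \<le> 1.03 * (y / 800) + 0.00002 * gain + 2 * (y / 1000)" .
  have y: "0 \<le> y" unfolding y_def using noise_nonneg[OF s4] mu_pos by simp
  \<comment> \<open>The decrease demanded by the contraction is a small fraction of
    \<open>gain\<close>, because the gap is bounded and \<open>mu \<le> 2 * gain\<close>.\<close>
  have 3: "k * mu / 2 * (Jopt - Jbar \<theta>) \<le> gain / 592"
  proof -
    have "k * mu / 2 * (Jopt - Jbar \<theta>) \<le> k * mu / 2 * ((1 + lam * logA) / (1 - \<gamma>))"
      using Jopt_gap_le eta mu_pos by (intro mult_left_mono) auto
    also have "\<dots> = mu / 2 * (k * ((1 + lam * logA) / (1 - \<gamma>) ^ 1))" by simp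
    also have "\<dots> \<le> mu / 2 * (1 / 592)"
      using mu_pos by (intro mult_left_mono step_bounds) auto
    also have "\<dots> \<le> gain / 592" using gain_bounds(3) by simp
    finally show ?thesis .
  qed
  have 4: "Jbar \<theta> - y / 592 \<le> expect (server \<theta>) Jbar"
    using server_ascent_any[OF s4, of \<theta>] noise_ratio(1) unfolding y_def by linarith
  have "gain / 592 + y / 592 + 100 * (gain * e2) \<le> gain + y"
    using ge y gain_bounds(1) by (simp add: field_simps)
  moreover have "Jbar \<theta> - y / 592 + gain - 100 * (gain * e2) \<le> expect (fround \<theta>) Jbar"
    using 1 4 unfolding 2 by (simp add: algebra_simps)
  ultimately have "Jopt - expect (fround \<theta>) Jbar \<le> (Jopt - Jbar \<theta>) - gain / 592 + y"
    by linarith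
  then show ?thesis
    using 3 unfolding y_def[symmetric] by (simp add: left_diff_distrib)
qed

lemma fround_any: "Jopt - expect (fround \<theta>) Jbar \<le> (1 - k * mu / 2) * (Jopt - Jbar \<theta>) + noise s4 / mu"
proof (cases "\<exists>s a. softmax \<theta> s a \<le> 0.4 * \<tau>")
  case True
  then show ?thesis using fround_irregular by blast
next
  case False
  then have "Jopt - expect (fround \<theta>) Jbar \<le> (1 - k * mu / 2) * (Jopt - Jbar \<theta>) + k / 2 * noise s4"
    by (intro fround_regular) (auto simp: not_le intro: less_imp_le)
  moreover have "k / 2 * noise s4 \<le> noise s4 / mu"
  proof -
    have "y / 592 \<le> y" if "0 \<le> y" for y :: real using that by simp
    then show ?thesis using noise_nonneg[OF s4] mu_pos noise_ratio(1) by (meson divide_nonneg_pos order_trans)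
  qed
  ultimately show ?thesis by linarith
qed

section \<open>Iteration over the rounds\<close>

abbreviation "run \<equiv> rs_fedpg M \<gamma> lam \<rho> P r H B T \<eta> \<tau> tie"

lemma finite_run: "finite (set_pmf (run \<theta>\<^sub>0 R))"
  by (induction R) (auto simp: finite_fround)

lemma run_floor: "\<theta> \<in> set_pmf (run \<theta>\<^sub>0 (Suc R)) \<Longrightarrow> \<tau> / 2 \<le> softmax \<theta> s a"
  using fround_floor by auto

text \<open>Induction with the fixed additive level \<open>noise s4 / mu\<close>: the first round
  may use it up entirely, and regular rounds reproduce it.\<close>

lemma convergence:
  "Jopt - expect (run \<theta>\<^sub>0 R) Jbar \<le> (1 - k * mu / 2) ^ R * (Jopt - Jbar \<theta>\<^sub>0) + noise s4 / mu"
proof (induction R)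
  case 0
  then show ?case using noise_nonneg[OF s4] mu_pos by simp
next
  case (Suc R)
  let ?x = "k * mu / 2" and ?y = "noise s4 / mu"
  have x: "0 \<le> 1 - ?x" using k_mu_le by simp
  show ?case
  proof (cases R)
    case 0
    then show ?thesis using fround_any[of \<theta>\<^sub>0] by (simp add: bind_return_pmf)
  next
    case (Suc n)
    have "Jopt - expect (run \<theta>\<^sub>0 (Suc R)) Jbar = expect (run \<theta>\<^sub>0 R) (\<lambda>\<theta>. Jopt - expect (fround \<theta>) Jbar)"
      using finite_run finite_fround by (simp add: expect_bind)
    also have "\<dots> \<le> expect (run \<theta>\<^sub>0 R) (\<lambda>\<theta>. (1 - ?x) * (Jopt - Jbar \<theta>) + k / 2 * noise s4)"
    proof (rule expect_mono[OF finite_run])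
      fix \<theta> assume "\<theta> \<in> set_pmf (run \<theta>\<^sub>0 R)"
      then have "\<tau> / 2 \<le> softmax \<theta> s a" for s a using run_floor Suc by blast
      moreover have "0.4 * \<tau> \<le> \<tau> / 2" using tau by simp
      ultimately show "Jopt - expect (fround \<theta>) Jbar \<le> (1 - ?x) * (Jopt - Jbar \<theta>) + k / 2 * noise s4"
        by (intro fround_regular) (meson order_trans)
    qed
    also have "\<dots> = (1 - ?x) * (Jopt - expect (run \<theta>\<^sub>0 R) Jbar) + k / 2 * noise s4"
      using finite_run by simp
    also have "\<dots> \<le> (1 - ?x) * ((1 - ?x) ^ R * (Jopt - Jbar \<theta>\<^sub>0) + ?y) + k / 2 * noise s4"
      using Suc.IH x by (intro add_right_mono mult_left_mono)
    also have "\<dots> = (1 - ?x) ^ Suc R * (Jopt - Jbar \<theta>\<^sub>0) + ?y"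
    proof -
      \<comment> \<open>Fixed-point property of the noise level: contracting it and adding one noise
        share returns the same level.\<close>
      have "?x * ?y = k / 2 * noise s4" using mu_pos by simp
      then show ?thesis by (simp only: distrib_left left_diff_distrib power_Suc mult.assoc mult_1_left)
    qed
    finally show ?thesis .
  qed
qed

end

end

section \<open>Convergence of RS-FedPG\<close>

lemma eps_P_ge:
  fixes P :: "nat \<Rightarrow> ('s::finite, 'a::finite) kernel"
  assumes "c \<in> {1..M}" "c' \<in> {1..M}"
  shows "(\<Sum>s'\<in>UNIV. \<bar>pmf (P c s a) s' - pmf (P c' s a) s'\<bar>) \<le> eps_P M P"
proof -
  define g where "g s a c c' = (\<Sum>s'\<in>UNIV. \<bar>pmf (P c s a) s' - pmf (P c' s a) s'\<bar>)" for s a c c'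
  have "g s a c c' \<le> (MAX c'\<in>{1..M}. g s a c c')"
    by (intro Max_ge finite_imageI finite_atLeastAtMost imageI assms)
  also have "\<dots> \<le> (MAX c\<in>{1..M}. MAX c'\<in>{1..M}. g s a c c')"
    by (intro Max_ge finite_imageI finite_atLeastAtMost imageI assms)
  also have "\<dots> \<le> (MAX a. MAX c\<in>{1..M}. MAX c'\<in>{1..M}. g s a c c')"
    by (intro Max_ge finite_imageI finite_code rangeI) auto
  also have "\<dots> \<le> (MAX s. MAX a. MAX c\<in>{1..M}. MAX c'\<in>{1..M}. g s a c c')"
    by (intro Max_ge finite_imageI rangeI) auto
  finally show ?thesis by (simp only: g_def eps_P_def)
qed

lemma eps_r_ge:
  fixes r :: "nat \<Rightarrow> ('s::finite, 'a::finite) reward"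
  assumes "c \<in> {1..M}" "c' \<in> {1..M}"
  shows "\<bar>r c s a - r c' s a\<bar> \<le> eps_r M r"
proof -
  define g where "g c c' s a = \<bar>r c s a - r c' s a\<bar>" for c c' s a
  have "g c c' s a \<le> (MAX a. g c c' s a)"
    by (intro Max_ge finite_imageI rangeI) auto
  also have "\<dots> \<le> (MAX s. MAX a. g c c' s a)"
    by (intro Max_ge finite_imageI rangeI) auto
  also have "\<dots> \<le> (MAX c'\<in>{1..M}. MAX s. MAX a. g c c' s a)"
    by (intro Max_ge finite_imageI finite_atLeastAtMost imageI assms)
  also have "\<dots> \<le> (MAX c\<in>{1..M}. MAX c'\<in>{1..M}. MAX s. MAX a. g c c' s a)"
    by (intro Max_ge finite_imageI finite_atLeastAtMost imageI assms)
  finally show ?thesis by (simp only: g_def eps_r_def)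
qed

text \<open>The two upper bounds on \<open>tau\<close> are averaged in logarithmic form. Half of the
  exponent pays for the range of the soft Q-function; half of the polynomial bound pays for
  \<open>ln (2 * A)\<close> and the extra \<open>lam\<close>.\<close>

lemma threshold_gap:
  fixes \<gamma> lam A \<rho>m tau :: real
  assumes "0 < \<gamma>" "\<gamma> < 1" "0 < lam" "2 \<le> A" "0 < \<rho>m" "\<rho>m \<le> 1" "0 < tau"
    and tau: "tau \<le> 1 / 3 * exp (- ((16 + 8 * \<gamma> * lam * ln A) / (lam * (1 - \<gamma>)\<^sup>2 * \<rho>m)))"
      "tau \<le> 1 / (3 ^ 8 * A ^ 4)"
  shows "(1 + \<gamma> * lam * ln A) / (1 - \<gamma>) + lam \<le> lam * (- ln (2 * A) - ln tau)"
proof -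
  define u X where "u = \<gamma> * lam * ln A" and "X = (16 + 8 * \<gamma> * lam * ln A) / (lam * (1 - \<gamma>)\<^sup>2 * \<rho>m)"
  have lA: "0 \<le> ln A" using assms by simp
  have u: "0 \<le> u" unfolding u_def using assms lA by simp
  have l3: "1 \<le> ln (3::real)"
    using ln_ge_iff[of 3 1] exp_le by simp
  have l2: "ln (2::real) \<le> 1" using ln_le_minus_one[of 2] by simp
  have l2A: "ln (2 * A) = ln 2 + ln A" using assms(4) by (simp add: ln_mult)
  have "ln tau \<le> ln (1 / 3 * exp (- X))"
    using assms(7) tau(1) unfolding X_def by (intro ln_mono) auto
  also have "\<dots> = - ln 3 - X" by (subst ln_mult) (simp_all add: ln_div)
  finally have t1: "ln 3 + X \<le> - ln tau" by simp
  have "ln tau \<le> ln (1 / (3 ^ 8 * A ^ 4))"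
    using assms(4,7) tau(2) by (intro ln_mono) auto
  also have "\<dots> = - (8 * ln 3 + 4 * ln A)"
    using assms(4) ln_realpow[of 3 8] ln_realpow[of A 4] by (simp add: ln_div ln_mult)
  finally have t2: "8 * ln 3 + 4 * ln A \<le> - ln tau" by simp
  have "X / 2 + (4 * ln 3 + 2 * ln A) \<le> - ln tau" using t1 t2 l3 by linarith
  then have "X / 2 + 1 \<le> - ln (2 * A) - ln tau"
    using l2 l3 lA l2A by linarith
  then have "lam * (X / 2 + 1) \<le> lam * (- ln (2 * A) - ln tau)"
    using assms(3) by (intro mult_left_mono) auto
  moreover have "(1 + u) / (1 - \<gamma>) \<le> lam * (X / 2)"
  proof -
    have "(1 - \<gamma>)\<^sup>2 * \<rho>m \<le> (1 - \<gamma>) * 1 * 1"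
      unfolding power2_eq_square using assms by (intro mult_mono) auto
    then have "(1 + u) / (1 - \<gamma>) \<le> (8 + 4 * u) / ((1 - \<gamma>)\<^sup>2 * \<rho>m)"
      using assms u by (intro frac_le) auto
    also have "\<dots> = lam * (X / 2)"
      using assms by (simp add: X_def u_def field_simps)
    finally show ?thesis .
  qed
  ultimately show ?thesis
    unfolding u_def[symmetric] by (simp only: distrib_left mult_1_right)
qed

theorem theoremD13:
  fixes \<rho> :: "'s::finite pmf"
    and P :: "nat \<Rightarrow> ('s, 'a::finite) kernel"
    and r :: "nat \<Rightarrow> ('s, 'a) reward"
    and \<theta>\<^sub>0 :: "('s, 'a) param"
    and tie :: "('s \<Rightarrow> 'a \<Rightarrow> real) \<Rightarrow> ('s \<Rightarrow> 'a) pmf"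
    and M H B T R :: nat
    and \<gamma> lam \<eta> rho_min tau mu L2 L3 zeta_sq beta sigma2_sq sigma4_4 logA :: real
  assumes "M \<ge> 1" "H \<ge> 1" "B \<ge> 1" "T \<ge> 1"
    and "0 < \<gamma>" "\<gamma> < 1"
    and "\<And>c s a. c \<in> {1..M} \<Longrightarrow> 0 \<le> r c s a \<and> r c s a \<le> 1"
    and "argmax_rule tie"
    and "rho_min = (MIN s. pmf \<rho> s)" "rho_min > 0"
    and "CARD('a) \<ge> 2"
    and "logA = ln (real CARD('a))"
    and "lam > 0"
    and "tau = min ((1 / 3) * exp (- ((16 + 8 * \<gamma> * lam * logA) / (lam * (1 - \<gamma>)^2 * rho_min))))
                   (1 / (3^8 * real CARD('a)^4))"
    and "mu = lam * (1 - \<gamma>) * rho_min^2 * tau^2 / real CARD('s)"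
    and "L2 = (8 + lam * (4 + 8 * logA)) / (1 - \<gamma>)^3"
    and "L3 = (480 + 832 * lam * logA) / (1 - \<gamma>)^4"
    and "zeta_sq = 56 * (1 + lam * logA)^2 * (eps_P M P)^2 / (1 - \<gamma>)^6
                   + 36 * (eps_r M r)^2 / (1 - \<gamma>)^4"
    and "beta = 2 * (1 + lam * logA) * \<gamma>^T / (1 - \<gamma>) * (real T + 1 / (1 - \<gamma>))"
    and "sigma2_sq = (12 + 24 * lam^2 * logA^2) / (real B * (1 - \<gamma>)^4)"
    and "sigma4_4 = (1120 + 4480 * lam^4 * logA^4) / ((real B)^2 * (1 - \<gamma>)^8)"
    and "\<eta> > 0" "\<eta> * real H * L2 \<le> 1 / 74"
  shows "J_star M \<gamma> lam \<rho> P r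
           - measure_pmf.expectation (rs_fedpg M \<gamma> lam \<rho> P r H B T \<eta> tau tie \<theta>\<^sub>0 R)
               (J_avg M \<gamma> lam \<rho> P r)
         \<le> (1 - \<eta> * real H * mu / 2)^R * (J_star M \<gamma> lam \<rho> P r - J_avg M \<gamma> lam \<rho> P r \<theta>\<^sub>0)
           + 3 * \<eta> * L2 * sigma2_sq / (real M * mu)
           + zeta_sq / mu
           + 4 * beta^2 / mu
           + 8 * 12^3 * \<eta>^4 * L3^2 * real H * (real H - 1) * sigma4_4 / mu"
proof -
  note mu_eq = \<open>mu = _\<close> and zeta_eq = \<open>zeta_sq = _\<close> and tau_eq = \<open>tau = _\<close>
  let ?A = "real CARD('a)"
  have mdp: "soft_mdp (r c) \<gamma> lam logA" if "c \<in> {1..M}" for c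
    using assms that by unfold_locales auto
  have one: "1 \<in> {1..M}" using assms(1) by simp
  have L2: "soft_mdp.L2 \<gamma> lam logA = L2"
    unfolding soft_mdp.L2_def[OF mdp[OF one]] \<open>L2 = _\<close> ..
  have L3: "soft_mdp.L3 \<gamma> lam logA = L3"
    unfolding soft_mdp.L3_def[OF mdp[OF one]] \<open>L3 = _\<close> ..
  have beta: "soft_mdp.beta \<gamma> lam logA T = beta"
    unfolding soft_mdp.beta_def[OF mdp[OF one]] \<open>beta = _\<close> ..
  have s2: "soft_mdp.sigma2_sq \<gamma> lam logA B = sigma2_sq"
    unfolding soft_mdp.sigma2_sq_def[OF mdp[OF one]] \<open>sigma2_sq = _\<close> ..
  have rho: "rho_min \<le> pmf \<rho> s" for s
    unfolding assms(9) by (intro Min_le) auto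
  have rho1: "rho_min \<le> 1"
    using rho[of undefined] pmf_le_1[of \<rho> undefined] by linarith
  have A: "2 \<le> ?A" using assms(11) by simp
  have tau_pos: "0 < tau" unfolding tau_eq using A by simp
  have tau1: "tau \<le> 1 / 3 * exp (- ((16 + 8 * \<gamma> * lam * logA) / (lam * (1 - \<gamma>)^2 * rho_min)))"
    and tau2: "tau \<le> 1 / (3 ^ 8 * ?A ^ 4)"
    unfolding tau_eq by simp_all
  have tau3: "tau \<le> 1 / 10000"
  proof -
    have "(2::real) ^ 4 \<le> ?A ^ 4" using A by (intro power_mono) auto
    then have "1 / (3 ^ 8 * ?A ^ 4) \<le> 1 / 10000" by (intro divide_left_mono) auto
    with tau2 show ?thesis by linarith
  qed
  have tau4: "tau \<le> 1 / (2 * ?A\<^sup>2)"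
  proof -
    have "?A\<^sup>2 \<le> ?A ^ 4" using A by (intro power_increasing) auto
    then have "1 / (3 ^ 8 * ?A ^ 4) \<le> 1 / (2 * ?A\<^sup>2)" using A by (intro divide_left_mono mult_mono) auto
    with tau2 show ?thesis by linarith
  qed
  \<comment> \<open>The heterogeneity level is set to half of \<open>zeta_sq\<close>, since
    \<open>noise\<close> contains it twice; the constants of the gradient comparison fit, as
    \<open>16 \<le> 28\<close> and \<open>4 \<le> 18\<close>.\<close>
  interpret F: fedpg \<rho> P r M H B T \<gamma> lam logA \<eta> tau rho_min "zeta_sq / 2" "?A" tie
  proof (rule fedpg.intro)
    show "(norm (full_grad \<rho> (P c) (r c) \<gamma> lam \<theta> - full_grad \<rho> (P c') (r c') \<gamma> lam \<theta>))\<^sup>2 \<le> zeta_sq / 2"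
      if "c \<in> {1..M}" "c' \<in> {1..M}" for c c' \<theta>
    proof -
      have "(norm (full_grad \<rho> (P c) (r c) \<gamma> lam \<theta> - full_grad \<rho> (P c') (r c') \<gamma> lam \<theta>))\<^sup>2
          \<le> 16 * (1 + lam * logA)\<^sup>2 * (eps_P M P)\<^sup>2 / (1 - \<gamma>) ^ 6 + 4 * (eps_r M r)\<^sup>2 / (1 - \<gamma>) ^ 4"
        by (intro full_grad_heterogeneity mdp eps_P_ge eps_r_ge that)
      also have "\<dots> \<le> 28 * (1 + lam * logA)\<^sup>2 * (eps_P M P)\<^sup>2 / (1 - \<gamma>) ^ 6 + 18 * (eps_r M r)\<^sup>2 / (1 - \<gamma>) ^ 4"
        using assms(6) by (intro add_mono divide_right_mono mult_right_mono) auto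
      also have "\<dots> = zeta_sq / 2" by (simp add: zeta_eq add_divide_distrib)
      finally show ?thesis .
    qed
    show "(1 + \<gamma> * lam * logA) / (1 - \<gamma>) + lam \<le> lam * (- ln (2 * ?A) - ln tau)"
      using threshold_gap[of \<gamma> lam ?A rho_min tau] assms(5,6,10,13) A rho1 tau_pos tau1 tau2
      unfolding \<open>logA = _\<close> by simp
  qed (use assms(1-3,8,10,22,23) mdp rho tau_pos tau3 tau4 in \<open>simp_all add: L2\<close>)
  have s4: "sigma2_sq\<^sup>2 \<le> sigma4_4"
  proof -
    define v where "v = lam\<^sup>2 * logA\<^sup>2"
    \<comment> \<open>The mixed term is absorbed by the square and the constant, which leaves ample
      room below \<open>1120\<close> and \<open>4480\<close>.\<close>
    have "(12 + 24 * v)\<^sup>2 = 144 + 576 * v + 576 * v\<^sup>2" "2 * v \<le> 1 + v\<^sup>2"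
      using sum_squares_bound[of 1 v] by (simp_all add: power2_sum power_mult_distrib)
    then have "(12 + 24 * v)\<^sup>2 \<le> 1120 + 4480 * v\<^sup>2"
      using zero_le_power2[of v] by linarith
    then have "(12 + 24 * v)\<^sup>2 / ((real B)\<^sup>2 * (1 - \<gamma>) ^ 8) \<le> (1120 + 4480 * v\<^sup>2) / ((real B)\<^sup>2 * (1 - \<gamma>) ^ 8)"
      by (intro divide_right_mono) auto
    moreover have "sigma2_sq\<^sup>2 = (12 + 24 * v)\<^sup>2 / ((real B)\<^sup>2 * (1 - \<gamma>) ^ 8)"
      by (simp add: \<open>sigma2_sq = _\<close> v_def power_divide power_mult_distrib mult.assoc flip: power_mult)
    moreover have "sigma4_4 = (1120 + 4480 * v\<^sup>2) / ((real B)\<^sup>2 * (1 - \<gamma>) ^ 8)"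
      by (simp add: \<open>sigma4_4 = _\<close> v_def power_mult_distrib mult.assoc flip: power_mult)
    ultimately show ?thesis by simp
  qed
  have J: "J_agent \<gamma> lam \<rho> (P c) (r c) = F.Jc c" if "c \<in> {1..M}" for c
    using soft_mdp.J_agent_eq[OF mdp[OF that]] by (intro ext)
  have Javg: "J_avg M \<gamma> lam \<rho> P r = F.Jbar"
    by (intro ext) (simp add: J_avg_def F.Jbar_def F.avg_def J)
  have Jstar: "J_star M \<gamma> lam \<rho> P r = F.Jopt"
    by (simp add: J_star_def F.Jopt_def F.avg_def J)
  have mu: "F.mu = mu" unfolding F.mu_def mu_eq ..
  have noise: "F.noise sigma4_4 / mu = 3 * \<eta> * L2 * sigma2_sq / (real M * mu) + zeta_sq / mu + 4 * beta\<^sup>2 / mu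
      + 8 * 12 ^ 3 * \<eta> ^ 4 * L3\<^sup>2 * real H * (real H - 1) * sigma4_4 / mu"
    unfolding F.noise_def L2 L3 beta s2 add_divide_distrib by simp
  have "F.Jopt - measure_pmf.expectation (rs_fedpg M \<gamma> lam \<rho> P r H B T \<eta> tau tie \<theta>\<^sub>0 R) F.Jbar
      \<le> (1 - \<eta> * real H * F.mu / 2) ^ R * (F.Jopt - F.Jbar \<theta>\<^sub>0) + F.noise sigma4_4 / F.mu"
    by (rule F.convergence) (simp add: s2 s4)
  then show ?thesis
    unfolding mu noise Javg Jstar by (simp only: add.assoc)
qed

end
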